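(* Let $\omega=e-2$ and let $\Sigma_\omega\subset\mathbb R$ be the spectrum of the Almost Mathieu operator with coupling $b=2$ and frequency $\omega$. Each of the following open intervals is contained in the open spectral gap (bounded connected component of $\mathbb R\setminus\Sigma_\omega$) having the indicated label; in particular these 8 gaps are open (non-collapsed): \begin{itemize} \item $(-2.65714062500,\,-2.63451562500)$: label $-4$; \item $(-2.61414062500,\,-2.55656250000)$: label $3$; \item $(-2.48323437500,\,-0.801437500000)$: label $-1$; \item $(-0.589406250000,\,-0.096787500000)$: label $2$; \item $(0.096787500000,\,0.589406250000)$: label $-2$; \item $(0.801437500000,\,2.48323437500)$: label $1$; \item $(2.55656250000,\,2.61414062500)$: label $-3$; \item $(2.63451562500,\,2.65714062500)$: label $4$. \end{itemize} Moreover $(-\infty,-2.72603125000)$ and $(2.72603125000,+\infty)$ are contained in the lower and upper unbounded connected components of $\mathbb R\setminus\Sigma_\omega$, respectively (label $0$).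
   Context: The Almost Mathieu operator with coupling $b=2$, frequency $\omega$ and phase $\theta\in\mathbb T=\mathbb R/\mathbb Z$ acts on $\ell^2(\mathbb Z)$ by $$(H_{2,\omega,\theta}x)_n=x_{n+1}+x_{n-1}+2\cos(2\pi(\omega n+\theta))\,x_n,\qquad n\in\mathbb Z.$$ For irrational $\omega$ its spectrum is a compact subset of $\mathbb R$ independent of $\theta$, denoted $\Sigma_\omega$. A (open, non-collapsed) spectral gap is a connected component of $\mathbb R\setminus\Sigma_\omega$. The integrated density of states $N:\mathbb R\to[0,1]$ (the limit as $L\to\infty$ of $\frac1L$ times the number of eigenvalues $\le a$ of the restriction of the operator to $\{1,\dots,L\}$) is continuous, nondecreasing, and constant exactly on the components of $\mathbb R\setminus\Sigma_\omega$. By the Gap Labelling Theorem, on each bounded gap the value of $N$ is $\{k\omega\}$ for a unique integer $k$, called the label of the gap, where $\{\cdot\}$ denotes the fractional part. The two unbounded components (where $N=0$ and $N=1$) are given the label $0$. Here $e$ is the base of natural logarithms. *)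

theory Defs
  imports "HOL-Analysis.Infinite_Sum" "HOL-Analysis.Connected"
    "HOL-Analysis.Elementary_Metric_Spaces" "Jordan_Normal_Form.Char_Poly"
begin

definition l2 :: "(int \<Rightarrow> complex) set" where
  "l2 = {x. (\<lambda>n. (cmod (x n))\<^sup>2) summable_on UNIV}"

definition l2_norm :: "(int \<Rightarrow> complex) \<Rightarrow> real" where
  "l2_norm x = sqrt (\<Sum>\<^sub>\<infinity>n. (cmod (x n))\<^sup>2)"

text \<open>The spectrum of an everywhere defined operator on \<open>l2\<close>: the complement of the set of those
  \<open>z\<close> for which \<open>T - z\<close> is a bijection of \<open>l2\<close> with bounded inverse.\<close>

definition l2_spectrum :: "((int \<Rightarrow> complex) \<Rightarrow> int \<Rightarrow> complex) \<Rightarrow> complex set" where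
  "l2_spectrum T = {z. \<not> (bij_betw (\<lambda>x n. T x n - z * x n) l2 l2 \<and>
     (\<exists>C. \<forall>x\<in>l2. l2_norm x \<le> C * l2_norm (\<lambda>n. T x n - z * x n)))}"

definition amo_potential :: "real \<Rightarrow> real \<Rightarrow> int \<Rightarrow> real" where
  "amo_potential \<omega> \<theta> n = 2 * cos (2 * pi * (\<omega> * of_int n + \<theta>))"

definition amo :: "real \<Rightarrow> real \<Rightarrow> (int \<Rightarrow> complex) \<Rightarrow> int \<Rightarrow> complex" where
  "amo \<omega> \<theta> x n = x (n + 1) + x (n - 1) + complex_of_real (amo_potential \<omega> \<theta> n) * x n"

text \<open>The spectrum is kept as a function of the phase; the phase in \<open>\<real>/\<int>\<close> is represented by a real
  number, on which the operator depends only modulo 1.\<close>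

definition amo_spectrum :: "real \<Rightarrow> real \<Rightarrow> real set" where
  "amo_spectrum \<omega> \<theta> = {a. complex_of_real a \<in> l2_spectrum (amo \<omega> \<theta>)}"

text \<open>The restriction to \<open>{1..L}\<close>; matrix indices start at 0, so row \<open>i\<close> is the site \<open>i + 1\<close>.\<close>

definition amo_restriction :: "real \<Rightarrow> real \<Rightarrow> nat \<Rightarrow> real mat" where
  "amo_restriction \<omega> \<theta> L = mat L L (\<lambda>(i, j).
     if i = j then amo_potential \<omega> \<theta> (int i + 1)
     else if i = j + 1 \<or> j = i + 1 then 1 else 0)"

text \<open>Eigenvalues are counted with multiplicity.\<close>

definition eigenvalue_count :: "real mat \<Rightarrow> real \<Rightarrow> nat" where
  "eigenvalue_count A a = (\<Sum>x | eigenvalue A x \<and> x \<le> a. Polynomial.order x (char_poly A))"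

definition amo_ids :: "real \<Rightarrow> real \<Rightarrow> real \<Rightarrow> real" where
  "amo_ids \<omega> \<theta> a = lim (\<lambda>L. real (eigenvalue_count (amo_restriction \<omega> \<theta> L) a) / real L)"

text \<open>The gaps, including the two unbounded ones.\<close>

definition spectral_gaps :: "real \<Rightarrow> real \<Rightarrow> real set set" where
  "spectral_gaps \<omega> \<theta> = components (- amo_spectrum \<omega> \<theta>)"

text \<open>On a bounded gap, \<open>k\<close> is the unique integer for which the integrated density of states equals
  the fractional part of \<open>k\<omega>\<close>; the unbounded gaps have label 0 by convention.\<close>

definition has_gap_label :: "real \<Rightarrow> real \<Rightarrow> real set \<Rightarrow> int \<Rightarrow> bool" where
  "has_gap_label \<omega> \<theta> U k \<longleftrightarrow>
     (if bounded U
      then \<forall>j. (\<forall>a\<in>U. amo_ids \<omega> \<theta> a = frac (of_int j * \<omega>)) \<longleftrightarrow> j = k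
      else k = 0)"

definition in_bounded_gap :: "real \<Rightarrow> real \<Rightarrow> real set \<Rightarrow> int \<Rightarrow> bool" where
  "in_bounded_gap \<omega> \<theta> I k \<longleftrightarrow>
     (\<exists>U\<in>spectral_gaps \<omega> \<theta>. bounded U \<and> has_gap_label \<omega> \<theta> U k \<and> I \<subseteq> U)"

definition in_lower_gap :: "real \<Rightarrow> real \<Rightarrow> real set \<Rightarrow> bool" where
  "in_lower_gap \<omega> \<theta> I \<longleftrightarrow>
     (\<exists>U\<in>spectral_gaps \<omega> \<theta>. \<not> bdd_below U \<and> bdd_above U \<and> has_gap_label \<omega> \<theta> U 0 \<and> I \<subseteq> U)"

definition in_upper_gap :: "real \<Rightarrow> real \<Rightarrow> real set \<Rightarrow> bool" where
  "in_upper_gap \<omega> \<theta> I \<longleftrightarrow>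
     (\<exists>U\<in>spectral_gaps \<omega> \<theta>. bdd_below U \<and> \<not> bdd_above U \<and> has_gap_label \<omega> \<theta> U 0 \<and> I \<subseteq> U)"

end

theory Submission
  imports Defs "HOL-Complex_Analysis.Complex_Analysis"
begin

text \<open>The energies of the intervals are shown to lie outside the spectrum by exhibiting, for every phase and every energy of an
interval, a strictly invariant field of cones for the transfer matrices of the second order recurrence. An irrational rotation returns to a
short arc after one of two times, so it suffices to check finitely long columns of cones over the arc: if each column ends inside the cone in
which it started, the columns fit together along every orbit. The indefinite quadratic form that is positive on the cones
grows along all solutions. This yields a lower bound for the operator minus the energy, by summing the growth, and solvability, by shooting
between isotropic lines on finite windows: lemmas hyperbolic_bounded_below, hyperbolic_solvable and hyperbolic_resolvent.

The label comes from rotation numbers. By Sturm's theorem the number of eigenvalues of a truncated matrix above E is the number of sign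
changes of the Dirichlet solution at E (sturm_count), which differs by at most one from that of any other solution. For a
solution in the cone field the number of sign changes in each of the two columns is an integer that does not depend on
phase, energy or direction (column_count_constant). If a column of length N and winding number z has kap N - k z changes, the sum over returns
telescopes, and the density of sign changes is kap - k \<omega>; hence the integrated density of states is 1 - kap + k \<omega>, the
fractional part of k \<omega>. Inside a component of the resolvent set the counts of two energies differ by a bounded amount
(count_diff_bounded), so the value holds on the whole gap. Its two neighbours at infinity have densities 0 and 1.

The columns are found numerically and verified in integer arithmetic. A vector of a cone depends linearly on the phase
within a small cell; one step of a column multiplies by the transfer matrix, turns the two boundary vectors outwards by a bound for all
errors, and checks that the cone contains the image for both ends of the energy range (step_sound). Runs of this check over cells
covering the arc give four towers for positive energies and one for the upper component. Alternating signs and moving the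
phase by one half exchanges E and - E (counted_tower_mir), which yields the remaining intervals.\<close>

section \<open>Quadratic forms that grow along solutions\<close>

fun qf :: "real \<times> real \<times> real \<Rightarrow> real \<Rightarrow> real \<Rightarrow> real" where
  "qf (\<alpha>, \<beta>, \<gamma>) x z = \<alpha> * x\<^sup>2 + 2 * \<beta> * x * z + \<gamma> * z\<^sup>2"

text \<open>On the window from m to m + J, with the state at a site n being the pair of x n and x (n - 1), the forms increase
strictly along every solution. Each form has an isotropic vector, hence is indefinite; this is what makes the boundary
value problem on the window solvable below, while the growth alone makes its solution unique.\<close>

definition lyapunov :: "(int \<Rightarrow> real) \<Rightarrow> real \<Rightarrow> real \<Rightarrow> real \<Rightarrow> int \<Rightarrow> nat \<Rightarrow> (nat \<Rightarrow> real \<times> real \<times> real) \<Rightarrow> bool" where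
  "lyapunov V E l M m J k \<longleftrightarrow>
     (\<forall>j\<le>J. (case k j of (\<alpha>, \<beta>, \<gamma>) \<Rightarrow> \<bar>\<alpha>\<bar> \<le> M \<and> \<bar>\<beta>\<bar> \<le> M \<and> \<bar>\<gamma>\<bar> \<le> M) \<and>
        (\<exists>x z. (x, z) \<noteq> (0, 0) \<and> qf (k j) x z = 0)) \<and>
     (\<forall>j<J. \<forall>x z. qf (k j) x z + l * (x\<^sup>2 + z\<^sup>2) \<le> qf (k (Suc j)) ((E - V (m + int j)) * x - z) x)"

text \<open>Uniform constants on arbitrarily large windows replace a globally defined form, so that a form may be assembled from
pieces whose starting site depends on the window.\<close>

definition hyperbolic :: "(int \<Rightarrow> real) \<Rightarrow> real \<Rightarrow> bool" where
  "hyperbolic V E \<longleftrightarrow> (\<exists>l>0. \<exists>M\<ge>0. \<forall>a b. \<exists>m J k. m \<le> a \<and> b \<le> m + int J \<and> lyapunov V E l M m J k)"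

lemma qf_bound:
  assumes "\<bar>\<alpha>\<bar> \<le> M" "\<bar>\<beta>\<bar> \<le> M" "\<bar>\<gamma>\<bar> \<le> M"
  shows "\<bar>qf (\<alpha>, \<beta>, \<gamma>) x z\<bar> \<le> 2 * M * (x\<^sup>2 + z\<^sup>2)"
proof -
  have 1: "\<bar>\<alpha> * x\<^sup>2\<bar> \<le> M * x\<^sup>2" using assms by (simp add: abs_mult mult_right_mono)
  have 3: "\<bar>\<gamma> * z\<^sup>2\<bar> \<le> M * z\<^sup>2" using assms by (simp add: abs_mult mult_right_mono)
  have "2 * \<bar>x * z\<bar> \<le> x\<^sup>2 + z\<^sup>2"
    using sum_squares_bound[of "\<bar>x\<bar>" "\<bar>z\<bar>"] by (simp add: abs_mult)
  then have "\<bar>\<beta>\<bar> * (2 * \<bar>x * z\<bar>) \<le> M * (x\<^sup>2 + z\<^sup>2)"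
    using assms by (intro mult_mono) auto
  then have 2: "\<bar>2 * \<beta> * x * z\<bar> \<le> M * (x\<^sup>2 + z\<^sup>2)" by (simp add: abs_mult algebra_simps)
  show ?thesis using 1 2 3 by (simp add: algebra_simps)
qed

text \<open>A forcing term y costs at most a multiple of its square: the cross term is split by the inequality between the means,
and half of the growth absorbs the part containing the solution.\<close>

lemma forced_step:
  assumes l: "0 < l" and M: "0 \<le> M" "\<bar>\<alpha>\<bar> \<le> M" "\<bar>\<beta>\<bar> \<le> M" and w: "\<bar>w\<bar> \<le> B"
    and step: "q + l * (x\<^sup>2 + z\<^sup>2) \<le> qf (\<alpha>, \<beta>, \<gamma>) (w * x - z) x"
  shows "q + l / 2 * (x\<^sup>2 + z\<^sup>2) \<le> qf (\<alpha>, \<beta>, \<gamma>) (w * x - z + y) x + (4 / l * (M * (B + 1))\<^sup>2 + M) * y\<^sup>2"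
proof -
  define X where "X = w * x - z"
  define c where "c = M * (B + 1)"
  define s where "s = \<bar>x\<bar> + \<bar>z\<bar>"
  have B0: "0 \<le> B" using w by linarith
  have X: "\<bar>X\<bar> \<le> B * \<bar>x\<bar> + \<bar>z\<bar>"
    unfolding X_def using abs_triangle_ineq4[of "w*x" z] mult_right_mono[OF w, of "\<bar>x\<bar>"] by (simp add: abs_mult)
  have "\<bar>\<alpha> * X + \<beta> * x\<bar> \<le> \<bar>\<alpha>\<bar> * \<bar>X\<bar> + \<bar>\<beta>\<bar> * \<bar>x\<bar>"
    by (metis abs_mult abs_triangle_ineq)
  also have "\<dots> \<le> M * (B * \<bar>x\<bar> + \<bar>z\<bar>) + M * \<bar>x\<bar>"
    using M X by (intro add_mono mult_mono) auto
  also have "\<dots> \<le> c * s"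
    unfolding c_def s_def using M(1) B0 by (simp add: algebra_simps)
  finally have cs: "\<bar>\<alpha> * X + \<beta> * x\<bar> \<le> c * s" .
  have "s\<^sup>2 \<le> 2 * (x\<^sup>2 + z\<^sup>2)"
    unfolding s_def using sum_squares_bound[of "\<bar>x\<bar>" "\<bar>z\<bar>"] by (simp add: power2_eq_square algebra_simps)
  then have s2: "l / 4 * s\<^sup>2 \<le> l / 2 * (x\<^sup>2 + z\<^sup>2)"
    using mult_left_mono[of "s\<^sup>2" "2 * (x\<^sup>2 + z\<^sup>2)" "l / 4"] l by (simp add: field_simps)
  have "0 \<le> (sqrt (l / 4) * s - sqrt (4 / l) * (c * \<bar>y\<bar>))\<^sup>2" by simp
  also have "\<dots> = l / 4 * s\<^sup>2 - 2 * (sqrt (l / 4) * sqrt (4 / l)) * (s * c * \<bar>y\<bar>) + 4 / l * c\<^sup>2 * y\<^sup>2"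
    using l by (simp add: power2_diff power_mult_distrib algebra_simps)
  also have "sqrt (l / 4) * sqrt (4 / l) = 1"
    using l by (simp add: real_sqrt_mult[symmetric])
  finally have transfer_by: "2 * (c * s) * \<bar>y\<bar> \<le> l / 4 * s\<^sup>2 + 4 / l * c\<^sup>2 * y\<^sup>2" by (simp add: algebra_simps)
  have "\<bar>2 * (\<alpha> * X + \<beta> * x) * y\<bar> = 2 * \<bar>\<alpha> * X + \<beta> * x\<bar> * \<bar>y\<bar>" by (simp only: abs_mult abs_numeral)
  also have "\<dots> \<le> 2 * (c * s) * \<bar>y\<bar>" using cs by (simp add: mult_right_mono)
  finally have cross: "\<bar>2 * (\<alpha> * X + \<beta> * x) * y\<bar> \<le> l / 2 * (x\<^sup>2 + z\<^sup>2) + 4 / l * c\<^sup>2 * y\<^sup>2"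
    using transfer_by s2 by linarith
  have sq: "\<bar>\<alpha> * y\<^sup>2\<bar> \<le> M * y\<^sup>2" using M by (simp add: abs_mult mult_right_mono)
  have "qf (\<alpha>, \<beta>, \<gamma>) (X + y) x = qf (\<alpha>, \<beta>, \<gamma>) X x + 2 * (\<alpha> * X + \<beta> * x) * y + \<alpha> * y\<^sup>2"
    by (simp add: power2_eq_square algebra_simps)
  then show ?thesis
    using cross sq step unfolding X_def[symmetric] c_def[symmetric]
    by (simp add: algebra_simps)
qed

lemma window_energy:
  fixes x y :: "int \<Rightarrow> real"
  assumes l: "0 < l" and M: "0 \<le> M" and B: "\<And>n. \<bar>E - V n\<bar> \<le> B"
    and L: "lyapunov V E l M m J k"
    and eq: "\<And>n. m \<le> n \<Longrightarrow> n < m + int J \<Longrightarrow> x (n + 1) = (E - V n) * x n - x (n - 1) + y n"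
    and i: "i \<le> J"
  shows "qf (k 0) (x m) (x (m - 1)) + l / 2 * (\<Sum>j<i. (x (m + int j))\<^sup>2 + (x (m + int j - 1))\<^sup>2)
     \<le> qf (k i) (x (m + int i)) (x (m + int i - 1)) + (4 / l * (M * (B + 1))\<^sup>2 + M) * (\<Sum>j<i. (y (m + int j))\<^sup>2)"
  using i
proof (induction i)
  case 0
  then show ?case by simp
next
  case (Suc i)
  define n where "n = m + int i"
  obtain \<alpha> \<beta> \<gamma> where k: "k (Suc i) = (\<alpha>, \<beta>, \<gamma>)" by (cases "k (Suc i)") auto
  have kb: "\<bar>\<alpha>\<bar> \<le> M" "\<bar>\<beta>\<bar> \<le> M" using L Suc.prems k unfolding lyapunov_def by fastforce+
  have "qf (k i) (x n) (x (n - 1)) + l * ((x n)\<^sup>2 + (x (n - 1))\<^sup>2) \<le> qf (\<alpha>, \<beta>, \<gamma>) ((E - V n) * x n - x (n - 1)) (x n)"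
    using L Suc.prems unfolding lyapunov_def n_def k[symmetric] by auto
  from forced_step[OF l M kb B this, of "y n"] eq[of n] Suc.prems
  have "qf (k i) (x n) (x (n - 1)) + l / 2 * ((x n)\<^sup>2 + (x (n - 1))\<^sup>2)
     \<le> qf (k (Suc i)) (x (n + 1)) (x n) + (4 / l * (M * (B + 1))\<^sup>2 + M) * (y n)\<^sup>2"
    unfolding n_def k by simp
  moreover have "m + int (Suc i) = n + 1" "m + int (Suc i) - 1 = n" by (auto simp: n_def)
  ultimately show ?case using Suc.IH Suc.prems
    unfolding n_def by (simp add: algebra_simps)
qed

lemma finite_sum_sq_le:
  assumes "(\<lambda>n::int. (f n)\<^sup>2) summable_on UNIV"
  shows "(\<Sum>j<i. (f (m + int j))\<^sup>2) \<le> (\<Sum>\<^sub>\<infinity>n. (f n :: real)\<^sup>2)"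
proof -
  have "(\<Sum>j<i. (f (m + int j))\<^sup>2) = (\<Sum>n\<in>(\<lambda>j. m + int j) ` {..<i}. (f n)\<^sup>2)"
    by (subst sum.reindex) (auto simp: inj_on_def)
  also have "\<dots> \<le> (\<Sum>\<^sub>\<infinity>n. (f n)\<^sup>2)"
    using assms by (intro finite_sum_le_infsum) auto
  finally show ?thesis .
qed

lemma sum_window_ge:
  fixes f :: "int \<Rightarrow> real"
  assumes "finite S" "S \<subseteq> {m..<m + int J}"
  shows "(\<Sum>n\<in>S. (f n)\<^sup>2) \<le> (\<Sum>j<J. (f (m + int j))\<^sup>2 + (f (m + int j - 1))\<^sup>2)"
proof -
  have "(\<Sum>n\<in>S. (f n)\<^sup>2) \<le> (\<Sum>n\<in>(\<lambda>j. m + int j) ` {..<J}. (f n)\<^sup>2)"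
  proof (rule sum_mono2)
    show "S \<subseteq> (\<lambda>j. m + int j) ` {..<J}"
    proof
      fix n assume "n \<in> S"
      then have "m \<le> n" "n < m + int J" using assms by auto
      then show "n \<in> (\<lambda>j. m + int j) ` {..<J}" by (intro image_eqI[of _ _ "nat (n - m)"]) auto
    qed
  qed auto
  also have "\<dots> = (\<Sum>j<J. (f (m + int j))\<^sup>2)"
    by (subst sum.reindex) (auto simp: inj_on_def)
  also have "\<dots> \<le> (\<Sum>j<J. (f (m + int j))\<^sup>2 + (f (m + int j - 1))\<^sup>2)"
    by (intro sum_mono) auto
  finally show ?thesis .
qed

lemma summable_sq_small:
  assumes "(\<lambda>n::int. (x n :: real)\<^sup>2) summable_on UNIV" "0 < e"
  obtains R where "\<And>n. R < \<bar>n\<bar> \<Longrightarrow> (x n)\<^sup>2 < e"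
proof -
  obtain X where X: "finite X" "\<And>Y. finite Y \<Longrightarrow> X \<subseteq> Y \<Longrightarrow> dist (\<Sum>n\<in>Y. (x n)\<^sup>2) (\<Sum>\<^sub>\<infinity>n. (x n)\<^sup>2) < e / 2"
    using infsum_tendsto[OF assms(1)] assms(2)
    unfolding tendsto_iff eventually_finite_subsets_at_top
    by (smt (verit, best) UNIV_I half_gt_zero subset_UNIV)
  obtain R where R: "\<And>n. n \<in> X \<Longrightarrow> \<bar>n\<bar> \<le> R"
    using X(1) by (metis finite_imageI finite_nat_iff_bounded_le abs_of_nonneg bdd_above_finite bdd_above_def imageI)
  show ?thesis
  proof
    fix n assume n: "R < \<bar>n\<bar>"
    then have "n \<notin> X" using R by force
    then have "(\<Sum>n\<in>insert n X. (x n)\<^sup>2) = (x n)\<^sup>2 + (\<Sum>n\<in>X. (x n)\<^sup>2)" using X(1) by simp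
    moreover have "dist (\<Sum>n\<in>X. (x n)\<^sup>2) (\<Sum>\<^sub>\<infinity>n. (x n)\<^sup>2) < e / 2"
      "dist (\<Sum>n\<in>insert n X. (x n)\<^sup>2) (\<Sum>\<^sub>\<infinity>n. (x n)\<^sup>2) < e / 2"
      using X(2)[OF X(1) subset_refl] X(2)[OF finite.insertI[OF X(1)] subset_insertI] by this+
    ultimately show "(x n)\<^sup>2 < e" unfolding dist_real_def by arith
  qed
qed

text \<open>The energy inequality is summed over a window. For a square summable sequence the two boundary forms are arbitrarily
small far out, so that the growth term, which dominates the norm of x, is controlled by the forcing term alone.\<close>

lemma hyperbolic_bounded_below:
  fixes V :: "int \<Rightarrow> real"
  assumes hyp: "hyperbolic V E" and B: "\<And>n. \<bar>E - V n\<bar> \<le> B"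
  shows "\<exists>C>0. \<forall>x. (\<lambda>n. (x n)\<^sup>2) summable_on UNIV \<longrightarrow>
     (\<lambda>n. (x (n + 1) + x (n - 1) + V n * x n - E * x n)\<^sup>2) summable_on UNIV \<longrightarrow>
     (\<Sum>\<^sub>\<infinity>n. (x n)\<^sup>2) \<le> C * (\<Sum>\<^sub>\<infinity>n. (x (n + 1) + x (n - 1) + V n * x n - E * x n)\<^sup>2)"
proof -
  obtain l M where l: "0 < l" and M: "0 \<le> M"
    and win: "\<And>a b. \<exists>m J k. m \<le> a \<and> b \<le> m + int J \<and> lyapunov V E l M m J k"
    using hyp unfolding hyperbolic_def by blast
  define C0 where "C0 = 4 / l * (M * (B + 1))\<^sup>2 + M"
  have C0: "0 \<le> C0" unfolding C0_def using l M by simp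
  show ?thesis
  proof (intro exI[of _ "2 / l * C0 + 1"] conjI allI impI)
    show "0 < 2 / l * C0 + 1" using C0 l by (simp add: add_nonneg_pos)
    fix x :: "int \<Rightarrow> real"
    define y where "y n = x (n + 1) + x (n - 1) + V n * x n - E * x n" for n
    assume x: "(\<lambda>n. (x n)\<^sup>2) summable_on UNIV"
      and "(\<lambda>n. (x (n + 1) + x (n - 1) + V n * x n - E * x n)\<^sup>2) summable_on UNIV"
    then have y: "(\<lambda>n. (y n)\<^sup>2) summable_on UNIV" by (simp add: y_def)
    define Y where "Y = (\<Sum>\<^sub>\<infinity>n. (y n)\<^sup>2)"
    have Y0: "0 \<le> Y" unfolding Y_def by (intro infsum_nonneg) auto
    have fin: "(\<Sum>n\<in>S. (x n)\<^sup>2) \<le> (2 / l * C0 + 1) * Y" if S: "finite S" for S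
    proof (rule field_le_epsilon)
      fix e :: real assume e: "0 < e"
      define e' where "e' = e * l / (16 * (M + 1))"
      have e': "0 < e'" unfolding e'_def using e l M by simp
      obtain R where R: "\<And>n. R < \<bar>n\<bar> \<Longrightarrow> (x n)\<^sup>2 < e'" using summable_sq_small[OF x e'] by blast
      obtain R' where R': "\<And>n. n \<in> S \<Longrightarrow> \<bar>n\<bar> \<le> R'"
        using S by (metis abs_of_nonneg bdd_above_finite bdd_above_def finite_imageI imageI)
      define r where "r = max 0 (max R R')"
      obtain m J k where mJ: "m \<le> - r - 2" "r + 2 \<le> m + int J" and L: "lyapunov V E l M m J k"
        using win by blast
      have end_bd: "\<bar>qf (k i) (x a) (x b)\<bar> \<le> 4 * M * e'" if "i \<le> J" "R < \<bar>a\<bar>" "R < \<bar>b\<bar>" for i a b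
      proof -
        obtain \<alpha> \<beta> \<gamma> where k: "k i = (\<alpha>, \<beta>, \<gamma>)" by (cases "k i") auto
        have "\<bar>\<alpha>\<bar> \<le> M" "\<bar>\<beta>\<bar> \<le> M" "\<bar>\<gamma>\<bar> \<le> M" using L that(1) k unfolding lyapunov_def by fastforce+
        from qf_bound[OF this, of "x a" "x b"]
        have "\<bar>qf (k i) (x a) (x b)\<bar> \<le> 2 * M * ((x a)\<^sup>2 + (x b)\<^sup>2)" by (simp add: k)
        also have "\<dots> \<le> 2 * M * (e' + e')"
          using R[OF that(2)] R[OF that(3)] M by (intro mult_left_mono) auto
        finally show ?thesis by simp
      qed
      have "qf (k 0) (x m) (x (m - 1)) + l / 2 * (\<Sum>j<J. (x (m + int j))\<^sup>2 + (x (m + int j - 1))\<^sup>2)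
         \<le> qf (k J) (x (m + int J)) (x (m + int J - 1)) + C0 * (\<Sum>j<J. (y (m + int j))\<^sup>2)"
        unfolding C0_def by (rule window_energy[OF l M B L]) (auto simp: y_def algebra_simps)
      moreover have "\<bar>qf (k 0) (x m) (x (m - 1))\<bar> \<le> 4 * M * e'"
        using mJ by (intro end_bd) (auto simp: r_def)
      moreover have "\<bar>qf (k J) (x (m + int J)) (x (m + int J - 1))\<bar> \<le> 4 * M * e'"
        using mJ by (intro end_bd) (auto simp: r_def)
      moreover have "C0 * (\<Sum>j<J. (y (m + int j))\<^sup>2) \<le> C0 * Y"
        using finite_sum_sq_le[OF y] C0 unfolding Y_def by (intro mult_left_mono) auto
      moreover have "(\<Sum>n\<in>S. (x n)\<^sup>2) \<le> (\<Sum>j<J. (x (m + int j))\<^sup>2 + (x (m + int j - 1))\<^sup>2)"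
      proof (rule sum_window_ge[OF S], rule subsetI)
        fix n assume "n \<in> S"
        with R'[of n] mJ show "n \<in> {m..<m + int J}" unfolding r_def by auto
      qed
      then have "l / 2 * (\<Sum>n\<in>S. (x n)\<^sup>2) \<le> l / 2 * (\<Sum>j<J. (x (m + int j))\<^sup>2 + (x (m + int j - 1))\<^sup>2)"
        using l by (intro mult_left_mono) auto
      ultimately have "l / 2 * (\<Sum>n\<in>S. (x n)\<^sup>2) \<le> 8 * M * e' + C0 * Y" by linarith
      moreover have "8 * M * e' \<le> l / 2 * e"
        unfolding e'_def using M e l by (simp add: field_simps)
      ultimately have "l / 2 * (\<Sum>n\<in>S. (x n)\<^sup>2) \<le> l / 2 * e + C0 * Y" by linarith
      then have "(\<Sum>n\<in>S. (x n)\<^sup>2) \<le> e + 2 / l * C0 * Y" using l by (simp add: field_simps)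
      then show "(\<Sum>n\<in>S. (x n)\<^sup>2) \<le> (2 / l * C0 + 1) * Y + e" using Y0 by (simp add: algebra_simps)
    qed
    show "(\<Sum>\<^sub>\<infinity>n. (x n)\<^sup>2) \<le> (2 / l * C0 + 1) * (\<Sum>\<^sub>\<infinity>n. (x (n + 1) + x (n - 1) + V n * x n - E * x n)\<^sup>2)"
      using infsum_le_finite_sums[OF x, of "(2 / l * C0 + 1) * Y"] fin unfolding Y_def y_def by auto
  qed
qed

text \<open>The forced recurrence in vector form; the solution set with initial vector on a line is one affine line.\<close>

fun shoot :: "(nat \<Rightarrow> real) \<Rightarrow> (nat \<Rightarrow> real) \<Rightarrow> real \<Rightarrow> real \<Rightarrow> nat \<Rightarrow> real \<times> real" where
  "shoot w y a b 0 = (a, b)"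
| "shoot w y a b (Suc j) = (w j * fst (shoot w y a b j) - snd (shoot w y a b j) + y j, fst (shoot w y a b j))"

lemma shoot_affine:
  "fst (shoot w y (s * a) (s * b) j) = s * fst (shoot w (\<lambda>_. 0) a b j) + fst (shoot w y 0 0 j)"
  "snd (shoot w y (s * a) (s * b) j) = s * snd (shoot w (\<lambda>_. 0) a b j) + snd (shoot w y 0 0 j)"
  by (induction j) (auto simp: algebra_simps)

lemma qf_scale: "qf k (t * x) (t * z) = t\<^sup>2 * qf k x z"
  by (cases k) (simp add: power2_eq_square algebra_simps)

lemma parallel_qf_zero:
  assumes "a * d = b * c" "(c, d) \<noteq> (0, 0)" "qf k c d = 0"
  shows "qf k a b = (0::real)"
proof -
  have "\<exists>t. a = t * c \<and> b = t * d"
  proof (cases "c = 0")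
    case True
    then show ?thesis using assms by (intro exI[of _ "b / d"]) auto
  next
    case False
    then show ?thesis using assms by (intro exI[of _ "a / c"]) (auto simp: field_simps)
  qed
  then show ?thesis using assms(3) by (auto simp: qf_scale)
qed

text \<open>Shooting from the isotropic line of the first form: without forcing the last form is positive on the image of that
line, so the image is not contained in an isotropic line of the last form, and a suitable multiple of the initial
vector lands on one. Both boundary terms of the energy inequality then vanish, which bounds the solution independently
of the window.\<close>

lemma window_solution:
  fixes y :: "int \<Rightarrow> real"
  assumes l: "0 < l" and L: "lyapunov V E l M m J k" and J: "0 < J"
  shows "\<exists>x. (\<forall>n. m \<le> n \<longrightarrow> n < m + int J \<longrightarrow> x (n + 1) = (E - V n) * x n - x (n - 1) + y n) \<and>
    qf (k 0) (x m) (x (m - 1)) = 0 \<and> qf (k J) (x (m + int J)) (x (m + int J - 1)) = 0"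
proof -
  define w where "w j = E - V (m + int j)" for j
  define f where "f j = y (m + int j)" for j
  obtain a b where ab: "(a, b) \<noteq> (0, 0)" "qf (k 0) a b = 0" using L unfolding lyapunov_def by blast
  obtain c d where cd: "(c, d) \<noteq> (0, 0)" "qf (k J) c d = 0" using L unfolding lyapunov_def by blast
  define h where "h = shoot w (\<lambda>_. 0) a b"
  define p where "p = shoot w f 0 0"
  have step: "qf (k j) (fst (h j)) (snd (h j)) + l * ((fst (h j))\<^sup>2 + (snd (h j))\<^sup>2)
      \<le> qf (k (Suc j)) (fst (h (Suc j))) (snd (h (Suc j)))" if "j < J" for j
    using L that unfolding lyapunov_def by (simp add: h_def w_def)
  have pos0: "0 < (fst (h 0))\<^sup>2 + (snd (h 0))\<^sup>2"
    using ab(1) by (auto simp: h_def sum_power2_gt_zero_iff)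
  have "0 < qf (k (Suc j)) (fst (h (Suc j))) (snd (h (Suc j)))" if "Suc j \<le> J" for j
    using that
  proof (induction j)
    case 0
    have "qf (k 0) (fst (h 0)) (snd (h 0)) = 0" using ab by (simp add: h_def)
    moreover have "0 < l * ((fst (h 0))\<^sup>2 + (snd (h 0))\<^sup>2)" using l pos0 by simp
    ultimately show ?case using step[of 0] 0 by linarith
  next
    case (Suc j)
    moreover have "0 \<le> l * ((fst (h (Suc j)))\<^sup>2 + (snd (h (Suc j)))\<^sup>2)" using l by simp
    ultimately show ?case using step[of "Suc j"] by linarith
  qed
  from this[of "J - 1"] J have hJ: "0 < qf (k J) (fst (h J)) (snd (h J))" by simp
  have nz: "fst (h J) * d - snd (h J) * c \<noteq> 0"
    using parallel_qf_zero[OF _ cd, of "fst (h J)" "snd (h J)"] hJ by auto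
  define s where "s = (snd (p J) * c - fst (p J) * d) / (fst (h J) * d - snd (h J) * c)"
  define v where "v = shoot w f (s * a) (s * b)"
  have "fst (v J) * d = snd (v J) * c"
  proof -
    have "s * (fst (h J) * d - snd (h J) * c) = snd (p J) * c - fst (p J) * d" unfolding s_def using nz by simp
    then show ?thesis unfolding v_def shoot_affine h_def p_def by (simp add: algebra_simps)
  qed
  then have vJ: "qf (k J) (fst (v J)) (snd (v J)) = 0" using parallel_qf_zero[OF _ cd] by blast
  define x where "x n = (if m \<le> n then fst (v (nat (n - m))) else s * b)" for n
  have x1: "x (m + int j) = fst (v j)" for j by (simp add: x_def)
  have x2: "x (m + int j - 1) = snd (v j)" for j
  proof (cases j)
    case 0
    then show ?thesis by (simp add: x_def v_def)
  next
    case (Suc i)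
    then have "m + int j - 1 = m + int i" by simp
    then show ?thesis using x1[of i] Suc by (simp add: v_def)
  qed
  show ?thesis
  proof (intro exI[of _ x] conjI allI impI)
    fix n assume n: "m \<le> n" "n < m + int J"
    define j where "j = nat (n - m)"
    have nj: "n = m + int j" "n + 1 = m + int (Suc j)" using n by (auto simp: j_def)
    have "fst (v (Suc j)) = w j * fst (v j) - snd (v j) + f j" by (simp add: v_def)
    then show "x (n + 1) = (E - V n) * x n - x (n - 1) + y n"
      using x1[of j] x1[of "Suc j"] x2[of j] unfolding nj(2) by (simp add: w_def f_def nj(1))
  next
    show "qf (k 0) (x m) (x (m - 1)) = 0"
      using x1[of 0] x2[of 0] ab(2) by (simp add: v_def qf_scale)
  next
    show "qf (k J) (x (m + int J)) (x (m + int J - 1)) = 0"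
      using vJ by (simp only: x1 x2)
  qed
qed

text \<open>Solutions on growing windows are bounded uniformly in l2 by the energy inequality; a diagonal subsequence converges at
every site and its limit is the required solution. With the lower bound this gives a bounded inverse without any
spectral theory.\<close>

lemma hyperbolic_solvable:
  fixes V y :: "int \<Rightarrow> real"
  assumes hyp: "hyperbolic V E" and B: "\<And>n. \<bar>E - V n\<bar> \<le> B"
    and y: "(\<lambda>n. (y n)\<^sup>2) summable_on UNIV"
  shows "\<exists>x. (\<lambda>n. (x n)\<^sup>2) summable_on UNIV \<and> (\<forall>n. x (n + 1) + x (n - 1) + V n * x n - E * x n = y n)"
proof -
  obtain l M where l: "0 < l" and M: "0 \<le> M"
    and win: "\<And>a b. \<exists>m J k. m \<le> a \<and> b \<le> m + int J \<and> lyapunov V E l M m J k"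
    using hyp unfolding hyperbolic_def by blast
  define C0 where "C0 = 4 / l * (M * (B + 1))\<^sup>2 + M"
  have C0: "0 \<le> C0" unfolding C0_def using l M by simp
  define Y where "Y = (\<Sum>\<^sub>\<infinity>n. (y n)\<^sup>2)"
  define K where "K = 2 / l * (C0 * Y)"
  have "\<exists>x. (\<forall>n. \<bar>n\<bar> \<le> int R \<longrightarrow> x (n + 1) = (E - V n) * x n - x (n - 1) + y n) \<and>
     (\<forall>S. finite S \<longrightarrow> S \<subseteq> {- int R .. int R} \<longrightarrow> (\<Sum>n\<in>S. (x n)\<^sup>2) \<le> K)" for R :: nat
  proof -
    obtain m J k where mJ: "m \<le> - int R - 1" "int R + 2 \<le> m + int J" and L: "lyapunov V E l M m J k"
      using win by blast
    have J: "0 < J" using mJ by linarith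
    from window_solution[OF l L J, where y = y]
    obtain x where x: "\<And>n. m \<le> n \<Longrightarrow> n < m + int J \<Longrightarrow> x (n + 1) = (E - V n) * x n - x (n - 1) + y n"
      "qf (k 0) (x m) (x (m - 1)) = 0" "qf (k J) (x (m + int J)) (x (m + int J - 1)) = 0"
      by blast
    have "qf (k 0) (x m) (x (m - 1)) + l / 2 * (\<Sum>j<J. (x (m + int j))\<^sup>2 + (x (m + int j - 1))\<^sup>2)
         \<le> qf (k J) (x (m + int J)) (x (m + int J - 1)) + C0 * (\<Sum>j<J. (y (m + int j))\<^sup>2)"
      unfolding C0_def by (rule window_energy[OF l M B L x(1)]) auto
    also have "\<dots> \<le> C0 * Y"
      unfolding x(3) Y_def using finite_sum_sq_le[OF y] C0 by (simp add: mult_left_mono)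
    finally have le: "(\<Sum>j<J. (x (m + int j))\<^sup>2 + (x (m + int j - 1))\<^sup>2) \<le> K"
      unfolding x(2) K_def using l by (simp add: field_simps)
    have "(\<Sum>n\<in>S. (x n)\<^sup>2) \<le> K" if "finite S" "S \<subseteq> {- int R .. int R}" for S
    proof -
      have "S \<subseteq> {m..<m + int J}" using that(2) mJ by (intro subsetI) (drule subsetD, assumption, simp)
      from sum_window_ge[OF that(1) this, of x] le show ?thesis by linarith
    qed
    moreover have "x (n + 1) = (E - V n) * x n - x (n - 1) + y n" if "\<bar>n\<bar> \<le> int R" for n
      using x(1)[of n] that mJ by auto
    ultimately show ?thesis by (intro exI[of _ x] conjI allI impI)
  qed
  then have "\<exists>X. \<forall>R. (\<forall>n. \<bar>n\<bar> \<le> int R \<longrightarrow> X R (n + 1) = (E - V n) * X R n - X R (n - 1) + y n) \<and>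
     (\<forall>S. finite S \<longrightarrow> S \<subseteq> {- int R .. int R} \<longrightarrow> (\<Sum>n\<in>S. (X R n)\<^sup>2) \<le> K)"
    by (intro choice allI)
  then obtain X where XX: "\<forall>R. (\<forall>n. \<bar>n\<bar> \<le> int R \<longrightarrow> X R (n + 1) = (E - V n) * X R n - X R (n - 1) + y n) \<and>
     (\<forall>S. finite S \<longrightarrow> S \<subseteq> {- int R .. int R} \<longrightarrow> (\<Sum>n\<in>S. (X R n)\<^sup>2) \<le> K)" ..
  have X: "X R (n + 1) = (E - V n) * X R n - X R (n - 1) + y n" if "\<bar>n\<bar> \<le> int R" for R n
    using spec[OF XX, of R] that by simp
  have XK: "(\<Sum>n\<in>S. (X R n)\<^sup>2) \<le> K" if "finite S" "S \<subseteq> {- int R .. int R}" for R S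
    using spec[OF XX, of R] that by simp
  define f where "f R n = (if \<bar>n\<bar> \<le> int R then X R n else 0)" for R n
  have fb: "norm (f R n) \<le> sqrt \<bar>K\<bar>" for R n
  proof -
    have "(X R n)\<^sup>2 \<le> K" if "\<bar>n\<bar> \<le> int R" using XK[of "{n}" R] that by (simp add: abs_le_iff)
    then have "(f R n)\<^sup>2 \<le> \<bar>K\<bar>" by (cases "\<bar>n\<bar> \<le> int R") (auto simp: f_def intro: order_trans)
    then show ?thesis using real_le_rsqrt[of "\<bar>f R n\<bar>"] by (simp only: real_norm_def power2_abs)
  qed
  obtain r where r: "strict_mono (r :: nat \<Rightarrow> nat)" "\<And>n. \<exists>l. (\<lambda>i. f (r i) n) \<longlonglongrightarrow> l"
    by (rule function_convergent_subsequence[of "UNIV :: int set" f "sqrt \<bar>K\<bar>"]) (use fb in simp_all)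
  have "\<exists>x. \<forall>n. (\<lambda>i. f (r i) n) \<longlonglongrightarrow> x n" by (intro choice allI r(2))
  then obtain x where lim: "\<forall>n. (\<lambda>i. f (r i) n) \<longlonglongrightarrow> x n" ..
  have fX: "eventually (\<lambda>i. f (r i) n = X (r i) n) sequentially" for n
    using eventually_ge_at_top[of "nat \<bar>n\<bar>"]
  proof eventually_elim
    case (elim i)
    then have "\<bar>n\<bar> \<le> int (r i)" using seq_suble[OF r(1), of i] by linarith
    then show ?case by (simp add: f_def)
  qed
  have limX: "(\<lambda>i. X (r i) n) \<longlonglongrightarrow> x n" for n
    using spec[OF lim, of n] unfolding tendsto_cong[OF fX[of n]] .
  have big: "eventually (\<lambda>i. N \<le> r i) sequentially" for N
    using filterlim_subseq[OF r(1)] unfolding filterlim_at_top by blast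
  show ?thesis
  proof (intro exI[of _ x] conjI allI)
    have "(\<Sum>n\<in>S. (x n)\<^sup>2) \<le> K" if S: "finite S" for S
    proof (rule tendsto_upperbound)
      show "(\<lambda>i. \<Sum>n\<in>S. (X (r i) n)\<^sup>2) \<longlonglongrightarrow> (\<Sum>n\<in>S. (x n)\<^sup>2)"
        by (intro tendsto_intros limX)
      obtain N where N: "\<And>n. n \<in> S \<Longrightarrow> \<bar>n\<bar> \<le> N"
        using S by (metis abs_of_nonneg bdd_above_finite bdd_above_def finite_imageI imageI)
      show "eventually (\<lambda>i. (\<Sum>n\<in>S. (X (r i) n)\<^sup>2) \<le> K) sequentially"
        using big[of "nat N"]
      proof eventually_elim
        case (elim i)
        show ?case
        proof (rule XK[OF S], rule subsetI)
          fix n assume "n \<in> S"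
          with N[of n] elim show "n \<in> {- int (r i) .. int (r i)}" by auto
        qed
      qed
    qed simp
    then show "(\<lambda>n. (x n)\<^sup>2) summable_on UNIV"
      by (intro nonneg_bounded_partial_sums_imp_summable_on[of _ _ K]) auto
  next
    fix n
    have "(\<lambda>i. X (r i) (n + 1) + X (r i) (n - 1) + V n * X (r i) n - E * X (r i) n) \<longlonglongrightarrow> x (n + 1) + x (n - 1) + V n * x n - E * x n"
      by (intro tendsto_intros limX)
    moreover have "eventually (\<lambda>i. X (r i) (n + 1) + X (r i) (n - 1) + V n * X (r i) n - E * X (r i) n = y n) sequentially"
      using big[of "nat \<bar>n\<bar>"]
    proof eventually_elim
      case (elim i)
      then show ?case using X[of n "r i"] by (simp add: algebra_simps)
    qed
    ultimately show "x (n + 1) + x (n - 1) + V n * x n - E * x n = y n"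
      by (rule LIMSEQ_unique[OF _ tendsto_eventually])
  qed
qed

section \<open>Hyperbolic energies lie in the resolvent set\<close>

definition jacobi :: "(int \<Rightarrow> real) \<Rightarrow> (int \<Rightarrow> complex) \<Rightarrow> int \<Rightarrow> complex" where
  "jacobi V x n = x (n + 1) + x (n - 1) + complex_of_real (V n) * x n"

lemma l2_iff: "x \<in> l2 \<longleftrightarrow> (\<lambda>n. (Re (x n))\<^sup>2) summable_on UNIV \<and> (\<lambda>n. (Im (x n))\<^sup>2) summable_on UNIV"
proof
  assume "x \<in> l2"
  then have s: "(\<lambda>n. (cmod (x n))\<^sup>2) summable_on UNIV" by (simp add: l2_def)
  show "(\<lambda>n. (Re (x n))\<^sup>2) summable_on UNIV \<and> (\<lambda>n. (Im (x n))\<^sup>2) summable_on UNIV"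
    by (intro conjI; rule summable_on_comparison_test[OF s]) (auto simp: cmod_power2)
next
  assume "(\<lambda>n. (Re (x n))\<^sup>2) summable_on UNIV \<and> (\<lambda>n. (Im (x n))\<^sup>2) summable_on UNIV"
  then have "(\<lambda>n. (Re (x n))\<^sup>2 + (Im (x n))\<^sup>2) summable_on UNIV" by (intro summable_on_add) auto
  then show "x \<in> l2" by (simp add: l2_def cmod_power2)
qed

lemma l2_norm_sq:
  assumes "x \<in> l2"
  shows "(l2_norm x)\<^sup>2 = (\<Sum>\<^sub>\<infinity>n. (Re (x n))\<^sup>2) + (\<Sum>\<^sub>\<infinity>n. (Im (x n))\<^sup>2)"
proof -
  have "(l2_norm x)\<^sup>2 = (\<Sum>\<^sub>\<infinity>n. (cmod (x n))\<^sup>2)"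
    unfolding l2_norm_def by (intro real_sqrt_pow2 infsum_nonneg) auto
  also have "\<dots> = (\<Sum>\<^sub>\<infinity>n. (Re (x n))\<^sup>2 + (Im (x n))\<^sup>2)" by (simp add: cmod_power2)
  also have "\<dots> = (\<Sum>\<^sub>\<infinity>n. (Re (x n))\<^sup>2) + (\<Sum>\<^sub>\<infinity>n. (Im (x n))\<^sup>2)"
    using assms by (intro infsum_add) (auto simp: l2_iff)
  finally show ?thesis .
qed

lemma l2_norm_nonneg: "0 \<le> l2_norm x"
  unfolding l2_norm_def by (intro real_sqrt_ge_zero infsum_nonneg) auto

lemma summable_sq_shift:
  fixes f :: "int \<Rightarrow> real"
  assumes "(\<lambda>n. (f n)\<^sup>2) summable_on UNIV"
  shows "(\<lambda>n. (f (n + c))\<^sup>2) summable_on UNIV"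
  using summable_on_reindex_bij_betw[of "\<lambda>n. n + c" UNIV UNIV "\<lambda>n. (f n)\<^sup>2"] assms
  by (simp add: bij_betw_def inj_on_def surj_plus_right)

lemma summable_sq_add:
  fixes f g :: "int \<Rightarrow> real"
  assumes "(\<lambda>n. (f n)\<^sup>2) summable_on UNIV" "(\<lambda>n. (g n)\<^sup>2) summable_on UNIV"
  shows "(\<lambda>n. (f n + g n)\<^sup>2) summable_on UNIV"
proof (rule summable_on_comparison_test)
  show "(\<lambda>n. 2 * (f n)\<^sup>2 + 2 * (g n)\<^sup>2) summable_on UNIV"
    by (intro summable_on_add summable_on_cmult_right assms)
  show "(f n + g n)\<^sup>2 \<le> 2 * (f n)\<^sup>2 + 2 * (g n)\<^sup>2" for n
    using sum_squares_bound[of "f n" "g n"] by (simp add: power2_sum)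
qed auto

lemma summable_sq_mult:
  fixes f g :: "int \<Rightarrow> real"
  assumes "(\<lambda>n. (f n)\<^sup>2) summable_on UNIV" "\<And>n. \<bar>g n\<bar> \<le> B"
  shows "(\<lambda>n. (g n * f n)\<^sup>2) summable_on UNIV"
proof (rule summable_on_comparison_test)
  show "(\<lambda>n. B\<^sup>2 * (f n)\<^sup>2) summable_on UNIV"
    by (intro summable_on_cmult_right assms)
  show "(g n * f n)\<^sup>2 \<le> B\<^sup>2 * (f n)\<^sup>2" for n
    using power_mono[OF assms(2)[of n], of 2] by (simp add: power_mult_distrib mult_right_mono)
qed auto

lemma hyperbolic_resolvent:
  assumes hyp: "hyperbolic V E" and B: "\<And>n. \<bar>V n\<bar> \<le> b"
  shows "complex_of_real E \<notin> l2_spectrum (jacobi V)"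
proof -
  define B where "B = \<bar>E\<bar> + b"
  have EB: "\<bar>E - V n\<bar> \<le> B" for n unfolding B_def using B[of n] by linarith
  define T where "T x n = jacobi V x n - complex_of_real E * x n" for x :: "int \<Rightarrow> complex" and n
  have T: "(\<lambda>n. jacobi V x n - complex_of_real E * x n) = T x"
    "(\<lambda>x n. jacobi V x n - complex_of_real E * x n) = T" for x
    by (simp_all add: T_def[abs_def])
  have Re_T: "Re (T x n) = Re (x (n + 1)) + Re (x (n - 1)) + V n * Re (x n) - E * Re (x n)"
    and Im_T: "Im (T x n) = Im (x (n + 1)) + Im (x (n - 1)) + V n * Im (x n) - E * Im (x n)" for x n
    by (simp_all add: T_def jacobi_def)
  have real_T: "(\<lambda>n. (f (n + 1) + f (n - 1) + V n * f n - E * f n)\<^sup>2) summable_on UNIV"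
    if "(\<lambda>n. (f n)\<^sup>2) summable_on UNIV" for f :: "int \<Rightarrow> real"
  proof -
    have "(\<lambda>n. (f (n + 1) + f (n + - 1) + (V n - E) * f n)\<^sup>2) summable_on UNIV"
      using EB by (intro summable_sq_add summable_sq_shift summable_sq_mult[of _ _ B] that) (simp_all add: abs_minus_commute)
    then show ?thesis by (simp add: algebra_simps)
  qed
  have T_l2: "T x \<in> l2" if "x \<in> l2" for x
    using real_T[of "\<lambda>n. Re (x n)"] real_T[of "\<lambda>n. Im (x n)"] that by (simp add: l2_iff Re_T Im_T)
  obtain C where C0: "0 < C" and "\<forall>x. (\<lambda>n. (x n)\<^sup>2) summable_on UNIV \<longrightarrow>
     (\<lambda>n. (x (n + 1) + x (n - 1) + V n * x n - E * x n)\<^sup>2) summable_on UNIV \<longrightarrow>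
     (\<Sum>\<^sub>\<infinity>n. (x n)\<^sup>2) \<le> C * (\<Sum>\<^sub>\<infinity>n. (x (n + 1) + x (n - 1) + V n * x n - E * x n)\<^sup>2)"
    using hyperbolic_bounded_below[OF hyp EB] by auto
  then have C: "(\<Sum>\<^sub>\<infinity>n. (f n)\<^sup>2) \<le> C * (\<Sum>\<^sub>\<infinity>n. (f (n + 1) + f (n - 1) + V n * f n - E * f n)\<^sup>2)"
    if "(\<lambda>n. (f n)\<^sup>2) summable_on UNIV" for f using real_T that by blast
  have bound: "l2_norm x \<le> sqrt C * l2_norm (T x)" if x: "x \<in> l2" for x
  proof -
    have re: "(\<lambda>n. (Re (x n))\<^sup>2) summable_on UNIV" and im: "(\<lambda>n. (Im (x n))\<^sup>2) summable_on UNIV"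
      using x[unfolded l2_iff] by auto
    have "(\<Sum>\<^sub>\<infinity>n. (Re (x n))\<^sup>2) \<le> C * (\<Sum>\<^sub>\<infinity>n. (Re (T x n))\<^sup>2)"
      unfolding Re_T by (rule C[OF re])
    moreover have "(\<Sum>\<^sub>\<infinity>n. (Im (x n))\<^sup>2) \<le> C * (\<Sum>\<^sub>\<infinity>n. (Im (T x n))\<^sup>2)"
      unfolding Im_T by (rule C[OF im])
    ultimately have "(l2_norm x)\<^sup>2 \<le> C * (l2_norm (T x))\<^sup>2"
      unfolding l2_norm_sq[OF x] l2_norm_sq[OF T_l2[OF x]] distrib_left by linarith
    then have "(l2_norm x)\<^sup>2 \<le> (sqrt C * l2_norm (T x))\<^sup>2" using C0 by (simp add: power_mult_distrib)
    then show ?thesis by (rule power2_le_imp_le) (use C0 l2_norm_nonneg[of "T x"] in simp)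
  qed
  have "bij_betw T l2 l2"
  proof (rule bij_betw_imageI)
    show "inj_on T l2"
    proof (rule inj_onI)
      fix x x' assume xx: "x \<in> l2" "x' \<in> l2" "T x = T x'"
      define z where "z n = x n + (- 1) * x' n" for n
      have z: "z \<in> l2"
        using xx(1,2) summable_sq_add[of "\<lambda>n. Re (x n)" "\<lambda>n. - Re (x' n)"]
          summable_sq_add[of "\<lambda>n. Im (x n)" "\<lambda>n. - Im (x' n)"] by (simp add: l2_iff z_def)
      have "T z n = T x n - T x' n" for n by (simp add: T_def jacobi_def z_def algebra_simps)
      then have "T z = (\<lambda>_. 0)" using xx(3) by auto
      then have "l2_norm z \<le> 0" using bound[OF z] by (simp add: l2_norm_def)
      then have "(\<Sum>\<^sub>\<infinity>n. (cmod (z n))\<^sup>2) \<le> 0" by (simp add: l2_norm_def)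
      then have "(cmod (z n))\<^sup>2 = 0" for n
        using z unfolding l2_def by (intro nonneg_infsum_le_0D[of "\<lambda>n. (cmod (z n))\<^sup>2" UNIV]) auto
      then show "x = x'" by (auto simp: z_def)
    qed
    show "T ` l2 = l2"
    proof (intro equalityI subsetI)
      fix y assume "y \<in> l2"
      then have y: "(\<lambda>n. (Re (y n))\<^sup>2) summable_on UNIV" "(\<lambda>n. (Im (y n))\<^sup>2) summable_on UNIV" by (auto simp: l2_iff)
      obtain u where u: "(\<lambda>n. (u n)\<^sup>2) summable_on UNIV" "\<forall>n. u (n + 1) + u (n - 1) + V n * u n - E * u n = Re (y n)"
        using hyperbolic_solvable[OF hyp EB y(1)] by auto
      obtain v where v: "(\<lambda>n. (v n)\<^sup>2) summable_on UNIV" "\<forall>n. v (n + 1) + v (n - 1) + V n * v n - E * v n = Im (y n)"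
        using hyperbolic_solvable[OF hyp EB y(2)] by auto
      have "y = T (\<lambda>n. Complex (u n) (v n))"
        by (intro ext complex_eqI) (simp_all add: Re_T Im_T u(2) v(2))
      moreover have "(\<lambda>n. Complex (u n) (v n)) \<in> l2" using u(1) v(1) by (simp add: l2_iff)
      ultimately show "y \<in> T ` l2" by blast
    qed (use T_l2 in auto)
  qed
  then show ?thesis
    using bound unfolding l2_spectrum_def mem_Collect_eq not_not T by auto
qed

text \<open>For |E| at least 5 the constant form x^2 - z^2 grows, as the new coordinate dominates the old one. These energies
anchor the two unbounded components.\<close>

lemma far_hyperbolic:
  assumes V: "\<And>n. \<bar>V n\<bar> \<le> 2" and E: "5 \<le> \<bar>E\<bar>"
  shows "hyperbolic V E"
proof -
  have lyap: "lyapunov V E (1/2) 1 a J (\<lambda>_. (1, 0, -1))" for a J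
    unfolding lyapunov_def
  proof (intro conjI allI impI)
    show "\<exists>x z. (x, z) \<noteq> (0, 0) \<and> qf (1, 0, - 1) x z = (0::real)"
      by (rule exI[of _ 1], rule exI[of _ 1]) simp
  next
    fix j and x z :: real
    define w where "w = E - V (a + int j)"
    have "3 \<le> \<bar>w\<bar>" using V[of "a + int j"] E unfolding w_def by linarith
    then have w: "9 \<le> w\<^sup>2" using abs_le_square_iff[of 3 w] by simp
    have "0 \<le> (2 * w * x - 3 * z)\<^sup>2" by simp
    then have "12 * (w * x * z) \<le> 4 * (w\<^sup>2 * x\<^sup>2) + 9 * z\<^sup>2" by (simp add: power2_eq_square algebra_simps)
    moreover have "9 * x\<^sup>2 \<le> w\<^sup>2 * x\<^sup>2" using w by (intro mult_right_mono) auto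
    moreover have "qf (1, 0, - 1) (w * x - z) x = w\<^sup>2 * x\<^sup>2 - 2 * (w * x * z) + z\<^sup>2 - x\<^sup>2"
      by (simp add: power2_eq_square algebra_simps)
    moreover have "qf (1, 0, - 1) x z = x\<^sup>2 - z\<^sup>2" by simp
    moreover have "0 \<le> x\<^sup>2" by simp
    ultimately show "qf (1, 0, - 1) x z + 1 / 2 * (x\<^sup>2 + z\<^sup>2) \<le> qf (1, 0, - 1) ((E - V (a + int j)) * x - z) x"
      unfolding w_def[symmetric] distrib_left by linarith
  qed auto
  have "\<exists>m J k. m \<le> a \<and> b \<le> m + int J \<and> lyapunov V E (1/2) 1 m J k" for a b
    by (rule exI[of _ a], rule exI[of _ "nat (b - a)"], rule exI) (use lyap in auto)
  moreover have "(0::real) < 1/2" "(0::real) \<le> 1" by auto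
  ultimately show ?thesis unfolding hyperbolic_def by blast
qed

section \<open>Sign changes\<close>

text \<open>A zero counts as a change when it is reached. The following product is then zero and not negative, so that passing
through a simple zero counts exactly once.\<close>

primrec changes :: "(nat \<Rightarrow> real) \<Rightarrow> nat \<Rightarrow> nat" where
  "changes x 0 = 0"
| "changes x (Suc n) = changes x n + (if x n * x (Suc n) < 0 \<or> x (Suc n) = 0 then 1 else 0)"

lemma eventually_same_sign:
  fixes f :: "'a \<Rightarrow> real"
  assumes "(f \<longlongrightarrow> l) F" "l \<noteq> 0"
  shows "eventually (\<lambda>t. 0 < f t * l) F"
proof -
  have "((\<lambda>t. f t * l) \<longlongrightarrow> l * l) F" by (intro tendsto_intros assms)
  moreover have "0 < l * l" using assms(2) by (auto simp: zero_less_mult_iff linorder_neq_iff)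
  ultimately show ?thesis by (rule order_tendstoD(1))
qed

text \<open>A zero with opposite signs on both sides contributes one change, and so does every small perturbation of it; hence the
count can only jump where the last term vanishes.\<close>

lemma changes_locally_constant:
  fixes X :: "'a \<Rightarrow> nat \<Rightarrow> real"
  assumes lim: "\<And>n. n \<le> L \<Longrightarrow> ((\<lambda>t. X t n) \<longlongrightarrow> x n) F"
    and zero: "\<And>n. Suc (Suc n) \<le> L \<Longrightarrow> x (Suc n) = 0 \<Longrightarrow> x n * x (Suc (Suc n)) < 0"
    and x0: "x 0 \<noteq> 0" and n: "n \<le> L" "x n \<noteq> 0"
  shows "eventually (\<lambda>t. changes (X t) n = changes x n) F"
  using n
proof (induction n rule: less_induct)
  case (less n)
  show ?case
  proof (cases n)
    case 0
    then show ?thesis by simp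
  next
    case (Suc m)
    have sn: "eventually (\<lambda>t. 0 < X t (Suc m) * x (Suc m)) F"
      using eventually_same_sign[OF lim] less.prems Suc by blast
    show ?thesis
    proof (cases "x m = 0")
      case False
      then have "eventually (\<lambda>t. 0 < X t m * x m) F" using eventually_same_sign[OF lim] less.prems Suc by simp
      moreover have "eventually (\<lambda>t. changes (X t) m = changes x m) F" using less.IH[of m] False less.prems Suc by simp
      ultimately show ?thesis using sn
      proof eventually_elim
        case (elim t)
        then have "X t m * X t (Suc m) < 0 \<longleftrightarrow> x m * x (Suc m) < 0" "X t (Suc m) \<noteq> 0" "x (Suc m) \<noteq> 0"
          by (auto simp: zero_less_mult_iff mult_less_0_iff)
        then show ?case using elim Suc by simp
      qed
    next
      case True
      then obtain k where k: "m = Suc k" using x0 by (cases m) auto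
      have opp: "x k * x (Suc m) < 0" using zero[of k] True k less.prems Suc by simp
      then have xk: "x k \<noteq> 0" by auto
      have "eventually (\<lambda>t. 0 < X t k * x k) F" using eventually_same_sign[OF lim] less.prems Suc k xk by simp
      moreover have "eventually (\<lambda>t. changes (X t) k = changes x k) F" using less.IH[of k] xk less.prems Suc k by simp
      ultimately show ?thesis using sn
      proof eventually_elim
        case (elim t)
        have "changes x (Suc m) = changes x k + 1" using True k opp by auto
        moreover have "changes (X t) (Suc m) = changes (X t) k + 1"
          using elim opp unfolding k
          by (cases "X t (Suc k) = 0"; cases "X t (Suc k) < 0") (auto simp: zero_less_mult_iff mult_less_0_iff not_less)
        ultimately show ?case using elim Suc by simp
      qed
    qed
  qed
qed

section \<open>Dirichlet solutions and their zeros\<close>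

text \<open>Characteristic polynomials of the truncated Jacobi matrices: the solution with value 1 at site 1 and 0 at site 0.\<close>

fun jp :: "(int \<Rightarrow> real) \<Rightarrow> nat \<Rightarrow> real poly" where
  "jp V 0 = 1"
| "jp V (Suc 0) = [:- V 1, 1:]"
| "jp V (Suc (Suc n)) = [:- V (int n + 2), 1:] * jp V (Suc n) - jp V n"

definition dirichlet :: "(int \<Rightarrow> real) \<Rightarrow> real \<Rightarrow> nat \<Rightarrow> real" where
  "dirichlet V a n = poly (jp V n) a"

lemma dirichlet_simps:
  "dirichlet V a 0 = 1" "dirichlet V a (Suc 0) = a - V 1"
  "dirichlet V a (Suc (Suc n)) = (a - V (int n + 2)) * dirichlet V a (Suc n) - dirichlet V a n"
  by (simp_all add: dirichlet_def algebra_simps)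

lemma recurrence_zero:
  fixes x :: "nat \<Rightarrow> real"
  assumes rec: "\<And>n. x (Suc (Suc n)) = w n * x (Suc n) - x n" and nz: "x 0 \<noteq> 0" "x (Suc n) = 0"
  shows "x n * x (Suc (Suc n)) < 0"
proof -
  have "x k \<noteq> 0 \<or> x (Suc k) \<noteq> 0" for k
    using nz(1) rec by (induction k) auto
  then have "x n \<noteq> 0" using nz by blast
  then have "0 < x n * x n" by (auto simp: zero_less_mult_iff linorder_neq_iff)
  then show ?thesis using rec[of n] nz by simp
qed

lemma dirichlet_zero: "dirichlet V a (Suc n) = 0 \<Longrightarrow> dirichlet V a n * dirichlet V a (Suc (Suc n)) < 0"
  by (rule recurrence_zero[where w = "\<lambda>n. a - V (int n + 2)"]) (auto simp: dirichlet_simps)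

text \<open>The derivative form of the Christoffel-Darboux identity. It shows that the roots are simple and that zeros of the
Dirichlet solution move in one direction as the energy varies, which is all that Sturm's count needs.\<close>

lemma wronskian_pos:
  "0 < poly (pderiv (jp V (Suc n))) a * dirichlet V a n - dirichlet V a (Suc n) * poly (pderiv (jp V n)) a"
proof (induction n)
  case 0
  then show ?case by (simp add: dirichlet_simps pderiv_pCons)
next
  case (Suc n)
  have "poly (pderiv (jp V (Suc (Suc n)))) a =
      dirichlet V a (Suc n) + (a - V (int n + 2)) * poly (pderiv (jp V (Suc n))) a - poly (pderiv (jp V n)) a"
    unfolding jp.simps pderiv_diff pderiv_mult by (simp add: dirichlet_def pderiv_pCons algebra_simps)
  then have "poly (pderiv (jp V (Suc (Suc n)))) a * dirichlet V a (Suc n) - dirichlet V a (Suc (Suc n)) * poly (pderiv (jp V (Suc n))) a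
    = (dirichlet V a (Suc n))\<^sup>2 + (poly (pderiv (jp V (Suc n))) a * dirichlet V a n - dirichlet V a (Suc n) * poly (pderiv (jp V n)) a)"
    unfolding dirichlet_simps by (simp only: power2_eq_square) (simp add: algebra_simps del: jp.simps)
  then show ?case using Suc by (simp add: add_nonneg_pos del: jp.simps)
qed

lemma jp_nonzero: "jp V n \<noteq> 0"
proof (cases n)
  case (Suc m)
  show ?thesis
  proof
    assume "jp V n = 0"
    then show False using wronskian_pos[of V m 0] Suc by (simp add: dirichlet_def)
  qed
qed simp

definition jroots :: "(int \<Rightarrow> real) \<Rightarrow> nat \<Rightarrow> real set" where
  "jroots V n = {r. dirichlet V r n = 0}"

lemma finite_jroots: "finite (jroots V n)"
  using poly_roots_finite[OF jp_nonzero[of V n]] by (simp add: jroots_def dirichlet_def)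

lemma dirichlet_tendsto_nhds: "((\<lambda>t. dirichlet V t n) \<longlongrightarrow> dirichlet V a n) (nhds a)"
proof -
  have "isCont (\<lambda>t. dirichlet V t n) a" unfolding dirichlet_def by simp
  then show ?thesis by (simp add: isCont_def tendsto_nhds_iff)
qed

text \<open>Both sides of Sturm's identity can change only at a root of the last polynomial, and there they change by the same
amount. A quantity that is locally constant on the line is constant.\<close>

lemma changes_dir_step:
  "eventually (\<lambda>t. int (changes (dirichlet V t) L) - int (card (jroots V L \<inter> {t..}))
      = int (changes (dirichlet V a) L) - int (card (jroots V L \<inter> {a..}))) (nhds a)"
proof (cases "dirichlet V a L = 0")
  case False
  have "eventually (\<lambda>t. t \<notin> jroots V L \<or> True) (nhds a)" by simp
  have "finite (jroots V L)" by (rule finite_jroots)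
  then have "eventually (\<lambda>t. \<forall>r\<in>jroots V L. r \<ge> t \<longleftrightarrow> r \<ge> a) (nhds a)"
  proof (intro eventually_ball_finite ballI)
    fix r assume "r \<in> jroots V L"
    then have "r \<noteq> a" using False by (auto simp: jroots_def)
    then consider "a < r" | "r < a" by linarith
    then show "eventually (\<lambda>t. (r \<ge> t) = (r \<ge> a)) (nhds a)"
    proof cases
      case 1
      then show ?thesis using eventually_nhds_in_open[of "{..<r}" a] by (auto elim!: eventually_mono)
    next
      case 2
      then show ?thesis using eventually_nhds_in_open[of "{r<..}" a] by (auto elim!: eventually_mono)
    qed
  qed
  moreover have "eventually (\<lambda>t. changes (dirichlet V t) L = changes (dirichlet V a) L) (nhds a)"
    using False by (intro changes_locally_constant[where L = L] dirichlet_tendsto_nhds dirichlet_zero) (auto simp: dirichlet_simps)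
  ultimately show ?thesis
  proof eventually_elim
    case (elim t)
    then have "jroots V L \<inter> {t..} = jroots V L \<inter> {a..}" by auto
    then show ?case using elim by simp
  qed
next
  case True
  then obtain m where m: "L = Suc m" by (cases L) (auto simp: dirichlet_simps)
  have dm: "dirichlet V a m \<noteq> 0" using wronskian_pos[of V m a] True m by auto
  have e1: "eventually (\<lambda>t. changes (dirichlet V t) m = changes (dirichlet V a) m) (nhds a)"
    using dm by (intro changes_locally_constant[where L = m] dirichlet_tendsto_nhds dirichlet_zero) (auto simp: dirichlet_simps)
  have "finite (jroots V L - {a})" using finite_jroots by simp
  then have e2: "eventually (\<lambda>t. \<forall>r\<in>jroots V L - {a}. r \<ge> t \<longleftrightarrow> r \<ge> a) (nhds a)"
  proof (intro eventually_ball_finite ballI)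
    fix r assume "r \<in> jroots V L - {a}"
    then consider "a < r" | "r < a" by force
    then show "eventually (\<lambda>t. (r \<ge> t) = (r \<ge> a)) (nhds a)"
    proof cases
      case 1
      then show ?thesis using eventually_nhds_in_open[of "{..<r}" a] by (auto elim!: eventually_mono)
    next
      case 2
      then show ?thesis using eventually_nhds_in_open[of "{r<..}" a] by (auto elim!: eventually_mono)
    qed
  qed
  define f where "f t = dirichlet V t m * dirichlet V t L" for t
  have "(f has_real_derivative (poly (pderiv (jp V m)) a * dirichlet V a L + poly (pderiv (jp V L)) a * dirichlet V a m)) (at a)"
    unfolding f_def dirichlet_def by (rule DERIV_mult; rule poly_DERIV)
  then have "(f has_real_derivative (poly (pderiv (jp V L)) a * dirichlet V a m)) (at a)" using True by simp
  moreover have "0 < poly (pderiv (jp V L)) a * dirichlet V a m" using wronskian_pos[of V m a] True m by simp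
  ultimately obtain d1 d2 where d: "0 < d1" "\<And>h. 0 < h \<Longrightarrow> h < d1 \<Longrightarrow> f a < f (a + h)"
      "0 < d2" "\<And>h. 0 < h \<Longrightarrow> h < d2 \<Longrightarrow> f (a - h) < f a"
    using DERIV_pos_inc_right[of f _ a] DERIV_pos_inc_left[of f _ a] by metis
  have fa: "f a = 0" using True by (simp add: f_def)
  have e3: "eventually (\<lambda>t. t \<in> {a - d2<..<a + d1}) (nhds a)"
    using d by (intro eventually_nhds_in_open) auto
  from e1 e2 e3 show ?thesis
  proof eventually_elim
    case (elim t)
    have fin: "finite (jroots V L \<inter> S)" for S using finite_jroots by blast
    have aR: "a \<in> jroots V L" using True by (simp add: jroots_def)
    have S0: "changes (dirichlet V a) L = changes (dirichlet V a) m + 1" using True m by simp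
    show ?case
    proof (cases "t \<le> a")
      case le: True
      have "changes (dirichlet V t) L = changes (dirichlet V t) m + 1"
      proof (cases "t = a")
        case False
        then have "f t < 0" using d(4)[of "a - t"] elim le fa by simp
        then show ?thesis using m by (simp add: f_def)
      qed (use S0 in simp)
      moreover have "jroots V L \<inter> {t..} = jroots V L \<inter> {a..}" using elim le by auto
      ultimately show ?thesis using S0 elim by simp
    next
      case gt: False
      then have "0 < f t" using d(2)[of "t - a"] elim fa by simp
      then have "changes (dirichlet V t) L = changes (dirichlet V t) m" using m by (auto simp: f_def)
      moreover have "jroots V L \<inter> {a..} = insert a (jroots V L \<inter> {t..})" using elim gt aR by auto
      then have "card (jroots V L \<inter> {a..}) = Suc (card (jroots V L \<inter> {t..}))"
        using fin gt by simp
      ultimately show ?thesis using S0 elim by simp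
    qed
  qed
qed

lemma dirichlet_large_growth:
  assumes V: "\<And>n. \<bar>V n\<bar> \<le> 2" and a: "5 \<le> a"
  shows "1 \<le> dirichlet V a n \<and> dirichlet V a n \<le> dirichlet V a (Suc n)"
proof (induction n)
  case 0
  then show ?case using V[of 1] a by (simp add: dirichlet_simps abs_le_iff)
next
  case (Suc n)
  have "2 \<le> a - V (int n + 2)" using V[of "int n + 2"] a by (simp add: abs_le_iff)
  then have "2 * dirichlet V a (Suc n) \<le> (a - V (int n + 2)) * dirichlet V a (Suc n)"
    using Suc by (intro mult_right_mono) auto
  moreover have "dirichlet V a (Suc (Suc n)) = (a - V (int n + 2)) * dirichlet V a (Suc n) - dirichlet V a n" by (simp add: dirichlet_simps)
  ultimately show ?case using Suc by linarith
qed

lemma dirichlet_small_alternates: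
  assumes V: "\<And>n. \<bar>V n\<bar> \<le> 2" and a: "a \<le> -5"
  shows "1 \<le> (-1) ^ n * dirichlet V a n \<and> (-1) ^ n * dirichlet V a n \<le> (-1) ^ Suc n * dirichlet V a (Suc n)"
proof (induction n)
  case 0
  then show ?case using V[of 1] a by (simp add: dirichlet_simps abs_le_iff)
next
  case (Suc n)
  define u where "u = (-1) ^ Suc n * dirichlet V a (Suc n)"
  have "2 \<le> V (int n + 2) - a" using V[of "int n + 2"] a by (simp add: abs_le_iff)
  then have "2 * u \<le> (V (int n + 2) - a) * u"
    using Suc unfolding u_def by (intro mult_right_mono) auto
  moreover have "(-1) ^ Suc (Suc n) * dirichlet V a (Suc (Suc n)) = (V (int n + 2) - a) * u - (-1) ^ n * dirichlet V a n"
    by (simp add: dirichlet_simps u_def algebra_simps)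
  ultimately show ?case using Suc unfolding u_def by simp
qed

text \<open>The difference of the two sides is locally constant in a, and both vanish for large a, where the Dirichlet solution
increases.\<close>

lemma sturm_count:
  assumes V: "\<And>n. \<bar>V n\<bar> \<le> 2"
  shows "card (jroots V L \<inter> {a..}) = changes (dirichlet V a) L"
proof -
  define g where "g t = int (changes (dirichlet V t) L) - int (card (jroots V L \<inter> {t..}))" for t
  have "g constant_on UNIV"
  proof (rule locally_constant_imp_constant)
    fix a :: real
    show "\<exists>T. openin (top_of_set UNIV) T \<and> a \<in> T \<and> (\<forall>x\<in>T. g x = g a)"
      using changes_dir_step[of V L a] unfolding eventually_nhds g_def by auto
  qed simp
  then have "g a = g 5" unfolding constant_on_def by auto
  moreover have "changes (dirichlet V 5) L = 0"
  proof (induction L)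
    case (Suc L)
    have "0 < dirichlet V 5 L" "0 < dirichlet V 5 (Suc L)" using dirichlet_large_growth[where V = V and n = L, OF V order_refl] by auto
    then show ?case using Suc by (simp add: mult_less_0_iff)
  qed simp
  moreover have "jroots V L \<inter> {5..} = {}"
    using dirichlet_large_growth[where V = V and n = L, OF V] by (force simp: jroots_def)
  ultimately show ?thesis unfolding g_def by simp
qed

text \<open>Below the spectrum the Dirichlet solution alternates, so that Sturm's count there gives all L roots.\<close>

lemma card_jroots:
  assumes V: "\<And>n. \<bar>V n\<bar> \<le> 2"
  shows "card (jroots V L) = L"
proof -
  have "changes (dirichlet V (-5)) L = L"
  proof (induction L)
    case (Suc L)
    have "0 < (-1) ^ L * dirichlet V (-5) L" "0 < (-1) ^ Suc L * dirichlet V (-5) (Suc L)"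
      using dirichlet_small_alternates[where V = V and n = L, OF V order_refl] by auto
    then have "0 < ((-1) ^ L * dirichlet V (-5) L) * ((-1) ^ Suc L * dirichlet V (-5) (Suc L))" by (rule mult_pos_pos)
    also have "\<dots> = - (((-1) ^ L * (-1) ^ L) * (dirichlet V (-5) L * dirichlet V (-5) (Suc L)))"
      by simp
    also have "((-1::real) ^ L * (-1) ^ L) = 1" by (simp flip: power_mult_distrib)
    finally have "dirichlet V (-5) L * dirichlet V (-5) (Suc L) < 0" by simp
    then show ?case using Suc by simp
  qed simp
  moreover have "jroots V L \<inter> {-5..} = jroots V L"
  proof -
    have "- 5 \<le> r" if "r \<in> jroots V L" for r
    proof (rule ccontr)
      assume "\<not> - 5 \<le> r"
      then show False using dirichlet_small_alternates[where V = V and n = L and a = r, OF V] that by (simp add: jroots_def)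
    qed
    then show ?thesis by blast
  qed
  ultimately show ?thesis using sturm_count[where V = V, OF V, of L "-5"] by simp
qed

section \<open>Eigenvalues of the truncated matrices\<close>

definition jmat :: "(int \<Rightarrow> real) \<Rightarrow> nat \<Rightarrow> real Matrix.mat" where
  "jmat V L = Matrix.mat L L (\<lambda>(i, j). if i = j then V (int i + 1) else if i = j + 1 \<or> j = i + 1 then 1 else 0)"

lemma jmat_carrier: "jmat V L \<in> carrier_mat L L"
  by (simp add: jmat_def)

lemma jmat_mult:
  assumes "i < L"
  shows "vec_index (jmat V L *\<^sub>v Matrix.vec L f) i = V (int i + 1) * f i + (if 0 < i then f (i - 1) else 0) + (if i + 1 < L then f (i + 1) else 0)"
proof -
  have "vec_index (jmat V L *\<^sub>v Matrix.vec L f) i = (\<Sum>j = 0..<L. (if i = j then V (int i + 1) else if i = j + 1 \<or> j = i + 1 then 1 else 0) * f j)"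
    using assms by (simp add: jmat_def scalar_prod_def)
  also have "\<dots> = (\<Sum>j = 0..<L. (if j = i then V (int i + 1) * f i else 0) + (if j = i - 1 then (if 0 < i then f (i - 1) else 0) else 0)
      + (if j = i + 1 then f (i + 1) else 0))"
    by (intro sum.cong) auto
  also have "\<dots> = V (int i + 1) * f i + (if 0 < i then f (i - 1) else 0) + (if i + 1 < L then f (i + 1) else 0)"
    using assms by (auto simp: sum.distrib)
  finally show ?thesis .
qed

lemma jroots_eigenvalue:
  assumes r: "r \<in> jroots V L"
  shows "eigenvalue (jmat V L) r"
proof -
  have dL: "dirichlet V r L = 0" using r by (simp add: jroots_def)
  then have L: "0 < L" by (cases L) (auto simp: dirichlet_simps)
  define v where "v = Matrix.vec L (dirichlet V r)"
  have "jmat V L *\<^sub>v v = r \<cdot>\<^sub>v v"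
  proof (rule eq_vecI)
    fix i assume "i < dim_vec (r \<cdot>\<^sub>v v)"
    then have i: "i < L" by (simp add: v_def)
    have "(if i + 1 < L then dirichlet V r (i + 1) else 0) = dirichlet V r (Suc i)"
      using i dL by (cases "Suc i = L") auto
    then have "vec_index (jmat V L *\<^sub>v v) i = V (int i + 1) * dirichlet V r i + (if 0 < i then dirichlet V r (i - 1) else 0) + dirichlet V r (Suc i)"
      unfolding v_def jmat_mult[OF i] by simp
    also have "\<dots> = r * dirichlet V r i"
      by (cases i) (auto simp: dirichlet_simps algebra_simps)
    finally show "vec_index (jmat V L *\<^sub>v v) i = vec_index (r \<cdot>\<^sub>v v) i" using i by (simp add: v_def)
  qed (simp add: v_def jmat_def)
  moreover have "v \<noteq> 0\<^sub>v (dim_row (jmat V L))"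
  proof
    assume "v = 0\<^sub>v (dim_row (jmat V L))"
    then have "vec_index v 0 = 0" using L by (simp add: jmat_def)
    then show False using L by (simp add: v_def dirichlet_simps)
  qed
  moreover have "v \<in> carrier_vec (dim_row (jmat V L))" by (simp add: v_def jmat_def)
  ultimately show ?thesis unfolding eigenvalue_def eigenvector_def by blast
qed

text \<open>The Dirichlet solution at a root is an eigenvector, and L distinct eigenvalues exhaust the characteristic polynomial,
so multiplicities are one.\<close>

lemma eigenvalue_count_jmat:
  assumes V: "\<And>n. \<bar>V n\<bar> \<le> 2"
  shows "eigenvalue_count (jmat V L) a = card (jroots V L \<inter> {..a})"
proof -
  define A where "A = jmat V L"
  define Z where "Z = {x. eigenvalue A x}"
  have A: "A \<in> carrier_mat L L" unfolding A_def by (rule jmat_carrier)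
  have deg: "degree (char_poly A) = L" and nz: "char_poly A \<noteq> 0"
    using degree_monic_char_poly[OF A] by auto
  have Z: "Z = {x. poly (char_poly A) x = 0}"
    unfolding Z_def using eigenvalue_root_char_poly[OF A] by auto
  have finZ: "finite Z" unfolding Z using poly_roots_finite[OF nz] .
  have sub: "jroots V L \<subseteq> Z" unfolding Z_def A_def using jroots_eigenvalue by blast
  have ord1: "1 \<le> Polynomial.order x (char_poly A)" if "x \<in> Z" for x
    using that nz unfolding Z by (simp add: order_root Suc_le_eq)
  have "size (proots (char_poly A)) \<le> L" using size_proots_le[of "char_poly A"] deg by simp
  moreover have "size (proots (char_poly A)) = (\<Sum>x\<in>Z. Polynomial.order x (char_poly A))"
    unfolding size_multiset_overloaded_eq Z using nz by simp
  ultimately have le: "(\<Sum>x\<in>Z. Polynomial.order x (char_poly A)) \<le> L" by simp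
  have "card Z \<le> (\<Sum>x\<in>Z. Polynomial.order x (char_poly A))"
    using sum_mono[of Z "\<lambda>_. 1" "\<lambda>x. Polynomial.order x (char_poly A)"] ord1 by simp
  moreover have "L \<le> card Z" using card_mono[OF finZ sub] card_jroots[where V = V, OF V] by simp
  ultimately have cZ: "card Z = L" and sumZ: "(\<Sum>x\<in>Z. Polynomial.order x (char_poly A)) = card Z" using le by auto
  have ZR: "Z = jroots V L"
    using card_subset_eq[OF finZ sub] cZ card_jroots[where V = V, OF V] by simp
  have ord: "Polynomial.order x (char_poly A) = 1" if "x \<in> Z" for x
  proof (rule ccontr)
    assume "Polynomial.order x (char_poly A) \<noteq> 1"
    then have "1 < Polynomial.order x (char_poly A)" using ord1[OF that] by simp
    then have "(\<Sum>x\<in>Z. 1) < (\<Sum>x\<in>Z. Polynomial.order x (char_poly A))"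
      using that ord1 finZ by (intro sum_strict_mono_ex1) auto
    then show False using sumZ by simp
  qed
  have "eigenvalue_count A a = (\<Sum>x\<in>Z \<inter> {..a}. Polynomial.order x (char_poly A))"
    unfolding eigenvalue_count_def Z_def by (intro sum.cong) auto
  also have "\<dots> = card (Z \<inter> {..a})" using ord by simp
  finally show ?thesis using ZR unfolding A_def by simp
qed

text \<open>The error 1 occurs when a itself is an eigenvalue, which is counted on both sides.\<close>

lemma eigenvalue_count_changes:
  assumes V: "\<And>n. \<bar>V n\<bar> \<le> 2"
  shows "\<bar>real (eigenvalue_count (jmat V L) a) - (real L - real (changes (dirichlet V a) L))\<bar> \<le> 1"
proof -
  have fin: "finite (jroots V L)" by (rule finite_jroots)
  have "jroots V L = (jroots V L \<inter> {..a}) \<union> (jroots V L \<inter> {a..})" by auto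
  then have "card (jroots V L \<inter> {..a}) + card (jroots V L \<inter> {a..}) = card (jroots V L) + card (jroots V L \<inter> {..a} \<inter> (jroots V L \<inter> {a..}))"
    using card_Un_Int[of "jroots V L \<inter> {..a}" "jroots V L \<inter> {a..}"] fin by simp
  moreover have "card (jroots V L \<inter> {..a} \<inter> (jroots V L \<inter> {a..})) \<le> card {a}"
    by (intro card_mono) auto
  ultimately show ?thesis
    unfolding eigenvalue_count_jmat[where V = V, OF V] sturm_count[where V = V, OF V] card_jroots[where V = V, OF V] by simp
qed

section \<open>Eigenvalue counts across the resolvent set\<close>

lemma christoffel_darboux:
  "(a - b) * (\<Sum>k\<le>n. dirichlet V a k * dirichlet V b k) = dirichlet V a (Suc n) * dirichlet V b n - dirichlet V a n * dirichlet V b (Suc n)"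
  by (induction n) (simp_all add: dirichlet_simps algebra_simps)

lemma dirichlet_orthogonal:
  assumes "a \<in> jroots V L" "b \<in> jroots V L" "a \<noteq> b"
  shows "(\<Sum>k<L. dirichlet V a k * dirichlet V b k) = 0"
proof -
  obtain n where "L = Suc n" using assms(1) by (cases L) (auto simp: jroots_def dirichlet_simps)
  then show ?thesis using christoffel_darboux[of a b V n] assms by (auto simp: jroots_def lessThan_Suc_atMost)
qed

lemma has_sum_window:
  fixes g :: "nat \<Rightarrow> real"
  shows "((\<lambda>s::int. if 1 \<le> s \<and> s \<le> int L then g (nat (s - 1)) else 0) has_sum (\<Sum>k<L. g k)) UNIV"
proof -
  have "((\<lambda>s::int. if 1 \<le> s \<and> s \<le> int L then g (nat (s - 1)) else 0) has_sum
      (\<Sum>s\<in>{1..int L}. if 1 \<le> s \<and> s \<le> int L then g (nat (s - 1)) else 0)) UNIV"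
    by (rule has_sum_finite_neutralI[of "{1..int L}"]) auto
  also have "(\<Sum>s\<in>{1..int L}. if 1 \<le> s \<and> s \<le> int L then g (nat (s - 1)) else 0) = (\<Sum>k<L. g k)"
    by (rule sum.reindex_bij_witness[of _ "\<lambda>k. int k + 1" "\<lambda>s. nat (s - 1)"]) auto
  finally show ?thesis .
qed

lemma l2_window:
  fixes f :: "nat \<Rightarrow> real" and L :: nat
  defines "x \<equiv> \<lambda>s::int. complex_of_real (if 1 \<le> s \<and> s \<le> int L then f (nat (s - 1)) else 0)"
  shows "x \<in> l2" "l2_norm x = sqrt (\<Sum>k<L. (f k)\<^sup>2)"
proof -
  have "(cmod (x s))\<^sup>2 = (if 1 \<le> s \<and> s \<le> int L then (f (nat (s - 1)))\<^sup>2 else 0)" for s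
    by (simp add: x_def)
  then have *: "((\<lambda>s. (cmod (x s))\<^sup>2) has_sum (\<Sum>k<L. (f k)\<^sup>2)) UNIV"
    using has_sum_window[of L "\<lambda>k. (f k)\<^sup>2"] by presburger
  show "x \<in> l2" unfolding l2_def using * has_sum_imp_summable by blast
  show "l2_norm x = sqrt (\<Sum>k<L. (f k)\<^sup>2)" unfolding l2_norm_def using infsumI[OF *] by simp
qed

text \<open>Three eigenvectors of a truncation span a space containing a nonzero vector that vanishes at the first and at the last
site. Extended by zero it satisfies the eigenvalue equation of the full operator up to a multiple of the distance of
the eigenvalues from c, against the bounded inverse at c.\<close>

lemma few_roots_near_resolvent:
  assumes c: "complex_of_real c \<notin> l2_spectrum (jacobi V)"
  obtains \<delta> where "0 < \<delta>" "\<And>L. card (jroots V L \<inter> {c - \<delta><..<c + \<delta>}) \<le> 2"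
proof -
  obtain C where C: "\<And>x. x \<in> l2 \<Longrightarrow> l2_norm x \<le> C * l2_norm (\<lambda>n. jacobi V x n - complex_of_real c * x n)"
    using c unfolding l2_spectrum_def by auto
  define \<delta> where "\<delta> = 1 / (\<bar>C\<bar> + 1)"
  have \<delta>: "0 < \<delta>" "\<bar>C\<bar> * \<delta> < 1" by (simp_all add: \<delta>_def field_simps)
  have "card (jroots V L \<inter> {c - \<delta><..<c + \<delta>}) \<le> 2" for L
  proof (rule ccontr)
    assume "\<not> card (jroots V L \<inter> {c - \<delta><..<c + \<delta>}) \<le> 2"
    then have "3 \<le> card (jroots V L \<inter> {c - \<delta><..<c + \<delta>})" by simp
    then obtain T where "T \<subseteq> jroots V L \<inter> {c - \<delta><..<c + \<delta>}" "card T = 3"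
      using obtain_subset_with_card_n by metis
    then obtain p q r where pqr: "p \<noteq> q" "q \<noteq> r" "p \<noteq> r"
      "{p, q, r} \<subseteq> jroots V L \<inter> {c - \<delta><..<c + \<delta>}" by (metis card_3_iff)
    then have R: "p \<in> jroots V L" "q \<in> jroots V L" "r \<in> jroots V L"
      and D: "\<bar>p - c\<bar> \<le> \<delta>" "\<bar>q - c\<bar> \<le> \<delta>" "\<bar>r - c\<bar> \<le> \<delta>" by auto
    obtain n where n: "L = Suc n" using R(1) by (cases L) (auto simp: jroots_def dirichlet_simps)
    obtain \<alpha> \<beta> \<gamma> where abc: "(\<alpha>, \<beta>, \<gamma>) \<noteq> (0, 0, 0)" "\<alpha> + \<beta> + \<gamma> = 0"
      "\<alpha> * dirichlet V p n + \<beta> * dirichlet V q n + \<gamma> * dirichlet V r n = 0"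
    proof (cases "dirichlet V p n = dirichlet V q n \<and> dirichlet V q n = dirichlet V r n")
      case True
      then show ?thesis using that[of 1 "-1" 0] by simp
    next
      case False
      then show ?thesis
        using that[of "dirichlet V q n - dirichlet V r n" "dirichlet V r n - dirichlet V p n" "dirichlet V p n - dirichlet V q n"] by (auto simp: algebra_simps)
    qed
    define mix where "mix a b e k = a * dirichlet V p k + b * dirichlet V q k + e * dirichlet V r k" for a b e k
    have norm_mix: "(\<Sum>k<L. (mix a b e k)\<^sup>2) = a\<^sup>2 * (\<Sum>k<L. (dirichlet V p k)\<^sup>2) + b\<^sup>2 * (\<Sum>k<L. (dirichlet V q k)\<^sup>2) + e\<^sup>2 * (\<Sum>k<L. (dirichlet V r k)\<^sup>2)" for a b e
    proof -
      have "(\<Sum>k<L. (mix a b e k)\<^sup>2) = (\<Sum>k<L. a\<^sup>2 * (dirichlet V p k)\<^sup>2 + b\<^sup>2 * (dirichlet V q k)\<^sup>2 + e\<^sup>2 * (dirichlet V r k)\<^sup>2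
         + 2 * a * b * (dirichlet V p k * dirichlet V q k) + 2 * b * e * (dirichlet V q k * dirichlet V r k) + 2 * a * e * (dirichlet V p k * dirichlet V r k))"
        by (intro sum.cong refl) (simp add: mix_def power2_eq_square algebra_simps)
      also have "\<dots> = a\<^sup>2 * (\<Sum>k<L. (dirichlet V p k)\<^sup>2) + b\<^sup>2 * (\<Sum>k<L. (dirichlet V q k)\<^sup>2) + e\<^sup>2 * (\<Sum>k<L. (dirichlet V r k)\<^sup>2)
         + 2 * a * b * (\<Sum>k<L. dirichlet V p k * dirichlet V q k) + 2 * b * e * (\<Sum>k<L. dirichlet V q k * dirichlet V r k) + 2 * a * e * (\<Sum>k<L. dirichlet V p k * dirichlet V r k)"
        by (simp only: sum.distrib sum_distrib_left)
      finally show ?thesis using dirichlet_orthogonal R pqr by simp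
    qed
    have one: "1 \<le> (\<Sum>k<L. (dirichlet V a k)\<^sup>2)" for a
      using member_le_sum[of 0 "{..<L}" "\<lambda>k. (dirichlet V a k)\<^sup>2"] n by (simp add: dirichlet_simps)
    define x where "x s = complex_of_real (if 1 \<le> s \<and> s \<le> int L then mix \<alpha> \<beta> \<gamma> (nat (s - 1)) else 0)" for s
    define y where "y s = complex_of_real (if 1 \<le> s \<and> s \<le> int L then mix (\<alpha> * (p - c)) (\<beta> * (q - c)) (\<gamma> * (r - c)) (nat (s - 1)) else 0)" for s
    have x: "x \<in> l2" "l2_norm x = sqrt (\<Sum>k<L. (mix \<alpha> \<beta> \<gamma> k)\<^sup>2)"
      and y: "l2_norm y = sqrt (\<Sum>k<L. (mix (\<alpha> * (p - c)) (\<beta> * (q - c)) (\<gamma> * (r - c)) k)\<^sup>2)"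
      unfolding x_def y_def by (rule l2_window)+
    have ends: "mix \<alpha> \<beta> \<gamma> 0 = 0" "mix \<alpha> \<beta> \<gamma> n = 0" "mix \<alpha> \<beta> \<gamma> (Suc n) = 0"
      using abc R n by (auto simp: mix_def dirichlet_simps jroots_def)
    have x_site: "x (int k + 1) = complex_of_real (mix \<alpha> \<beta> \<gamma> k)" if "k \<le> L" for k
      using that ends n by (cases "k = L") (auto simp: x_def)
    have "jacobi V x s - complex_of_real c * x s = y s" for s
    proof (cases "1 \<le> s \<and> s \<le> int L")
      case True
      then obtain k where k: "s = int k + 1" "k < L" by (intro that[of "nat (s - 1)"]) auto
      have "x (s + 1) = complex_of_real (mix \<alpha> \<beta> \<gamma> (Suc k))" using x_site[of "Suc k"] k by (simp add: add.commute)
      moreover have "x (s - 1) = complex_of_real (if k = 0 then 0 else mix \<alpha> \<beta> \<gamma> (k - 1))"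
        using x_site[of "k - 1"] k by (cases k) (auto simp: x_def)
      moreover have "x s = complex_of_real (mix \<alpha> \<beta> \<gamma> k)" using x_site k by simp
      moreover have "y s = complex_of_real (mix (\<alpha> * (p - c)) (\<beta> * (q - c)) (\<gamma> * (r - c)) k)"
        using k by (simp add: y_def)
      moreover have "mix \<alpha> \<beta> \<gamma> (Suc k) + (if k = 0 then 0 else mix \<alpha> \<beta> \<gamma> (k - 1)) + V s * mix \<alpha> \<beta> \<gamma> k - c * mix \<alpha> \<beta> \<gamma> k
          = mix (\<alpha> * (p - c)) (\<beta> * (q - c)) (\<gamma> * (r - c)) k"
      proof (cases k)
        case 0
        then show ?thesis using k by (simp add: mix_def dirichlet_simps algebra_simps)
      next
        case (Suc i)
        have "int i + 2 = s" using Suc k by simp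
        then show ?thesis using Suc by (simp add: mix_def dirichlet_simps algebra_simps)
      qed
      ultimately show ?thesis unfolding jacobi_def by (metis of_real_add of_real_diff of_real_mult)
    next
      case False
      then consider "s = 0" | "s = int L + 1" | "s < 0 \<or> int L + 1 < s" by linarith
      then show ?thesis
      proof cases
        case 1
        then show ?thesis using x_site[of 0] ends by (simp add: jacobi_def y_def x_def)
      next
        case 2
        then show ?thesis using x_site[of n] ends n by (simp add: jacobi_def y_def x_def)
      next
        case 3
        then show ?thesis by (auto simp: jacobi_def y_def x_def)
      qed
    qed
    then have Hx: "(\<lambda>s. jacobi V x s - complex_of_real c * x s) = y" by auto
    have coef: "(a * t)\<^sup>2 * N \<le> \<delta>\<^sup>2 * (a\<^sup>2 * N)" if "\<bar>t\<bar> \<le> \<delta>" "1 \<le> N" for a t N :: real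
    proof -
      have "t\<^sup>2 \<le> \<delta>\<^sup>2" using that(1) by (metis abs_ge_zero power2_abs power_mono)
      then have "t\<^sup>2 * (a\<^sup>2 * N) \<le> \<delta>\<^sup>2 * (a\<^sup>2 * N)" using that by (intro mult_right_mono) auto
      then show ?thesis by (simp add: power_mult_distrib algebra_simps)
    qed
    have "(\<Sum>k<L. (mix (\<alpha> * (p - c)) (\<beta> * (q - c)) (\<gamma> * (r - c)) k)\<^sup>2) \<le> \<delta>\<^sup>2 * (\<Sum>k<L. (mix \<alpha> \<beta> \<gamma> k)\<^sup>2)"
      unfolding norm_mix using coef[OF D(1) one, of \<alpha> p] coef[OF D(2) one, of \<beta> q] coef[OF D(3) one, of \<gamma> r]
      unfolding distrib_left by linarith
    then have "l2_norm y \<le> sqrt (\<delta>\<^sup>2 * (\<Sum>k<L. (mix \<alpha> \<beta> \<gamma> k)\<^sup>2))" unfolding y by simp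
    also have "\<dots> = \<delta> * l2_norm x" using \<delta> by (simp add: x real_sqrt_mult)
    finally have le: "l2_norm y \<le> \<delta> * l2_norm x" .
    have "0 < (\<Sum>k<L. (mix \<alpha> \<beta> \<gamma> k)\<^sup>2)"
    proof -
      have "\<alpha>\<^sup>2 * 1 + \<beta>\<^sup>2 * 1 + \<gamma>\<^sup>2 * 1 \<le> (\<Sum>k<L. (mix \<alpha> \<beta> \<gamma> k)\<^sup>2)"
        unfolding norm_mix by (intro add_mono mult_left_mono one) auto
      moreover have "0 < \<alpha>\<^sup>2 + \<beta>\<^sup>2 + \<gamma>\<^sup>2"
        using abc(1) by (metis add_nonneg_pos add_pos_nonneg not_sum_power2_lt_zero power2_less_0 linorder_neqE_linordered_idom prod.inject zero_less_power2 add.commute zero_le_power2)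
      ultimately show ?thesis by simp
    qed
    then have pos: "0 < l2_norm x" by (simp add: x)
    have "l2_norm x \<le> C * l2_norm y" using C[OF x(1)] unfolding Hx .
    also have "\<dots> \<le> \<bar>C\<bar> * l2_norm y" using l2_norm_nonneg by (intro mult_right_mono) auto
    also have "\<dots> \<le> \<bar>C\<bar> * (\<delta> * l2_norm x)" using le by (intro mult_left_mono) auto
    also have "\<dots> < 1 * l2_norm x" using mult_strict_right_mono[OF \<delta>(2) pos] by simp
    finally show False by simp
  qed
  then show thesis using that \<delta> by blast
qed

text \<open>Having counts that differ by a bound independent of L is an equivalence relation with open classes, by the preceding
lemma, and a connected set consists of one class.\<close>

lemma count_diff_bounded:
  assumes U: "connected U" "\<And>c. c \<in> U \<Longrightarrow> complex_of_real c \<notin> l2_spectrum (jacobi V)" and cd: "c \<in> U" "d \<in> U"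
  shows "\<exists>K. \<forall>L. \<bar>real (card (jroots V L \<inter> {..c})) - real (card (jroots V L \<inter> {..d}))\<bar> \<le> K"
proof (rule connected_equivalence_relation[OF U(1) cd])
  fix x y
  assume "\<exists>K. \<forall>L. \<bar>real (card (jroots V L \<inter> {..x})) - real (card (jroots V L \<inter> {..y}))\<bar> \<le> K"
  then show "\<exists>K. \<forall>L. \<bar>real (card (jroots V L \<inter> {..y})) - real (card (jroots V L \<inter> {..x}))\<bar> \<le> K"
    by (simp add: abs_minus_commute)
next
  fix x y z
  assume "\<exists>K. \<forall>L. \<bar>real (card (jroots V L \<inter> {..x})) - real (card (jroots V L \<inter> {..y}))\<bar> \<le> K"
    "\<exists>K. \<forall>L. \<bar>real (card (jroots V L \<inter> {..y})) - real (card (jroots V L \<inter> {..z}))\<bar> \<le> K"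
  then obtain K K' where K: "\<And>L. \<bar>real (card (jroots V L \<inter> {..x})) - real (card (jroots V L \<inter> {..y}))\<bar> \<le> K"
    "\<And>L. \<bar>real (card (jroots V L \<inter> {..y})) - real (card (jroots V L \<inter> {..z}))\<bar> \<le> K'" by auto
  show "\<exists>K. \<forall>L. \<bar>real (card (jroots V L \<inter> {..x})) - real (card (jroots V L \<inter> {..z}))\<bar> \<le> K"
  proof (intro exI[of _ "K + K'"] allI)
    fix L show "\<bar>real (card (jroots V L \<inter> {..x})) - real (card (jroots V L \<inter> {..z}))\<bar> \<le> K + K'"
      using K(1)[of L] K(2)[of L] by linarith
  qed
next
  fix a assume a: "a \<in> U"
  obtain \<delta> where \<delta>: "0 < \<delta>" "\<And>L. card (jroots V L \<inter> {a - \<delta><..<a + \<delta>}) \<le> 2"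
    using few_roots_near_resolvent[OF U(2)[OF a]] by blast
  have fin: "finite (jroots V L \<inter> S)" for L S using finite_jroots by blast
  have main: "\<bar>real (card (jroots V L \<inter> {..a})) - real (card (jroots V L \<inter> {..x}))\<bar> \<le> 2"
    if x: "x \<in> {a - \<delta><..<a + \<delta>}" for x L
  proof -
    have *: "card (jroots V L \<inter> {..t}) \<le> card (jroots V L \<inter> {..s}) + 2"
      if "s \<in> {a - \<delta><..<a + \<delta>}" "t \<in> {a - \<delta><..<a + \<delta>}" for s t
    proof -
      have "card (jroots V L \<inter> {..t}) \<le> card ((jroots V L \<inter> {..s}) \<union> (jroots V L \<inter> {a - \<delta><..<a + \<delta>}))"
        using that fin by (intro card_mono) auto
      also have "\<dots> \<le> card (jroots V L \<inter> {..s}) + card (jroots V L \<inter> {a - \<delta><..<a + \<delta>})" by (rule card_Un_le)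
      finally show ?thesis using \<delta>(2)[of L] by linarith
    qed
    show ?thesis using *[of a x] *[of x a] x \<delta>(1) by simp
  qed
  show "\<exists>T. openin (top_of_set U) T \<and> a \<in> T \<and> (\<forall>x\<in>T. \<exists>K. \<forall>L. \<bar>real (card (jroots V L \<inter> {..a})) - real (card (jroots V L \<inter> {..x}))\<bar> \<le> K)"
  proof (intro exI[of _ "U \<inter> {a - \<delta><..<a + \<delta>}"] conjI ballI)
    show "openin (top_of_set U) (U \<inter> {a - \<delta><..<a + \<delta>})" by (rule openin_open_Int) simp
    show "a \<in> U \<inter> {a - \<delta><..<a + \<delta>}" using a \<delta> by simp
    fix x assume "x \<in> U \<inter> {a - \<delta><..<a + \<delta>}"
    then show "\<exists>K. \<forall>L. \<bar>real (card (jroots V L \<inter> {..a})) - real (card (jroots V L \<inter> {..x}))\<bar> \<le> K"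
      using main by (intro exI[of _ 2] allI) auto
  qed
qed

lemma density_transfer:
  fixes f g :: "nat \<Rightarrow> real"
  assumes lim: "(\<lambda>L. f L / real L) \<longlonglongrightarrow> \<nu>" and K: "\<And>L. \<bar>f L - g L\<bar> \<le> K"
  shows "(\<lambda>L. g L / real L) \<longlonglongrightarrow> \<nu>"
proof -
  have "(\<lambda>L. (g L - f L) / real L) \<longlonglongrightarrow> 0"
  proof (rule Lim_null_comparison)
    show "\<forall>\<^sub>F L in sequentially. norm ((g L - f L) / real L) \<le> K / real L"
      using K by (intro always_eventually allI) (simp add: abs_minus_commute divide_right_mono)
    show "(\<lambda>L. K / real L) \<longlonglongrightarrow> 0" by (rule lim_const_over_n)
  qed
  from tendsto_add[OF lim this] show ?thesis by (simp add: diff_divide_distrib)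
qed

section \<open>Plane cones and their quadratic forms\<close>

text \<open>The area form. Whether a vector lies in a cone, and how large the cone is, are read off from its signs and values; the
transfer matrices preserve it.\<close>

definition area :: "real \<times> real \<Rightarrow> real \<times> real \<Rightarrow> real" where
  "area u v = fst u * snd v - snd u * fst v"

text \<open>The transfer matrix, with w standing for the energy minus the potential at a site.\<close>

definition transfer_by :: "real \<Rightarrow> real \<times> real \<Rightarrow> real \<times> real" where
  "transfer_by w u = (w * fst u - snd u, fst u)"

text \<open>The form that is positive exactly on the double cone spanned by P and Q and equals s t (P, Q) on s P + t Q, where (P,
Q) is the area form. It is isotropic on the two boundary lines.\<close>

definition kf :: "real \<times> real \<Rightarrow> real \<times> real \<Rightarrow> real \<times> real \<times> real" where
  "kf P Q = (- (snd P * snd Q) / area P Q, (fst P * snd Q + snd P * fst Q) / (2 * area P Q), - (fst P * fst Q) / area P Q)"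

lemma qf_kf: "qf (kf P Q) (fst v) (snd v) = area v Q * area P v / area P Q"
  unfolding kf_def qf.simps area_def[of v Q] area_def[of P v]
  by (cases "area P Q = 0") (simp_all add: power2_eq_square field_simps)

lemma area_transfer_by [simp]: "area (transfer_by w u) (transfer_by w v) = area u v"
  by (simp add: area_def transfer_by_def algebra_simps)

lemma cramer:
  assumes "area P Q \<noteq> 0"
  shows "fst v = area v Q / area P Q * fst P + area P v / area P Q * fst Q"
    "snd v = area v Q / area P Q * snd P + area P v / area P Q * snd Q"
  using assms by (simp_all add: field_simps) (simp_all add: area_def algebra_simps)

text \<open>The Pluecker relation in the plane. It turns the four strict inclusions of boundary vectors into a positive
determinant of the difference of two cone forms.\<close>

lemma plucker: "area P' Y * area X Q' = area P' Q' * area X Y + area P' X * area Y Q'"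
  by (simp add: area_def algebra_simps)

lemma quadratic_lower:
  fixes A C G s t :: real
  assumes "0 < A" "0 < C" "1 \<le> A * C - G\<^sup>2" "A + C \<le> T"
  shows "(s\<^sup>2 + t\<^sup>2) / T \<le> A * s\<^sup>2 + 2 * G * s * t + C * t\<^sup>2"
proof -
  have T: "0 < A + C" using assms by simp
  have "0 \<le> (A * s + G * t)\<^sup>2 + (G * s + C * t)\<^sup>2" by simp
  also have "\<dots> = (A + C) * (A * s\<^sup>2 + 2 * G * s * t + C * t\<^sup>2) - (A * C - G\<^sup>2) * (s\<^sup>2 + t\<^sup>2)"
    by (simp add: power2_eq_square algebra_simps)
  finally have "(A * C - G\<^sup>2) * (s\<^sup>2 + t\<^sup>2) \<le> (A + C) * (A * s\<^sup>2 + 2 * G * s * t + C * t\<^sup>2)" by simp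
  moreover have "1 * (s\<^sup>2 + t\<^sup>2) \<le> (A * C - G\<^sup>2) * (s\<^sup>2 + t\<^sup>2)" using assms by (intro mult_right_mono) auto
  ultimately have "(s\<^sup>2 + t\<^sup>2) / (A + C) \<le> A * s\<^sup>2 + 2 * G * s * t + C * t\<^sup>2"
    using T by (simp add: pos_divide_le_eq mult.commute)
  moreover have "(s\<^sup>2 + t\<^sup>2) / T \<le> (s\<^sup>2 + t\<^sup>2) / (A + C)" using T assms by (intro divide_left_mono) auto
  ultimately show ?thesis by linarith
qed

text \<open>Expanding in the basis X, Y makes the gain of the form a binary quadratic form with explicit coefficients; the
Pluecker relation symmetrises its middle coefficient.\<close>

lemma cone_form:
  fixes X Y P' Q' :: "real \<times> real"
  assumes v: "fst v = s * fst X + t * fst Y" "snd v = s * snd X + t * snd Y"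
    and D: "area P' Q' \<noteq> 0"
  shows "area P' Q' * (qf (kf P' Q') (fst v) (snd v) - s * t * area X Y)
     = (area X Q' * area P' X) * s\<^sup>2 + 2 * (area P' X * area Y Q') * s * t + (area Y Q' * area P' Y) * t\<^sup>2"
proof -
  have "area v Q' = s * area X Q' + t * area Y Q'" "area P' v = s * area P' X + t * area P' Y"
    using v by (simp_all add: area_def algebra_simps)
  then have "area P' Q' * qf (kf P' Q') (fst v) (snd v) = (s * area X Q' + t * area Y Q') * (s * area P' X + t * area P' Y)"
    using D by (simp add: qf_kf)
  also have "\<dots> = (area X Q' * area P' X) * s\<^sup>2 + s * t * (area P' Y * area X Q' + area P' X * area Y Q') + (area Y Q' * area P' Y) * t\<^sup>2"
    by (simp add: power2_eq_square algebra_simps)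
  also have "area P' Y * area X Q' + area P' X * area Y Q' = area P' Q' * area X Y + 2 * (area P' X * area Y Q')"
    using plucker[of P' Y X Q'] by simp
  finally show ?thesis by (simp add: algebra_simps)
qed

definition bd :: "real \<Rightarrow> real \<times> real \<Rightarrow> bool" where
  "bd R u \<longleftrightarrow> \<bar>fst u\<bar> \<le> R \<and> \<bar>snd u\<bar> \<le> R"

text \<open>Both X and Y lie in the open cone spanned by P and Q. The margin 1 is a normalisation for integer data: it gives
explicit constants and costs nothing after scaling.\<close>

definition inside :: "real \<times> real \<Rightarrow> real \<times> real \<Rightarrow> real \<times> real \<Rightarrow> real \<times> real \<Rightarrow> bool" where
  "inside X Y P Q \<longleftrightarrow> 1 \<le> area P X \<and> 1 \<le> area P Y \<and> 1 \<le> area X Q \<and> 1 \<le> area Y Q"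

lemma area_bound:
  assumes "bd R u" "bd S v"
  shows "\<bar>area u v\<bar> \<le> 2 * R * S"
proof -
  have "\<bar>fst u * snd v\<bar> \<le> R * S" "\<bar>snd u * fst v\<bar> \<le> R * S"
    using assms unfolding bd_def abs_mult by (auto intro!: mult_mono)
  then show ?thesis unfolding area_def by linarith
qed

lemma bd_transfer_by: "bd R u \<Longrightarrow> \<bar>w\<bar> \<le> B \<Longrightarrow> 0 \<le> B \<Longrightarrow> bd ((B + 1) * R) (transfer_by w u)"
proof -
  assume a: "bd R u" "\<bar>w\<bar> \<le> B" "0 \<le> B"
  then have "\<bar>w * fst u\<bar> \<le> B * R" unfolding bd_def abs_mult by (auto intro!: mult_mono)
  moreover have "0 \<le> R" "0 \<le> B * R" using a by (auto simp: bd_def)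
  ultimately show ?thesis using a unfolding bd_def transfer_by_def by (auto simp: algebra_simps)
qed

text \<open>The constant obtained from the least eigenvalue of the gain in the basis X, Y and the size of the change of basis,
when all vectors involved are bounded by R and the transfer matrix by B.\<close>

definition growth :: "real \<Rightarrow> real \<Rightarrow> real" where
  "growth B R = 1 / (4 * R\<^sup>2 * (2 * R\<^sup>2) * (2 * (2 * R * ((B + 1) * R))\<^sup>2))"

lemma growth_pos: "1 \<le> R \<Longrightarrow> 0 \<le> B \<Longrightarrow> 0 < growth B R"
  unfolding growth_def by (intro divide_pos_pos mult_pos_pos zero_less_power) auto

text \<open>Monotonicity of the form under inclusion of cones; it closes a column of cones at the return to the base.\<close>

lemma cone_inclusion:
  assumes ins: "inside P Q P' Q'" and W: "0 < area P Q" and D: "0 < area P' Q'"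
  shows "qf (kf P Q) x z \<le> qf (kf P' Q') x z"
proof -
  define s where "s = area (x, z) Q / area P Q"
  define t where "t = area P (x, z) / area P Q"
  have v: "fst (x, z) = s * fst P + t * fst Q" "snd (x, z) = s * snd P + t * snd Q"
    unfolding s_def t_def by (rule cramer; use W in simp)+
  have q: "qf (kf P Q) x z = s * t * area P Q"
    using qf_kf[of P Q "(x, z)"] W by (simp add: s_def t_def)
  define a b f h where "a = area P' P" and "b = area Q Q'" and "f = area P' Q" and "h = area P Q'"
  have pos: "1 \<le> a" "1 \<le> b" "1 \<le> f" "1 \<le> h" using ins by (auto simp: inside_def a_def b_def f_def h_def)
  have "f * h = area P' Q' * area P Q + a * b"
    unfolding a_def b_def f_def h_def by (rule plucker)
  then have ab: "a * b \<le> f * h" using W D by simp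
  have "0 \<le> (h * a) * s\<^sup>2 + 2 * (a * b) * s * t + (b * f) * t\<^sup>2"
  proof -
    have "0 \<le> a * h * (s + b / h * t)\<^sup>2 + (b / h) * (f * h - a * b) * t\<^sup>2"
      using pos ab by (intro add_nonneg_nonneg mult_nonneg_nonneg) auto
    also have "\<dots> = (h * a) * s\<^sup>2 + 2 * (a * b) * s * t + (b * f) * t\<^sup>2"
      using pos by (simp add: power2_eq_square field_simps)
    finally show ?thesis .
  qed
  then have "0 \<le> area P' Q' * (qf (kf P' Q') x z - s * t * area P Q)"
    using cone_form[OF v, of P' Q'] D by (simp add: a_def b_def f_def h_def)
  then show ?thesis using D q by (simp add: zero_le_mult_iff)
qed

text \<open>The determinant of the gain is the product of the two areas with the two boundary margins, hence at least 1. The trace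
is bounded, so the gain is bounded below.\<close>

lemma cone_growth:
  assumes ins: "inside (transfer_by w P) (transfer_by w Q) P' Q'" and W: "1 \<le> area P Q" and D: "1 \<le> area P' Q'"
    and R: "bd R P" "bd R Q" "bd R P'" "bd R Q'" "1 \<le> R" and w: "\<bar>w\<bar> \<le> B"
  shows "qf (kf P Q) x z + growth B R * (x\<^sup>2 + z\<^sup>2) \<le> qf (kf P' Q') (w * x - z) x"
proof -
  define X where "X = transfer_by w P"
  define Y where "Y = transfer_by w Q"
  have B: "0 \<le> B" using w by linarith
  define s where "s = area (x, z) Q / area P Q"
  define t where "t = area P (x, z) / area P Q"
  have v: "fst (x, z) = s * fst P + t * fst Q" "snd (x, z) = s * snd P + t * snd Q"
    unfolding s_def t_def by (rule cramer; use W in simp)+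
  have Av: "fst (transfer_by w (x, z)) = s * fst X + t * fst Y" "snd (transfer_by w (x, z)) = s * snd X + t * snd Y"
    using v by (simp_all add: X_def Y_def transfer_by_def algebra_simps)
  have q: "qf (kf P Q) x z = s * t * area X Y"
    using qf_kf[of P Q "(x, z)"] W by (simp add: s_def t_def X_def Y_def)
  define a b f h where "a = area P' X" and "b = area Y Q'" and "f = area P' Y" and "h = area X Q'"
  have pos: "1 \<le> a" "1 \<le> b" "1 \<le> f" "1 \<le> h" using ins by (auto simp: inside_def a_def b_def f_def h_def X_def Y_def)
  have fh: "f * h = area P' Q' * area P Q + a * b"
    using plucker[of P' Y X Q'] unfolding a_def b_def f_def h_def by (simp add: X_def Y_def)
  define K where "K = 2 * R * ((B + 1) * R)"
  have bX: "bd ((B + 1) * R) X" "bd ((B + 1) * R) Y" unfolding X_def Y_def using bd_transfer_by R w B by auto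
  have K: "a \<le> K" "b \<le> K" "f \<le> K" "h \<le> K"
    using area_bound[OF R(3) bX(1)] area_bound[OF R(3) bX(2)] area_bound[OF bX(1) R(4)] area_bound[OF bX(2) R(4)]
    unfolding a_def b_def f_def h_def K_def by (simp_all add: mult.commute mult.left_commute)
  have "1 * 1 \<le> area P' Q' * area P Q" using W D by (intro mult_mono) auto
  moreover have "1 * 1 \<le> a * b" using pos by (intro mult_mono) auto
  ultimately have "1 * 1 \<le> (a * b) * (area P' Q' * area P Q)" by (intro mult_mono) auto
  also have "\<dots> = (h * a) * (b * f) - (a * b)\<^sup>2" using fh by (simp add: power2_eq_square algebra_simps)
  finally have det: "1 \<le> (h * a) * (b * f) - (a * b)\<^sup>2" by simp
  have tr: "h * a + b * f \<le> 2 * K\<^sup>2"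
    using mult_mono[OF K(4) K(1)] mult_mono[OF K(2) K(3)] pos K by (simp add: power2_eq_square)
  have "(s\<^sup>2 + t\<^sup>2) / (2 * K\<^sup>2) \<le> (h * a) * s\<^sup>2 + 2 * (a * b) * s * t + (b * f) * t\<^sup>2"
    using pos by (intro quadratic_lower det tr mult_pos_pos) auto
  also have "\<dots> = area P' Q' * (qf (kf P' Q') (w * x - z) x - s * t * area X Y)"
    using cone_form[OF Av, of P' Q'] D by (simp add: a_def b_def f_def h_def transfer_by_def)
  finally have main: "(s\<^sup>2 + t\<^sup>2) / (2 * K\<^sup>2) \<le> area P' Q' * (qf (kf P' Q') (w * x - z) x - s * t * area X Y)" .
  have "0 \<le> (s\<^sup>2 + t\<^sup>2) / (2 * K\<^sup>2)" by simp
  then have g0: "0 \<le> qf (kf P' Q') (w * x - z) x - s * t * area X Y"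
    using main D by (smt (verit) zero_le_mult_iff)
  have "area P' Q' \<le> 2 * R\<^sup>2" using area_bound[OF R(3,4)] by (simp add: power2_eq_square)
  then have "area P' Q' * (qf (kf P' Q') (w * x - z) x - s * t * area X Y) \<le> 2 * R\<^sup>2 * (qf (kf P' Q') (w * x - z) x - s * t * area X Y)"
    using g0 by (intro mult_right_mono) auto
  with main have m2: "(s\<^sup>2 + t\<^sup>2) / (2 * K\<^sup>2) \<le> 2 * R\<^sup>2 * (qf (kf P' Q') (w * x - z) x - s * t * area X Y)" by linarith
  have comb: "(s * u + t * u')\<^sup>2 \<le> 2 * R\<^sup>2 * (s\<^sup>2 + t\<^sup>2)" if "\<bar>u\<bar> \<le> R" "\<bar>u'\<bar> \<le> R" for u u'
  proof -
    have "u\<^sup>2 \<le> R\<^sup>2" "u'\<^sup>2 \<le> R\<^sup>2" using that R(5) by (metis abs_ge_zero power2_abs power_mono)+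
    then have "u\<^sup>2 * s\<^sup>2 \<le> R\<^sup>2 * s\<^sup>2" "u'\<^sup>2 * t\<^sup>2 \<le> R\<^sup>2 * t\<^sup>2" by (intro mult_right_mono; simp)+
    moreover have "(s * u + t * u')\<^sup>2 \<le> 2 * (s * u)\<^sup>2 + 2 * (t * u')\<^sup>2"
      using sum_squares_bound[of "s * u" "t * u'"] by (simp add: power2_sum)
    ultimately show ?thesis by (simp add: power_mult_distrib algebra_simps)
  qed
  have "x\<^sup>2 + z\<^sup>2 \<le> 4 * R\<^sup>2 * (s\<^sup>2 + t\<^sup>2)"
    using comb[of "fst P" "fst Q"] comb[of "snd P" "snd Q"] v R by (simp add: bd_def)
  then have "growth B R * (x\<^sup>2 + z\<^sup>2) \<le> growth B R * (4 * R\<^sup>2 * (s\<^sup>2 + t\<^sup>2))"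
    using growth_pos[OF R(5) B] by (intro mult_left_mono) auto
  also have "\<dots> = (s\<^sup>2 + t\<^sup>2) / (2 * K\<^sup>2) / (2 * R\<^sup>2)"
  proof -
    have g: "growth B R = 1 / (4 * R\<^sup>2 * (2 * R\<^sup>2) * (2 * K\<^sup>2))" unfolding growth_def K_def ..
    have "0 < K" "0 < R" using K pos R(5) by linarith+
    then show ?thesis unfolding g by (simp add: field_simps)
  qed
  also have "\<dots> \<le> qf (kf P' Q') (w * x - z) x - s * t * area X Y"
    using m2 R(5) by (subst pos_divide_le_eq) (auto simp: mult.commute)
  finally show ?thesis using q by linarith
qed

section \<open>Columns of cones along the rotation\<close>

definition pot :: "real \<Rightarrow> real" where "pot x = 2 * cos (2 * pi * x)"

lemma pot_bound: "\<bar>pot x\<bar> \<le> 2"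
  unfolding pot_def by (simp add: abs_mult)

lemma pot_shift: "pot (x + of_int k) = pot x"
proof -
  have "cos (2 * pi * (x + of_int k)) = cos (2 * pi * x)"
    using cos_int_2pin sin_int_2pin by (simp add: distrib_left cos_add mult.assoc)
  then show ?thesis by (simp add: pot_def)
qed

text \<open>The cones depend on the phase t but not on the energy, and at the end they are closed up by the start cone or by its
negative, which spans the same double cone.\<close>

definition column :: "real \<Rightarrow> real \<Rightarrow> real \<Rightarrow> real \<Rightarrow> real \<times> real \<Rightarrow> real \<times> real \<Rightarrow> nat \<Rightarrow> real \<Rightarrow> bool" where
  "column \<omega> E1 E2 R p q N t \<longleftrightarrow> (\<exists>P Q. P 0 = p \<and> Q 0 = q \<and>
     (\<forall>n\<le>N. 1 \<le> area (P n) (Q n) \<and> bd R (P n) \<and> bd R (Q n)) \<and>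
     (\<forall>n<N. \<forall>E\<in>{E1..E2}. inside (transfer_by (E - pot (t + real n * \<omega>)) (P n)) (transfer_by (E - pot (t + real n * \<omega>)) (Q n)) (P (Suc n)) (Q (Suc n))) \<and>
     (inside (P N) (Q N) p q \<or> inside (P N) (Q N) (- p) (- q)))"

fun orb :: "(nat \<Rightarrow> real) \<Rightarrow> real \<times> real \<Rightarrow> nat \<Rightarrow> real \<times> real" where
  "orb w u 0 = u"
| "orb w u (Suc n) = transfer_by (w n) (orb w u n)"

lemma orb_add: "orb w u (m + n) = orb (\<lambda>j. w (m + j)) (orb w u m) n"
  by (induction n) simp_all

definition sector :: "real \<times> real \<Rightarrow> real \<times> real \<Rightarrow> (real \<times> real) set" where
  "sector p q = {v. \<exists>s t. 0 \<le> s \<and> 0 \<le> t \<and> 0 < s + t \<and> v = s *\<^sub>R p + t *\<^sub>R q}"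

lemma sector_iff:
  assumes "0 < area p q"
  shows "v \<in> sector p q \<longleftrightarrow> 0 \<le> area v q \<and> 0 \<le> area p v \<and> 0 < area v q + area p v"
proof
  assume "v \<in> sector p q"
  then obtain s t where st: "0 \<le> s" "0 \<le> t" "0 < s + t" "v = s *\<^sub>R p + t *\<^sub>R q" by (auto simp: sector_def)
  have "area v q = s * area p q" "area p v = t * area p q" using st(4) by (simp_all add: area_def algebra_simps)
  then show "0 \<le> area v q \<and> 0 \<le> area p v \<and> 0 < area v q + area p v"
    using st assms by (simp add: zero_less_mult_iff flip: distrib_right)
next
  assume *: "0 \<le> area v q \<and> 0 \<le> area p v \<and> 0 < area v q + area p v"
  have "v = (area v q / area p q) *\<^sub>R p + (area p v / area p q) *\<^sub>R q"
    using cramer[of p q v] assms by (simp add: prod_eq_iff)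
  moreover have "0 < area v q / area p q + area p v / area p q"
    using * assms by (simp flip: add_divide_distrib)
  moreover have "0 \<le> area v q / area p q" "0 \<le> area p v / area p q" using * assms by auto
  ultimately show "v \<in> sector p q" unfolding sector_def by blast
qed

lemma sector_step:
  assumes "inside X Y P Q" "0 < area P Q" and v: "v = s *\<^sub>R X + t *\<^sub>R Y" "0 \<le> s" "0 \<le> t" "0 < s + t"
  shows "v \<in> sector P Q"
proof -
  have "area v Q = s * area X Q + t * area Y Q" "area P v = s * area P X + t * area P Y"
    using v(1) by (simp_all add: area_def algebra_simps)
  moreover have "s * 1 \<le> s * area X Q" "t * 1 \<le> t * area Y Q" "s * 1 \<le> s * area P X" "t * 1 \<le> t * area P Y"
    using assms unfolding inside_def by (intro mult_left_mono; simp)+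
  ultimately show ?thesis unfolding sector_iff[OF assms(2)] using v by simp
qed

lemma column_orbit:
  assumes col: "column \<omega> E1 E2 R p q N t" and E: "E \<in> {E1..E2}" and u: "u \<in> sector p q"
    and w: "\<And>n. n < N \<Longrightarrow> w n = E - pot (t + real n * \<omega>)"
  shows "orb w u N \<in> sector p q \<or> - orb w u N \<in> sector p q"
proof -
  obtain P Q where PQ: "P 0 = p" "Q 0 = q" "\<And>n. n \<le> N \<Longrightarrow> 1 \<le> area (P n) (Q n)"
    "\<And>n. n < N \<Longrightarrow> inside (transfer_by (w n) (P n)) (transfer_by (w n) (Q n)) (P (Suc n)) (Q (Suc n))"
    "inside (P N) (Q N) p q \<or> inside (P N) (Q N) (- p) (- q)"
    using col E w unfolding column_def by fastforce
  have W: "0 < area (P n) (Q n)" if "n \<le> N" for n using PQ(3)[OF that] by linarith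
  have "orb w u n \<in> sector (P n) (Q n)" if "n \<le> N" for n
    using that
  proof (induction n)
    case 0
    then show ?case using u PQ by simp
  next
    case (Suc n)
    then obtain s t where st: "0 \<le> s" "0 \<le> t" "0 < s + t" "orb w u n = s *\<^sub>R P n + t *\<^sub>R Q n" by (auto simp: sector_def)
    then have "orb w u (Suc n) = s *\<^sub>R transfer_by (w n) (P n) + t *\<^sub>R transfer_by (w n) (Q n)"
      by (simp add: transfer_by_def algebra_simps)
    from sector_step[OF PQ(4) W[OF Suc.prems] this st(1-3)] Suc.prems show ?case by simp
  qed
  from this[of N] obtain s t where st: "0 \<le> s" "0 \<le> t" "0 < s + t" "orb w u N = s *\<^sub>R P N + t *\<^sub>R Q N" by (auto simp: sector_def)
  have W0: "0 < area p q" using W[of 0] PQ by simp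
  from PQ(5) show ?thesis
  proof
    assume "inside (P N) (Q N) p q"
    from sector_step[OF this W0 st(4,1-3)] show ?thesis ..
  next
    assume i: "inside (P N) (Q N) (- p) (- q)"
    have "0 < area (- p) (- q)" using W0 by (simp add: area_def)
    from sector_step[OF i this st(4,1-3)] obtain s' t' where "0 \<le> s'" "0 \<le> t'" "0 < s' + t'" "orb w u N = s' *\<^sub>R (- p) + t' *\<^sub>R (- q)"
      by (auto simp: sector_def)
    then have "- orb w u N = s' *\<^sub>R p + t' *\<^sub>R q" by simp
    then have "- orb w u N \<in> sector p q" using \<open>0 \<le> s'\<close> \<open>0 \<le> t'\<close> \<open>0 < s' + t'\<close> unfolding sector_def by blast
    then show ?thesis ..
  qed
qed

section \<open>Return towers over an arc\<close>

text \<open>The phases b to b + d2 return to the base after N1 rotations, moved by d1, and the remaining ones after N2 rotations,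
moved by - d2: the first return map of the rotation is an exchange of two intervals. The columns over the base make up
an invariant cone field over the whole orbit, for all energies between E1 and E2 at once.\<close>

locale tower =
  fixes \<omega> E1 E2 R b d1 d2 :: real and p q :: "real \<times> real" and N1 N2 :: nat and z1 z2 :: int
  assumes R: "1 \<le> R" and d: "0 < d1" "0 < d2" and N: "0 < N1" "0 < N2"
    and w1: "real N1 * \<omega> = of_int z1 + d1" and w2: "real N2 * \<omega> = of_int z2 - d2"
    and irr: "\<omega> \<notin> \<rat>"
    and col1: "\<And>t. t \<in> {b..b + d2} \<Longrightarrow> column \<omega> E1 E2 R p q N1 t"
    and col2: "\<And>t. t \<in> {b + d2..b + d2 + d1} \<Longrightarrow> column \<omega> E1 E2 R p q N2 t"
    and first_pos: "0 < fst p" "0 < fst q"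
begin

definition base where "base = {b..<b + d2 + d1}"
definition NN where "NN t = (if t < b + d2 then N1 else N2)"
definition ret where "ret t = (if t < b + d2 then t + d1 else t - d2)"
definition zz where "zz t = (if t < b + d2 then z1 else z2)"

lemma NN_pos: "0 < NN t" using N by (simp add: NN_def)

lemma ret_base: "t \<in> base \<Longrightarrow> ret t \<in> base"
  using d by (auto simp: base_def ret_def)

lemma ret_eq: "t + real (NN t) * \<omega> = ret t + of_int (zz t)"
  using w1 w2 by (auto simp: NN_def ret_def zz_def)

lemma base_column: "t \<in> base \<Longrightarrow> column \<omega> E1 E2 R p q (NN t) t"
  using col1 col2 by (auto simp: base_def NN_def)

lemma pq_pos: "1 \<le> area p q"
proof -
  have "column \<omega> E1 E2 R p q N1 b" using col1 d by simp
  then show ?thesis unfolding column_def by fastforce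
qed

text \<open>Columns are concatenated along the successive returns to the base. Where two columns meet, cone_inclusion lets the
form jump from the final cone to the start cone without losing growth.\<close>

lemma lyapunov_forward:
  assumes E: "E \<in> {E1..E2}" and B: "\<And>x. \<bar>E - pot x\<bar> \<le> B" and V: "\<And>n. V n = pot (\<theta> + of_int n * \<omega>)"
  shows "t \<in> base \<Longrightarrow> \<theta> + of_int m * \<omega> = t + of_int k \<Longrightarrow>
    \<exists>c. c 0 = kf p q \<and> lyapunov V E (growth B R) (R\<^sup>2) m J c"
proof (induction J arbitrary: m t k rule: less_induct)
  case (less J)
  obtain P Q where PQ: "P 0 = p" "Q 0 = q"
    "\<And>n. n \<le> NN t \<Longrightarrow> 1 \<le> area (P n) (Q n) \<and> bd R (P n) \<and> bd R (Q n)"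
    "\<And>n. n < NN t \<Longrightarrow> inside (transfer_by (E - pot (t + real n * \<omega>)) (P n)) (transfer_by (E - pot (t + real n * \<omega>)) (Q n)) (P (Suc n)) (Q (Suc n))"
    "inside (P (NN t)) (Q (NN t)) p q \<or> inside (P (NN t)) (Q (NN t)) (- p) (- q)"
    using base_column[OF less.prems(1)] E unfolding column_def by fastforce
  have Vm: "V (m + int n) = pot (t + real n * \<omega>)" for n
  proof -
    have "\<theta> + of_int (m + int n) * \<omega> = (t + real n * \<omega>) + of_int k"
      using less.prems(2) by (simp add: algebra_simps)
    then show ?thesis unfolding V by (simp only: pot_shift)
  qed
  have coef: "case kf (P n) (Q n) of (\<alpha>, \<beta>, \<gamma>) \<Rightarrow> \<bar>\<alpha>\<bar> \<le> R\<^sup>2 \<and> \<bar>\<beta>\<bar> \<le> R\<^sup>2 \<and> \<bar>\<gamma>\<bar> \<le> R\<^sup>2" if "n \<le> NN t" for n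
  proof -
    have W: "1 \<le> area (P n) (Q n)" and b: "bd R (P n)" "bd R (Q n)" using PQ(3)[OF that] by auto
    have pr: "\<bar>u * v\<bar> \<le> R\<^sup>2" if "\<bar>u\<bar> \<le> R" "\<bar>v\<bar> \<le> R" for u v
      unfolding abs_mult power2_eq_square using that R by (intro mult_mono) auto
    have dv: "\<bar>x / area (P n) (Q n)\<bar> \<le> \<bar>x\<bar>" for x using W by (simp add: divide_le_eq mult_le_cancel_left1)
    have "\<bar>fst (P n) * snd (Q n)\<bar> \<le> R\<^sup>2" "\<bar>snd (P n) * fst (Q n)\<bar> \<le> R\<^sup>2" "\<bar>snd (P n) * snd (Q n)\<bar> \<le> R\<^sup>2" "\<bar>fst (P n) * fst (Q n)\<bar> \<le> R\<^sup>2"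
      using b by (auto intro!: pr simp: bd_def)
    moreover have "\<bar>(x + y) / 2\<bar> \<le> r" if "\<bar>x\<bar> \<le> r" "\<bar>y\<bar> \<le> r" for x y r :: real using that by (auto simp: abs_le_iff add_divide_distrib)
    ultimately have "\<bar>(fst (P n) * snd (Q n) + snd (P n) * fst (Q n)) / 2\<bar> \<le> R\<^sup>2"
      "\<bar>- (snd (P n) * snd (Q n))\<bar> \<le> R\<^sup>2" "\<bar>- (fst (P n) * fst (Q n))\<bar> \<le> R\<^sup>2" by simp_all
    then have "\<bar>(fst (P n) * snd (Q n) + snd (P n) * fst (Q n)) / 2 / area (P n) (Q n)\<bar> \<le> R\<^sup>2"
      "\<bar>- (snd (P n) * snd (Q n)) / area (P n) (Q n)\<bar> \<le> R\<^sup>2" "\<bar>- (fst (P n) * fst (Q n)) / area (P n) (Q n)\<bar> \<le> R\<^sup>2"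
      using dv order_trans by blast+
    then show ?thesis by (simp add: kf_def)
  qed
  have iso: "\<exists>x z. (x, z) \<noteq> (0, 0) \<and> qf (kf (P n) (Q n)) x z = 0" if "n \<le> NN t" for n
  proof -
    have "qf (kf (P n) (Q n)) (fst (P n)) (snd (P n)) = 0"
      unfolding qf_kf by (simp add: area_def)
    moreover have "(fst (P n), snd (P n)) \<noteq> (0, 0)" using PQ(3)[OF that] by (auto simp: area_def)
    ultimately show ?thesis by blast
  qed
  have grow: "qf (kf (P n) (Q n)) x z + growth B R * (x\<^sup>2 + z\<^sup>2)
      \<le> qf (kf (P (Suc n)) (Q (Suc n))) ((E - V (m + int n)) * x - z) x" if "n < NN t" for n x z
    unfolding Vm using that PQ(3)[of n] PQ(3)[of "Suc n"] PQ(4)[of n]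
    by (intro cone_growth B R) auto
  show ?case
  proof (cases "J \<le> NN t")
    case True
    have "lyapunov V E (growth B R) (R\<^sup>2) m J (\<lambda>n. kf (P n) (Q n))"
      unfolding lyapunov_def using True coef iso grow by auto
    then show ?thesis using PQ(1,2) by (intro exI[of _ "\<lambda>n. kf (P n) (Q n)"]) simp
  next
    case False
    have pos: "\<theta> + of_int (m + int (NN t)) * \<omega> = ret t + of_int (k + zz t)"
      using less.prems(2) ret_eq[of t] by (simp add: algebra_simps)
    obtain c where c: "c 0 = kf p q" "lyapunov V E (growth B R) (R\<^sup>2) (m + int (NN t)) (J - NN t) c"
      using less.IH[OF _ ret_base[OF less.prems(1)] pos, of "J - NN t"] False NN_pos[of t] by auto
    define e where "e n = (if n < NN t then kf (P n) (Q n) else c (n - NN t))" for n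
    have close: "qf (kf (P (NN t)) (Q (NN t))) x z \<le> qf (kf p q) x z" for x z
    proof -
      have W: "0 < area (P (NN t)) (Q (NN t))" "0 < area p q" using PQ(3)[of "NN t"] pq_pos by auto
      have neg: "kf (- p) (- q) = kf p q" "area (- p) (- q) = area p q" by (simp_all add: kf_def area_def)
      from PQ(5) show ?thesis
      proof
        assume "inside (P (NN t)) (Q (NN t)) p q"
        from cone_inclusion[OF this W] show ?thesis .
      next
        assume "inside (P (NN t)) (Q (NN t)) (- p) (- q)"
        from cone_inclusion[OF this W(1), unfolded neg, OF W(2)] show ?thesis .
      qed
    qed
    have "lyapunov V E (growth B R) (R\<^sup>2) m J e"
      unfolding lyapunov_def
    proof (intro conjI allI impI)
      fix j assume j: "j \<le> J"
      show "case e j of (\<alpha>, \<beta>, \<gamma>) \<Rightarrow> \<bar>\<alpha>\<bar> \<le> R\<^sup>2 \<and> \<bar>\<beta>\<bar> \<le> R\<^sup>2 \<and> \<bar>\<gamma>\<bar> \<le> R\<^sup>2"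
      proof (cases "j < NN t")
        case True
        then show ?thesis using coef[of j] by (simp add: e_def)
      next
        case False
        then show ?thesis using c(2) j unfolding lyapunov_def by (simp add: e_def)
      qed
      show "\<exists>x z. (x, z) \<noteq> (0, 0) \<and> qf (e j) x z = 0"
      proof (cases "j < NN t")
        case True
        then show ?thesis using iso[of j] by (simp add: e_def)
      next
        case False
        then show ?thesis using c(2) j unfolding lyapunov_def by (simp add: e_def)
      qed
    next
      fix j and x z :: real assume j: "j < J"
      consider "Suc j < NN t" | "Suc j = NN t" | "NN t \<le> j" by linarith
      then show "qf (e j) x z + growth B R * (x\<^sup>2 + z\<^sup>2) \<le> qf (e (Suc j)) ((E - V (m + int j)) * x - z) x"
      proof cases
        case 1
        then show ?thesis using grow[of j x z] by (simp add: e_def)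
      next
        case 2
        then have "e (Suc j) = kf p q" "e j = kf (P j) (Q j)" using c(1) by (auto simp: e_def)
        then show ?thesis using grow[of j x z] close 2 order_trans by (metis lessI)
      next
        case 3
        then obtain i where i: "j = NN t + i" by (metis le_Suc_ex)
        then have "i < J - NN t" using j by simp
        then have "qf (c i) x z + growth B R * (x\<^sup>2 + z\<^sup>2) \<le> qf (c (Suc i)) ((E - V (m + int (NN t) + int i)) * x - z) x"
          using c(2) unfolding lyapunov_def by blast
        then show ?thesis using i by (simp add: e_def add.assoc)
      qed
    qed
    moreover have "e 0 = kf p q" using NN_pos[of t] PQ(1,2) by (simp add: e_def)
    ultimately show ?thesis by blast
  qed
qed

text \<open>Every orbit visits the base arbitrarily far in the past, by density of the orbit of an irrational rotation.\<close>

lemma base_hit: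
  "\<exists>m\<le>a. \<exists>t\<in>base. \<exists>k. \<theta> + of_int m * \<omega> = t + of_int k"
proof -
  have irr': "- \<omega> \<notin> \<rat>" using irr by simp
  define r where "r = min ((d1 + d2) / 2) (1 / 2)"
  define \<alpha> where "\<alpha> = frac (b + r - \<theta> - of_int a * \<omega>)"
  have r: "0 < r" using d by (simp add: r_def)
  have "0 \<le> \<alpha>" "\<alpha> \<le> 1" unfolding \<alpha>_def using frac_lt_1[of "b + r - \<theta> - of_int a * \<omega>"] by auto
  then obtain j :: nat where j: "0 < j" "\<bar>frac (real j * - \<omega>) - \<alpha>\<bar> < r"
    using Kronecker_approx_1_explicit[OF irr' _ _ r] by blast
  define m where "m = a - int j"
  define e where "e = frac (real j * - \<omega>) - \<alpha>"
  define k where "k = \<lfloor>real j * - \<omega>\<rfloor> - \<lfloor>b + r - \<theta> - of_int a * \<omega>\<rfloor>"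
  have "\<theta> + of_int m * \<omega> = (b + r + e) + of_int k"
    unfolding m_def e_def k_def \<alpha>_def frac_def by (simp add: algebra_simps)
  moreover have "b + r + e \<in> base"
  proof -
    have "r \<le> d1 / 2 + d2 / 2" by (simp add: r_def add_divide_distrib)
    moreover have "\<bar>e\<bar> < r" using j(2) by (simp add: e_def)
    ultimately show ?thesis using d unfolding base_def atLeastLessThan_iff by linarith
  qed
  moreover have "m \<le> a" by (simp add: m_def)
  ultimately show ?thesis by blast
qed

lemma tower_hyperbolic:
  assumes E: "E \<in> {E1..E2}" and V: "\<And>n. V n = pot (\<theta> + of_int n * \<omega>)"
  shows "hyperbolic V E"
proof -
  define B where "B = \<bar>E\<bar> + 2"
  have B: "\<bar>E - pot x\<bar> \<le> B" for x unfolding B_def using pot_bound[of x] by linarith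
  have "\<exists>m J c. m \<le> a \<and> e \<le> m + int J \<and> lyapunov V E (growth B R) (R\<^sup>2) m J c" for a e
  proof -
    obtain m t k where m: "m \<le> a" "t \<in> base" "\<theta> + of_int m * \<omega> = t + of_int k" using base_hit by blast
    obtain c where "lyapunov V E (growth B R) (R\<^sup>2) m (nat (e - m)) c"
      using lyapunov_forward[OF E B V m(2,3)] by blast
    moreover have "e \<le> m + int (nat (e - m))" by simp
    ultimately show ?thesis using m(1) by blast
  qed
  moreover have "0 < growth B R" using growth_pos[OF R, of B] by (simp add: B_def)
  moreover have "0 \<le> R\<^sup>2" by simp
  ultimately show ?thesis unfolding hyperbolic_def by blast
qed

end

section \<open>Sign changes along a tower\<close>

lemma changes_add: "changes x (m + n) = changes x m + changes (\<lambda>j. x (m + j)) n"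
  by (induction n) simp_all

lemma changes_le: "changes x n \<le> n"
  by (induction n) auto

lemma changes_scale: "c \<noteq> 0 \<Longrightarrow> changes (\<lambda>n. c * x n) n = changes x n"
proof (induction n)
  case (Suc n)
  assume c: "c \<noteq> 0"
  have "(c * x n) * (c * x (Suc n)) = c\<^sup>2 * (x n * x (Suc n))" by (simp add: power2_eq_square)
  moreover have "0 < c\<^sup>2" using c by simp
  ultimately have "(c * x n) * (c * x (Suc n)) < 0 \<longleftrightarrow> x n * x (Suc n) < 0" by (metis mult_less_cancel_left_pos mult_zero_right)
  then show ?case using Suc c by simp
qed simp

text \<open>At a zero the sign is that of the next term, which matches the convention of changes for sequences whose zeros are
crossings.\<close>

definition pos_sign :: "(nat \<Rightarrow> real) \<Rightarrow> nat \<Rightarrow> bool" where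
  "pos_sign x n \<longleftrightarrow> (if x n \<noteq> 0 then 0 < x n else 0 < x (Suc n))"

lemma changes_pos_sign:
  fixes x :: "nat \<Rightarrow> real"
  assumes "x (Suc (Suc n)) = w * x (Suc n) - x n" "x n \<noteq> 0 \<or> x (Suc n) \<noteq> 0"
  shows "changes x (Suc n) = changes x n + (if pos_sign x n = pos_sign x (Suc n) then 0 else 1)"
proof -
  consider "x n = 0" "x (Suc n) \<noteq> 0" | "x n \<noteq> 0" "x (Suc n) = 0" | "x n \<noteq> 0" "x (Suc n) \<noteq> 0" using assms(2) by blast
  then show ?thesis
  proof cases
    case 1
    then show ?thesis by (simp add: pos_sign_def)
  next
    case 2
    then have "x (Suc (Suc n)) = - x n" using assms(1) by simp
    then show ?thesis using 2 by (auto simp: pos_sign_def)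
  next
    case 3
    then have "x n * x (Suc n) < 0 \<longleftrightarrow> (0 < x n) \<noteq> (0 < x (Suc n))" by (auto simp: mult_less_0_iff)
    then show ?thesis using 3 by (simp add: pos_sign_def)
  qed
qed

text \<open>Two solutions of one recurrence have constant Wronskian, so their zeros interlace: their signs, read at each site, can
be out of step by at most one change.\<close>

lemma sturm_comparison_pos:
  fixes u v :: "nat \<Rightarrow> real"
  assumes u: "\<And>n. u (Suc (Suc n)) = w n * u (Suc n) - u n" and v: "\<And>n. v (Suc (Suc n)) = w n * v (Suc n) - v n"
    and W: "0 < u 1 * v 0 - u 0 * v 1"
  shows "\<bar>int (changes u L) - int (changes v L)\<bar> \<le> 1"
proof -
  have W': "0 < u (Suc n) * v n - u n * v (Suc n)" for n
  proof (induction n)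
    case (Suc n)
    have "u (Suc (Suc n)) * v (Suc n) - u (Suc n) * v (Suc (Suc n)) = u (Suc n) * v n - u n * v (Suc n)"
      by (simp add: u v algebra_simps)
    then show ?case using Suc by simp
  qed (use W in simp)
  have nz: "u n \<noteq> 0 \<or> u (Suc n) \<noteq> 0" "v n \<noteq> 0 \<or> v (Suc n) \<noteq> 0" for n using W'[of n] by auto
  define e where "e n = (if pos_sign u n = pos_sign v n then 0 else - 1 :: int)" for n
  have "int (changes u n) - int (changes v n) = e n - e 0" for n
  proof (induction n)
    case (Suc n)
    define a a' c c' where "a = pos_sign u n" and "a' = pos_sign u (Suc n)" and "c = pos_sign v n" and "c' = pos_sign v (Suc n)"
    have su: "u (Suc (Suc n)) = - u n" if "u (Suc n) = 0" using u[of n] that by simp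
    have sv: "v (Suc (Suc n)) = - v n" if "v (Suc n) = 0" using v[of n] that by simp
    have A: "a = (if u n \<noteq> 0 then 0 < u n else 0 < u (Suc n))" "a' = (if u (Suc n) \<noteq> 0 then 0 < u (Suc n) else u n < 0)"
      "c = (if v n \<noteq> 0 then 0 < v n else 0 < v (Suc n))" "c' = (if v (Suc n) \<noteq> 0 then 0 < v (Suc n) else v n < 0)"
      unfolding a_def a'_def c_def c'_def pos_sign_def using su sv by simp_all
    have prod: "0 < u (Suc n) * v n \<or> u n * v (Suc n) < 0" using W'[of n] by linarith
    have ok: "\<not> (a = c \<and> a' \<noteq> a \<and> c' = c) \<and> \<not> (a \<noteq> c \<and> a' = a \<and> c' \<noteq> c)"
      using prod nz[of n] unfolding A zero_less_mult_iff mult_less_0_iff by (smt (verit))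
    have "changes u (Suc n) = changes u n + (if a = a' then 0 else 1)" "changes v (Suc n) = changes v n + (if c = c' then 0 else 1)"
      unfolding a_def a'_def c_def c'_def by (rule changes_pos_sign[OF u[of n] nz(1)[of n]], rule changes_pos_sign[OF v[of n] nz(2)[of n]])
    moreover have "e n = (if a = c then 0 else - 1)" "e (Suc n) = (if a' = c' then 0 else - 1)"
      by (simp_all add: e_def a_def a'_def c_def c'_def)
    ultimately show ?case using Suc ok by (cases a; cases a'; cases c; cases c') simp_all
  qed simp
  from this[of L] show ?thesis unfolding e_def by (auto split: if_splits)
qed

lemma sturm_comparison:
  fixes u v :: "nat \<Rightarrow> real"
  assumes u: "\<And>n. u (Suc (Suc n)) = w n * u (Suc n) - u n" and v: "\<And>n. v (Suc (Suc n)) = w n * v (Suc n) - v n"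
    and nz: "u 0 \<noteq> 0 \<or> u 1 \<noteq> 0" "v 0 \<noteq> 0 \<or> v 1 \<noteq> 0"
  shows "\<bar>int (changes u L) - int (changes v L)\<bar> \<le> 1"
proof -
  consider "0 < u 1 * v 0 - u 0 * v 1" | "0 < v 1 * u 0 - v 0 * u 1" | "u 1 * v 0 = u 0 * v 1"
    by (metis diff_gt_0_iff_gt linorder_neqE_linordered_idom mult.commute)
  then show ?thesis
  proof cases
    case 1
    then show ?thesis using sturm_comparison_pos[of u w v] u v by blast
  next
    case 2
    then show ?thesis using sturm_comparison_pos[of v w u L] u v by (simp add: abs_minus_commute)
  next
    case 3
    have "\<exists>c. c \<noteq> 0 \<and> u 0 = c * v 0 \<and> u 1 = c * v 1"
    proof (cases "v 0 = 0")
      case True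
      then show ?thesis using nz 3 by (intro exI[of _ "u 1 / v 1"]) auto
    next
      case False
      then show ?thesis using nz 3 by (intro exI[of _ "u 0 / v 0"]) (auto simp: field_simps)
    qed
    then obtain c where c: "c \<noteq> 0" "u 0 = c * v 0" "u (Suc 0) = c * v (Suc 0)" by auto
    have "u n = c * v n \<and> u (Suc n) = c * v (Suc n)" for n
    proof (induction n)
      case (Suc n)
      have "u (Suc (Suc n)) = c * (w n * v (Suc n) - v n)" unfolding u using Suc by (simp add: algebra_simps)
      then show ?case using Suc unfolding v[of n] by simp
    qed (use c in simp)
    then have "changes u L = changes v L" using changes_scale[OF c(1), of v L] by (metis ext)
    then show ?thesis by simp
  qed
qed

lemma fst_orb_rec: "fst (orb w u (Suc (Suc n))) = w (Suc n) * fst (orb w u (Suc n)) - fst (orb w u n)"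
  by (simp add: transfer_by_def)

lemma orb_scale: "orb w (c *\<^sub>R u) n = c *\<^sub>R orb w u n"
  by (induction n) (simp_all add: transfer_by_def algebra_simps)

text \<open>Phase, energy and the direction within the cone are deformed simultaneously. The first coordinate at the end of the
column never vanishes, as both start vectors have positive first coordinate, and the count is locally constant; the
parameter space is connected.\<close>

lemma column_count_constant:
  assumes col: "\<And>t. t \<in> {lo..hi} \<Longrightarrow> column \<omega> E1 E2 R p q N t" and pos: "0 < fst p" "0 < fst q"
    and t: "t \<in> {lo..hi}" "t' \<in> {lo..hi}" and E: "E \<in> {E1..E2}" "E' \<in> {E1..E2}"
    and u: "u \<in> sector p q" "u' \<in> sector p q"
  shows "changes (\<lambda>n. fst (orb (\<lambda>n. E - pot (t + real n * \<omega>)) u n)) N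
    = changes (\<lambda>n. fst (orb (\<lambda>n. E' - pot (t' + real n * \<omega>)) u' n)) N"
proof -
  define S where "S = {lo..hi} \<times> {E1..E2} \<times> {0..1::real}"
  define F where "F z n = orb (\<lambda>n. fst (snd z) - pot (fst z + real n * \<omega>)) ((1 - snd (snd z)) *\<^sub>R p + snd (snd z) *\<^sub>R q) n" for z :: "real \<times> real \<times> real" and n
  have cont: "continuous_on UNIV (\<lambda>z. F z n)" for n
  proof (induction n)
    case 0
    then show ?case unfolding F_def orb.simps by (intro continuous_intros)
  next
    case (Suc n)
    have "F z (Suc n) = ((fst (snd z) - pot (fst z + real n * \<omega>)) * fst (F z n) - snd (F z n), fst (F z n))" for z
      by (simp add: F_def transfer_by_def)
    then show ?case unfolding pot_def by (simp only:) (intro continuous_intros Suc)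
  qed
  have in_sector: "(1 - s) *\<^sub>R p + s *\<^sub>R q \<in> sector p q" if "s \<in> {0..1}" for s
    unfolding sector_def using that by (intro CollectI exI[of _ "1 - s"] exI[of _ s]) auto
  have sector_fst: "0 < fst v" if v: "v \<in> sector p q" for v
  proof -
    obtain s t where st: "0 \<le> s" "0 \<le> t" "0 < s + t" "v = s *\<^sub>R p + t *\<^sub>R q" using v by (auto simp: sector_def)
    have v: "fst v = s * fst p + t * fst q" using st(4) by simp
    have "0 \<le> s * fst p" "0 \<le> t * fst q" using st pos by simp_all
    moreover have "0 < s * fst p \<or> 0 < t * fst q" using st(1-3) pos by (cases "s = 0") simp_all
    ultimately show ?thesis unfolding v by linarith
  qed
  define f where "f z = changes (\<lambda>n. fst (F z n)) N" for z
  have "f constant_on S"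
  proof (rule locally_constant_imp_constant)
    show "connected S" unfolding S_def by (intro connected_Times connected_Icc)
    fix a assume a: "a \<in> S"
    define w where "w = (\<lambda>n. fst (snd a) - pot (fst a + real n * \<omega>))"
    define v where "v = (1 - snd (snd a)) *\<^sub>R p + snd (snd a) *\<^sub>R q"
    have vc: "v \<in> sector p q" unfolding v_def by (rule in_sector) (use a in \<open>simp add: S_def mem_Times_iff\<close>)
    have Fa: "F a n = orb w v n" for n unfolding F_def v_def w_def ..
    have zero: "fst (F a (Suc n)) = 0 \<Longrightarrow> fst (F a n) * fst (F a (Suc (Suc n))) < 0" for n
      unfolding Fa using sector_fst[OF vc]
      using recurrence_zero[where w = "\<lambda>n. w (Suc n)" and x = "\<lambda>n. fst (orb w v n)" and n = n, OF fst_orb_rec] by simp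
    have "orb w v N \<in> sector p q \<or> - orb w v N \<in> sector p q"
    proof (rule column_orbit[OF col _ vc])
      show "fst a \<in> {lo..hi}" "fst (snd a) \<in> {E1..E2}" using a by (simp_all add: S_def mem_Times_iff)
    qed (simp add: w_def)
    then have endN: "fst (F a N) \<noteq> 0" unfolding Fa using sector_fst[of "orb w v N"] sector_fst[of "- orb w v N"] by auto
    have "eventually (\<lambda>z. f z = f a) (at a within S)"
      unfolding f_def
    proof (rule changes_locally_constant[where L = N])
      show "((\<lambda>z. fst (F z n)) \<longlongrightarrow> fst (F a n)) (at a within S)" for n
      proof (rule tendsto_fst)
        have "continuous_on S (\<lambda>z. F z n)" using continuous_on_subset[OF cont] by blast
        then show "((\<lambda>z. F z n) \<longlongrightarrow> F a n) (at a within S)" using a unfolding continuous_on_def by blast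
      qed
      show "fst (F a 0) \<noteq> 0" using sector_fst[OF vc] by (simp add: Fa)
    qed (use zero endN in simp_all)
    then obtain T where T: "open T" "a \<in> T" "\<forall>z\<in>T. z \<noteq> a \<longrightarrow> z \<in> S \<longrightarrow> f z = f a"
      unfolding eventually_at_topological by blast
    have "\<forall>z\<in>S \<inter> T. f z = f a"
    proof
      fix z assume "z \<in> S \<inter> T"
      then show "f z = f a" using T(3) by (cases "z = a") auto
    qed
    moreover have "openin (top_of_set S) (S \<inter> T)" using T(1) by (rule openin_open_Int)
    ultimately show "\<exists>T. openin (top_of_set S) T \<and> a \<in> T \<and> (\<forall>x\<in>T. f x = f a)"
      using a T(2) by blast
  qed
  then obtain f0 where f0: "\<forall>z\<in>S. f z = f0" unfolding constant_on_def by blast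
  have norm: "\<exists>s\<in>{0..1}. \<exists>c>0. u = c *\<^sub>R ((1 - s) *\<^sub>R p + s *\<^sub>R q)" if u: "u \<in> sector p q" for u
  proof -
    obtain s t where st: "0 \<le> s" "0 \<le> t" "0 < s + t" "u = s *\<^sub>R p + t *\<^sub>R q" using u by (auto simp: sector_def)
    then have e: "(s + t) * (1 - t / (s + t)) = s" "(s + t) * (t / (s + t)) = t" by (simp_all add: field_simps)
    have "u = (s + t) *\<^sub>R ((1 - t / (s + t)) *\<^sub>R p + (t / (s + t)) *\<^sub>R q)"
      by (simp only: scaleR_right_distrib scaleR_scaleR e st(4))
    then show ?thesis using st by (intro bexI[of _ "t / (s + t)"] exI[of _ "s + t"]) auto
  qed
  have eval: "\<exists>s\<in>{0..1}. changes (\<lambda>n. fst (orb (\<lambda>n. E - pot (t + real n * \<omega>)) u n)) N = f (t, E, s)" if u: "u \<in> sector p q" for t E u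
  proof -
    obtain s c where sc: "s \<in> {0..1}" "0 < c" "u = c *\<^sub>R ((1 - s) *\<^sub>R p + s *\<^sub>R q)" using norm[OF u] by blast
    have "changes (\<lambda>n. fst (orb (\<lambda>n. E - pot (t + real n * \<omega>)) u n)) N = f (t, E, s)"
      unfolding f_def F_def sc(3) orb_scale using changes_scale[of c] sc(2) by simp
    then show ?thesis using sc(1) by blast
  qed
  obtain s where s: "s \<in> {0..1}" "changes (\<lambda>n. fst (orb (\<lambda>n. E - pot (t + real n * \<omega>)) u n)) N = f (t, E, s)"
    using eval[OF u(1), of E t] by blast
  obtain s' where s': "s' \<in> {0..1}" "changes (\<lambda>n. fst (orb (\<lambda>n. E' - pot (t' + real n * \<omega>)) u' n)) N = f (t', E', s')"
    using eval[OF u(2), of E' t'] by blast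
  have "(t, E, s) \<in> S" "(t', E', s') \<in> S" using s s' t E by (auto simp: S_def)
  then show ?thesis unfolding s(2) s'(2) using f0 by simp
qed

text \<open>One orbit in each of the two columns fixes the number of changes in all orbits of that column. The prescribed form
makes the count per column equal to (kap - k \<omega>) N plus k times the displacement under the return map, which
telescopes along an orbit.\<close>

locale counted_tower = tower +
  fixes kap k :: int
  assumes count1: "\<exists>t\<in>{b..b + d2}. \<exists>E\<in>{E1..E2}. \<exists>u\<in>sector p q.
      (\<forall>n\<le>N1. fst (orb (\<lambda>n. E - pot (t + real n * \<omega>)) u n) \<noteq> 0) \<and>
      int (changes (\<lambda>n. fst (orb (\<lambda>n. E - pot (t + real n * \<omega>)) u n)) N1) = kap * int N1 - k * z1"
    and count2: "\<exists>t\<in>{b + d2..b + d2 + d1}. \<exists>E\<in>{E1..E2}. \<exists>u\<in>sector p q.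
      (\<forall>n\<le>N2. fst (orb (\<lambda>n. E - pot (t + real n * \<omega>)) u n) \<noteq> 0) \<and>
      int (changes (\<lambda>n. fst (orb (\<lambda>n. E - pot (t + real n * \<omega>)) u n)) N2) = kap * int N2 - k * z2"
begin

lemma base_count:
  assumes "t \<in> base" "E \<in> {E1..E2}" "u \<in> sector p q"
  shows "real (changes (\<lambda>n. fst (orb (\<lambda>n. E - pot (t + real n * \<omega>)) u n)) (NN t)) = (kap - k * \<omega>) * real (NN t) + k * (ret t - t)"
proof -
  have "int (changes (\<lambda>n. fst (orb (\<lambda>n. E - pot (t + real n * \<omega>)) u n)) (NN t)) = kap * int (NN t) - k * zz t"
  proof (cases "t < b + d2")
    case True
    obtain t' E' u' where *: "t' \<in> {b..b + d2}" "E' \<in> {E1..E2}" "u' \<in> sector p q"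
      "int (changes (\<lambda>n. fst (orb (\<lambda>n. E' - pot (t' + real n * \<omega>)) u' n)) N1) = kap * int N1 - k * z1" using count1 by (elim bexE conjE) (rule that)
    have "t \<in> {b..b + d2}" using True assms(1) by (auto simp: base_def)
    have "changes (\<lambda>n. fst (orb (\<lambda>n. E - pot (t + real n * \<omega>)) u n)) N1 = changes (\<lambda>n. fst (orb (\<lambda>n. E' - pot (t' + real n * \<omega>)) u' n)) N1"
    proof (rule column_count_constant[where lo = "b" and hi = "b + d2" and ?E1.0 = E1 and ?E2.0 = E2 and R = R and p = p and q = q])
      show "\<And>t. t \<in> {b..b + d2} \<Longrightarrow> column \<omega> E1 E2 R p q N1 t" by (rule col1)
    qed (use \<open>t \<in> {b..b + d2}\<close> * assms first_pos in simp_all)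
    with *(4) True
    show ?thesis by (simp add: NN_def zz_def)
  next
    case False
    obtain t' E' u' where *: "t' \<in> {b + d2..b + d2 + d1}" "E' \<in> {E1..E2}" "u' \<in> sector p q"
      "int (changes (\<lambda>n. fst (orb (\<lambda>n. E' - pot (t' + real n * \<omega>)) u' n)) N2) = kap * int N2 - k * z2" using count2 by (elim bexE conjE) (rule that)
    have "t \<in> {b + d2..b + d2 + d1}" using False assms(1) by (auto simp: base_def)
    have "changes (\<lambda>n. fst (orb (\<lambda>n. E - pot (t + real n * \<omega>)) u n)) N2 = changes (\<lambda>n. fst (orb (\<lambda>n. E' - pot (t' + real n * \<omega>)) u' n)) N2"
    proof (rule column_count_constant[where lo = "b + d2" and hi = "b + d2 + d1" and ?E1.0 = E1 and ?E2.0 = E2 and R = R and p = p and q = q])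
      show "\<And>t. t \<in> {b + d2..b + d2 + d1} \<Longrightarrow> column \<omega> E1 E2 R p q N2 t" by (rule col2)
    qed (use \<open>t \<in> {b + d2..b + d2 + d1}\<close> * assms first_pos in simp_all)
    with *(4) False
    show ?thesis by (simp add: NN_def zz_def)
  qed
  then have "real_of_int (int (changes (\<lambda>n. fst (orb (\<lambda>n. E - pot (t + real n * \<omega>)) u n)) (NN t))) = real_of_int (kap * int (NN t) - k * zz t)"
    by (rule arg_cong)
  then have "real (changes (\<lambda>n. fst (orb (\<lambda>n. E - pot (t + real n * \<omega>)) u n)) (NN t)) = kap * real (NN t) - k * real_of_int (zz t)" by simp
  moreover have "real_of_int (zz t) = t + real (NN t) * \<omega> - ret t" using ret_eq[of t] by linarith
  ultimately show ?thesis by (simp add: algebra_simps)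
qed

text \<open>The displacements telescope to the total displacement within the base, which is bounded. Only the last, incomplete
column contributes a further bounded error.\<close>

lemma orbit_count:
  assumes E: "E \<in> {E1..E2}"
  shows "t \<in> base \<Longrightarrow> u \<in> sector p q \<or> - u \<in> sector p q \<Longrightarrow>
    \<exists>t'\<in>base. \<bar>real (changes (\<lambda>n. fst (orb (\<lambda>n. E - pot (t + real n * \<omega>)) u n)) L) - (kap - k * \<omega>) * real L - k * (t' - t)\<bar>
      \<le> (1 + \<bar>kap - k * \<omega>\<bar>) * real (N1 + N2)"
proof (induction L arbitrary: t u rule: less_induct)
  case (less L)
  define w where "w n = E - pot (t + real n * \<omega>)" for n
  define x where "x n = fst (orb w u n)" for n
  define N where "N = NN t"
  show ?case
  proof (cases "L < N")
    case True
    have "real L \<le> real (N1 + N2)" using True by (auto simp: N_def NN_def split: if_splits)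
    have "\<bar>real (changes x L) - (kap - k * \<omega>) * real L\<bar> \<le> \<bar>real (changes x L)\<bar> + \<bar>(kap - k * \<omega>) * real L\<bar>" by (rule abs_triangle_ineq4)
    also have "\<dots> \<le> real L + \<bar>kap - k * \<omega>\<bar> * real L" using changes_le[of x L] by (simp add: abs_mult)
    also have "\<dots> = (1 + \<bar>kap - k * \<omega>\<bar>) * real L" by (simp add: algebra_simps)
    also have "\<dots> \<le> (1 + \<bar>kap - k * \<omega>\<bar>) * real (N1 + N2)" using \<open>real L \<le> real (N1 + N2)\<close> by (intro mult_left_mono) auto
    finally have "\<bar>real (changes x L) - (kap - k * \<omega>) * real L - k * (t - t)\<bar> \<le> (1 + \<bar>kap - k * \<omega>\<bar>) * real (N1 + N2)" by simp
    then show ?thesis using less.prems(1) unfolding x_def w_def by (rule bexI)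
  next
    case False
    then obtain M where M: "L = N + M" by (metis le_Suc_ex not_less)
    have M_less: "M < L" using NN_pos[of t] M by (simp add: N_def)
    have neg: "orb w (- v) n = - orb w v n" for v n using orb_scale[of w "-1" v n] by simp
    have x_neg: "changes (\<lambda>n. fst (orb w (- u) n)) N = changes x N"
      using changes_scale[of "-1" x N] by (simp add: neg x_def)
    have cnt: "real (changes x N) = (kap - k * \<omega>) * real N + k * (ret t - t)"
      using less.prems(2)
    proof
      assume "u \<in> sector p q"
      from base_count[OF less.prems(1) E this] show ?thesis unfolding x_def w_def N_def .
    next
      assume "- u \<in> sector p q"
      from base_count[OF less.prems(1) E this] show ?thesis unfolding x_neg[symmetric] unfolding w_def N_def .
    qed
    define u' where "u' = orb w u N"
    have u': "u' \<in> sector p q \<or> - u' \<in> sector p q"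
      using less.prems(2)
    proof
      assume "u \<in> sector p q"
      show ?thesis unfolding u'_def N_def
        by (rule column_orbit[OF base_column[OF less.prems(1)] E \<open>u \<in> sector p q\<close>]) (simp add: w_def)
    next
      assume "- u \<in> sector p q"
      have "orb w (- u) N \<in> sector p q \<or> - orb w (- u) N \<in> sector p q" unfolding N_def
        by (rule column_orbit[OF base_column[OF less.prems(1)] E \<open>- u \<in> sector p q\<close>]) (simp add: w_def)
      then show ?thesis unfolding u'_def neg by auto
    qed
    have w': "w (N + j) = E - pot (ret t + real j * \<omega>)" for j
    proof -
      have "t + real (N + j) * \<omega> = (ret t + real j * \<omega>) + of_int (zz t)"
        using ret_eq[of t] by (simp add: N_def algebra_simps)
      then show ?thesis unfolding w_def by (simp only: pot_shift)
    qed
    have "changes x L = changes x N + changes (\<lambda>j. x (N + j)) M" unfolding M by (rule changes_add)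
    also have "(\<lambda>j. x (N + j)) = (\<lambda>j. fst (orb (\<lambda>j. E - pot (ret t + real j * \<omega>)) u' j))"
      unfolding x_def orb_add u'_def w' ..
    finally have split_eq: "changes x L = changes x N + changes (\<lambda>j. fst (orb (\<lambda>j. E - pot (ret t + real j * \<omega>)) u' j)) M" .
    obtain t' where t': "t' \<in> base" "\<bar>real (changes (\<lambda>n. fst (orb (\<lambda>n. E - pot (ret t + real n * \<omega>)) u' n)) M) - (kap - k * \<omega>) * real M - k * (t' - ret t)\<bar>
      \<le> (1 + \<bar>kap - k * \<omega>\<bar>) * real (N1 + N2)"
      using less.IH[OF M_less ret_base[OF less.prems(1)] u'] by (elim bexE) (rule that)
    have "real (changes x L) - (kap - k * \<omega>) * real L - k * (t' - t)
       = real (changes (\<lambda>n. fst (orb (\<lambda>n. E - pot (ret t + real n * \<omega>)) u' n)) M) - (kap - k * \<omega>) * real M - k * (t' - ret t)"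
    proof -
      have sr: "real (changes x L) = ((kap - k * \<omega>) * real N + k * (ret t - t)) + real (changes (\<lambda>n. fst (orb (\<lambda>n. E - pot (ret t + real n * \<omega>)) u' n)) M)"
        unfolding split_eq of_nat_add cnt ..
      have L: "real L = real N + real M" by (simp add: M)
      have alg: "(c * n + i * (r - s)) + S - c * (n + j) - i * (s' - s) = S - c * j - i * (s' - r)" for S c n j r s s' i :: real
        by (simp add: algebra_simps)
      show ?thesis unfolding sr L by (rule alg)
    qed
    with t'(2) have "\<bar>real (changes x L) - (kap - k * \<omega>) * real L - k * (t' - t)\<bar> \<le> (1 + \<bar>kap - k * \<omega>\<bar>) * real (N1 + N2)" by (simp only:)
    then show ?thesis using t'(1) unfolding x_def w_def by (rule bexI)
  qed
qed

text \<open>The Dirichlet solution is compared, by Sturm's theorem, with an orbit in the cone that starts at a visit to the base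
before site 1; the initial piece of that orbit has a length independent of L.\<close>

lemma dirichlet_count_bounded:
  assumes E: "E \<in> {E1..E2}" and V: "\<And>n. V n = pot (\<theta> + of_int n * \<omega>)"
  shows "\<exists>K. \<forall>L. \<bar>real (changes (dirichlet V E) L) - (kap - k * \<omega>) * real L\<bar> \<le> K"
proof -
  obtain m t i where m: "m \<le> 1" "t \<in> base" "\<theta> + of_int m * \<omega> = t + of_int i" using base_hit by blast
  define n0 where "n0 = nat (1 - m)"
  define w where "w n = E - pot (t + real n * \<omega>)" for n
  have pc: "p \<in> sector p q" unfolding sector_def by (intro CollectI exI[of _ 1] exI[of _ 0]) auto
  define x where "x n = fst (orb w p n)" for n
  have w_V: "w (n0 + n) = E - V (int n + 1)" for n
  proof -
    have "m + int n0 = 1" using m(1) by (simp add: n0_def)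
    then have "real_of_int m + real n0 = 1" by (metis of_int_1 of_int_add of_int_of_nat_eq)
    then have "\<theta> + of_int (int n + 1) * \<omega> = \<theta> + (of_int m + real n0 + real n) * \<omega>" by simp
    also have "\<dots> = (t + real (n0 + n) * \<omega>) + of_int i" using m(3) by (simp add: algebra_simps)
    finally show ?thesis unfolding w_def V by (simp only: pot_shift)
  qed
  define y where "y n = x (n0 + n)" for n
  have y: "y (Suc (Suc n)) = (E - V (int n + 2)) * y (Suc n) - y n" for n
    using fst_orb_rec[of w p "n0 + n"] w_V[of "Suc n"] by (simp add: y_def x_def add.commute)
  have nz: "x n \<noteq> 0 \<or> x (Suc n) \<noteq> 0" for n
  proof (induction n)
    case 0
    then show ?case using first_pos by (simp add: x_def)
  next
    case (Suc n)
    then show ?case using fst_orb_rec[of w p n] by (auto simp: x_def)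
  qed
  have comp: "\<bar>int (changes (dirichlet V E) L) - int (changes y L)\<bar> \<le> 1" for L
    using nz[of n0] by (intro sturm_comparison[where w = "\<lambda>n. E - V (int n + 2)"]) (auto simp: y dirichlet_simps, auto simp: y_def)
  have tot: "changes x (n0 + L) = changes x n0 + changes y L" for L unfolding y_def by (rule changes_add)
  have t'_bd: "\<bar>k * (t' - t)\<bar> \<le> \<bar>real_of_int k\<bar> * (d1 + d2)" if "t' \<in> base" for t'
    unfolding abs_mult using that m(2) by (intro mult_left_mono) (auto simp: base_def)
  define K where "K = (1 + \<bar>kap - k * \<omega>\<bar>) * real (N1 + N2) + \<bar>real_of_int k\<bar> * (d1 + d2)"
  have xb: "\<bar>real (changes x L) - (kap - k * \<omega>) * real L\<bar> \<le> K" for L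
  proof -
    obtain t' where t': "t' \<in> base" "\<bar>real (changes x L) - (kap - k * \<omega>) * real L - k * (t' - t)\<bar> \<le> (1 + \<bar>kap - k * \<omega>\<bar>) * real (N1 + N2)"
      using orbit_count[OF E m(2) disjI1[OF pc], of L, folded w_def x_def] by (elim bexE) (rule that)
    then show ?thesis using t'_bd[OF t'(1)] unfolding K_def by linarith
  qed
  have "\<bar>real (changes (dirichlet V E) L) - (kap - k * \<omega>) * real L\<bar> \<le> 1 + (K + \<bar>(kap - k * \<omega>) * real n0\<bar> + real (changes x n0))" for L
  proof -
    have c: "\<bar>real (changes (dirichlet V E) L) - real (changes y L)\<bar> \<le> 1" using comp[of L] by linarith
    have "real (changes x (n0 + L)) = real (changes x n0) + real (changes y L)" using tot[of L] by simp
    moreover have "(kap - k * \<omega>) * real (n0 + L) = (kap - k * \<omega>) * real n0 + (kap - k * \<omega>) * real L" by (simp add: algebra_simps)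
    ultimately show ?thesis using xb[of "n0 + L"] c by linarith
  qed
  then show ?thesis by blast
qed

end

section \<open>The symmetry of the spectrum\<close>

text \<open>Changing the sign of every other term of a solution exchanges E and - E once the phase moves by one half; on vectors
of consecutive terms this is the reflection mir, up to sign.\<close>

definition mir :: "real \<times> real \<Rightarrow> real \<times> real" where "mir u = (fst u, - snd u)"

lemma mir_simps: "fst (mir u) = fst u" "snd (mir u) = - snd u" "mir (- u) = - mir u"
  "transfer_by (- w) (mir u) = - mir (transfer_by w u)" "area (mir u) (mir v) = area v u" "mir (s *\<^sub>R u + t *\<^sub>R v) = s *\<^sub>R mir u + t *\<^sub>R mir v"
  "mir (s *\<^sub>R u) = s *\<^sub>R mir u"
  by (simp_all add: mir_def transfer_by_def area_def prod_eq_iff algebra_simps)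

lemma am_scale: "transfer_by w (c *\<^sub>R u) = c *\<^sub>R transfer_by w u"
  by (simp add: transfer_by_def algebra_simps)

lemma area_scale: "area (c *\<^sub>R u) (e *\<^sub>R v) = c * e * area u v"
  by (simp add: area_def algebra_simps)

lemma pot_half: "pot (x + 1/2) = - pot x"
  unfolding pot_def by (simp add: distrib_left cos_add)

lemma sign_sq: "((-1) ^ n * (-1) ^ n :: real) = 1"
  by (simp flip: power_mult_distrib)

lemma inside_mir:
  assumes "inside X Y P Q" and c: "c * c = 1"
  shows "inside (c *\<^sub>R mir Y) (c *\<^sub>R mir X) (c *\<^sub>R mir Q) (c *\<^sub>R mir P)"
  using assms by (simp add: inside_def area_scale mir_simps)

lemma column_mir:
  assumes "column \<omega> E1 E2 R p q N t"
  shows "column \<omega> (- E2) (- E1) R (mir q) (mir p) N (t + 1/2)"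
proof -
  obtain P Q where PQ: "P 0 = p" "Q 0 = q"
    "\<forall>n\<le>N. 1 \<le> area (P n) (Q n) \<and> bd R (P n) \<and> bd R (Q n)"
    "\<forall>n<N. \<forall>E\<in>{E1..E2}. inside (transfer_by (E - pot (t + real n * \<omega>)) (P n)) (transfer_by (E - pot (t + real n * \<omega>)) (Q n)) (P (Suc n)) (Q (Suc n))"
    "inside (P N) (Q N) p q \<or> inside (P N) (Q N) (- p) (- q)"
    using assms unfolding column_def by auto
  define c :: "nat \<Rightarrow> real" where "c n = (-1) ^ n" for n
  have cc: "c n * c n = 1" "\<bar>c n\<bar> = 1" for n by (auto simp: c_def sign_sq power_abs)
  define P' where "P' n = c n *\<^sub>R mir (Q n)" for n
  define Q' where "Q' n = c n *\<^sub>R mir (P n)" for n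
  have bdm: "bd R (c n *\<^sub>R mir u)" if "bd R u" for n u using that cc(2)[of n] by (simp add: bd_def mir_simps abs_mult)
  have "P' 0 = mir q" "Q' 0 = mir p" using PQ by (simp_all add: P'_def Q'_def c_def)
  moreover have "\<forall>n\<le>N. 1 \<le> area (P' n) (Q' n) \<and> bd R (P' n) \<and> bd R (Q' n)"
    using PQ(3) bdm unfolding P'_def Q'_def area_scale mir_simps cc by auto
  moreover have "\<forall>n<N. \<forall>E\<in>{- E2..- E1}. inside (transfer_by (E - pot (t + 1/2 + real n * \<omega>)) (P' n)) (transfer_by (E - pot (t + 1/2 + real n * \<omega>)) (Q' n)) (P' (Suc n)) (Q' (Suc n))"
  proof (intro allI impI ballI)
    fix n E assume n: "n < N" and E: "E \<in> {- E2..- E1}"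
    define w where "w = - E - pot (t + real n * \<omega>)"
    have "E - pot (t + 1/2 + real n * \<omega>) = - w"
      using pot_half[of "t + real n * \<omega>"] by (simp add: w_def add.commute add.left_commute)
    moreover have "transfer_by (- w) (c n *\<^sub>R mir u) = c (Suc n) *\<^sub>R mir (transfer_by w u)" for u
      by (simp add: am_scale mir_simps c_def)
    moreover have "inside (transfer_by w (P n)) (transfer_by w (Q n)) (P (Suc n)) (Q (Suc n))"
      using PQ(4) n E unfolding w_def by simp
    ultimately show "inside (transfer_by (E - pot (t + 1/2 + real n * \<omega>)) (P' n)) (transfer_by (E - pot (t + 1/2 + real n * \<omega>)) (Q' n)) (P' (Suc n)) (Q' (Suc n))"
      unfolding P'_def Q'_def using inside_mir[OF _ cc(1)] by simp
  qed
  moreover have "inside (P' N) (Q' N) (mir q) (mir p) \<or> inside (P' N) (Q' N) (- mir q) (- mir p)"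
  proof -
    have "inside (P' N) (Q' N) (c N *\<^sub>R mir q) (c N *\<^sub>R mir p) \<or> inside (P' N) (Q' N) (c N *\<^sub>R mir (- q)) (c N *\<^sub>R mir (- p))"
      using PQ(5) inside_mir[OF _ cc(1)[of N]] unfolding P'_def Q'_def by blast
    moreover have "c N = 1 \<or> c N = - 1" using cc(2)[of N] by linarith
    ultimately show ?thesis by (auto simp: mir_simps)
  qed
  ultimately show ?thesis unfolding column_def by blast
qed

lemma orb_mir: "orb (\<lambda>n. - w n) (mir u) n = (-1) ^ n *\<^sub>R mir (orb w u n)"
  by (induction n) (simp_all add: am_scale mir_simps)

lemma changes_alternate:
  assumes "\<And>n. n \<le> N \<Longrightarrow> x n \<noteq> 0" "n \<le> N"
  shows "changes (\<lambda>n. (-1) ^ n * x n) n + changes x n = n"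
  using assms(2)
proof (induction n)
  case (Suc n)
  have nz: "x n \<noteq> 0" "x (Suc n) \<noteq> 0" using assms(1) Suc.prems by auto
  define y where "y n = (-1) ^ n * x n" for n
  have "y n * y (Suc n) = - (((-1) ^ n * (-1) ^ n) * (x n * x (Suc n)))" by (simp add: y_def)
  then have e: "y n * y (Suc n) = - (x n * x (Suc n))" by (simp only: sign_sq mult_1)
  have y0: "y (Suc n) \<noteq> 0" using nz by (simp add: y_def)
  have IH: "changes y n + changes x n = n" using Suc unfolding y_def by simp
  have "x n * x (Suc n) \<noteq> 0" using nz by simp
  then have "(if y n * y (Suc n) < 0 \<or> y (Suc n) = 0 then 1 else 0) + (if x n * x (Suc n) < 0 \<or> x (Suc n) = 0 then 1 else (0::nat)) = 1"
    using nz y0 unfolding e by (cases "x n * x (Suc n) < 0") simp_all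
  then show ?case using IH unfolding y_def[symmetric, abs_def] changes.simps by linarith
qed simp

text \<open>Alternation turns each sign change into a constancy and conversely, so a count c in a column of length N becomes N -
c.\<close>

lemma count_mir:
  assumes "\<exists>t\<in>{lo..hi}. \<exists>E\<in>{E1..E2}. \<exists>u\<in>sector p q.
      (\<forall>n\<le>N. fst (orb (\<lambda>n. E - pot (t + real n * \<omega>)) u n) \<noteq> 0) \<and>
      int (changes (\<lambda>n. fst (orb (\<lambda>n. E - pot (t + real n * \<omega>)) u n)) N) = kap * int N - k * z"
  shows "\<exists>t\<in>{lo + 1/2..hi + 1/2}. \<exists>E\<in>{- E2..- E1}. \<exists>u\<in>sector (mir q) (mir p).
      (\<forall>n\<le>N. fst (orb (\<lambda>n. E - pot (t + real n * \<omega>)) u n) \<noteq> 0) \<and>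
      int (changes (\<lambda>n. fst (orb (\<lambda>n. E - pot (t + real n * \<omega>)) u n)) N) = (1 - kap) * int N - (- k) * z"
proof -
  obtain t E u where *: "t \<in> {lo..hi}" "E \<in> {E1..E2}" "u \<in> sector p q"
    "\<forall>n\<le>N. fst (orb (\<lambda>n. E - pot (t + real n * \<omega>)) u n) \<noteq> 0"
    "int (changes (\<lambda>n. fst (orb (\<lambda>n. E - pot (t + real n * \<omega>)) u n)) N) = kap * int N - k * z"
    using assms by (elim bexE conjE) (rule that)
  define w where "w = (\<lambda>n. E - pot (t + real n * \<omega>))"
  have w': "(\<lambda>n. - E - pot (t + 1/2 + real n * \<omega>)) = (\<lambda>n. - w n)"
  proof
    fix n
    show "- E - pot (t + 1/2 + real n * \<omega>) = - w n"
      using pot_half[of "t + real n * \<omega>"] by (simp add: w_def add.commute add.left_commute)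
  qed
  have fst': "fst (orb (\<lambda>n. - E - pot (t + 1/2 + real n * \<omega>)) (mir u) n) = (-1) ^ n * fst (orb w u n)" for n
    unfolding w' orb_mir by (simp add: mir_simps)
  have uc: "mir u \<in> sector (mir q) (mir p)"
  proof -
    obtain s r where "0 \<le> s" "0 \<le> r" "0 < s + r" "u = s *\<^sub>R p + r *\<^sub>R q" using *(3) by (auto simp: sector_def)
    then have "0 \<le> r" "0 \<le> s" "0 < r + s" "mir u = r *\<^sub>R mir q + s *\<^sub>R mir p" by (simp_all add: mir_simps add.commute)
    then show ?thesis unfolding sector_def by blast
  qed
  have nz: "\<forall>n\<le>N. fst (orb (\<lambda>n. - E - pot (t + 1/2 + real n * \<omega>)) (mir u) n) \<noteq> 0"
    using *(4) unfolding fst' w_def by simp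
  have "changes (\<lambda>n. (-1) ^ n * fst (orb w u n)) N + changes (\<lambda>n. fst (orb w u n)) N = N"
    using *(4) unfolding w_def by (intro changes_alternate[where N = N]) auto
  then have "int (changes (\<lambda>n. fst (orb (\<lambda>n. - E - pot (t + 1/2 + real n * \<omega>)) (mir u) n)) N) = (1 - kap) * int N - (- k) * z"
    unfolding fst' using *(5) unfolding w_def[symmetric] by (simp add: algebra_simps)
  then show ?thesis using nz uc *(1,2)
    by (intro bexI[of _ "t + 1/2"] bexI[of _ "- E"] bexI[of _ "mir u"] conjI) auto
qed

lemma tower_mir:
  assumes "tower \<omega> E1 E2 R b d1 d2 p q N1 N2 z1 z2"
  shows "tower \<omega> (- E2) (- E1) R (b + 1/2) d1 d2 (mir q) (mir p) N1 N2 z1 z2"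
proof -
  interpret tower \<omega> E1 E2 R b d1 d2 p q N1 N2 z1 z2 by (rule assms)
  show ?thesis
  proof
    fix t assume "t \<in> {b + 1/2..b + 1/2 + d2}"
    then have "t - 1/2 \<in> {b..b + d2}" by auto
    from column_mir[OF col1[OF this]] show "column \<omega> (- E2) (- E1) R (mir q) (mir p) N1 t" by simp
  next
    fix t assume "t \<in> {b + 1/2 + d2..b + 1/2 + d2 + d1}"
    then have "t - 1/2 \<in> {b + d2..b + d2 + d1}" by auto
    from column_mir[OF col2[OF this]] show "column \<omega> (- E2) (- E1) R (mir q) (mir p) N2 t" by simp
  qed (use R d N w1 w2 irr first_pos in \<open>auto simp: mir_simps\<close>)
qed

lemma counted_tower_mir:
  assumes "counted_tower \<omega> E1 E2 R b d1 d2 p q N1 N2 z1 z2 kap k"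
  shows "counted_tower \<omega> (- E2) (- E1) R (b + 1/2) d1 d2 (mir q) (mir p) N1 N2 z1 z2 (1 - kap) (- k)"
proof -
  interpret counted_tower \<omega> E1 E2 R b d1 d2 p q N1 N2 z1 z2 kap k by (rule assms)
  have e: "b + d2 + 1/2 = b + 1/2 + d2" "b + d2 + d1 + 1/2 = b + 1/2 + d2 + d1" by simp_all
  have "tower \<omega> (- E2) (- E1) R (b + 1/2) d1 d2 (mir q) (mir p) N1 N2 z1 z2" by (rule tower_mir) unfold_locales
  then show ?thesis
    unfolding counted_tower_def counted_tower_axioms_def
    using count_mir[OF count1, unfolded e] count_mir[OF count2, unfolded e] by blast
qed

section \<open>Gap labels from counted towers\<close>

lemma amo_jacobi: "amo \<omega> \<theta> = jacobi (amo_potential \<omega> \<theta>)"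
  by (intro ext) (simp add: amo_def jacobi_def)

lemma amo_pot: "amo_potential \<omega> \<theta> n = pot (\<theta> + of_int n * \<omega>)"
  by (simp add: amo_potential_def pot_def algebra_simps)

lemma amo_pot_bound: "\<bar>amo_potential \<omega> \<theta> n\<bar> \<le> 2"
  unfolding amo_pot by (rule pot_bound)

lemma amo_restriction_jmat: "amo_restriction \<omega> \<theta> L = jmat (amo_potential \<omega> \<theta>) L"
  unfolding amo_restriction_def jmat_def ..

lemma resolventI: "hyperbolic (amo_potential \<omega> \<theta>) E \<Longrightarrow> E \<notin> amo_spectrum \<omega> \<theta>"
  unfolding amo_spectrum_def amo_jacobi using hyperbolic_resolvent amo_pot_bound by blast

definition cnt :: "real \<Rightarrow> real \<Rightarrow> real \<Rightarrow> nat \<Rightarrow> real" where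
  "cnt \<omega> \<theta> a L = real (card (jroots (amo_potential \<omega> \<theta>) L \<inter> {..a}))"

lemma ids_eqI:
  assumes "(\<lambda>L. cnt \<omega> \<theta> a L / real L) \<longlonglongrightarrow> \<nu>"
  shows "amo_ids \<omega> \<theta> a = \<nu>"
proof -
  have "eigenvalue_count (amo_restriction \<omega> \<theta> L) a = card (jroots (amo_potential \<omega> \<theta>) L \<inter> {..a})" for L
    unfolding amo_restriction_jmat by (rule eigenvalue_count_jmat) (rule amo_pot_bound)
  then show ?thesis unfolding amo_ids_def using limI[OF assms] by (simp add: cnt_def)
qed

text \<open>The density at one point of a gap determines it on the whole gap, as counts there differ by a bounded amount.\<close>

lemma density_component:
  assumes U: "U \<in> spectral_gaps \<omega> \<theta>" "a \<in> U" "c \<in> U" and lim: "(\<lambda>L. cnt \<omega> \<theta> a L / real L) \<longlonglongrightarrow> \<nu>"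
  shows "(\<lambda>L. cnt \<omega> \<theta> c L / real L) \<longlonglongrightarrow> \<nu>"
proof -
  have con: "connected U" using U(1) in_components_connected unfolding spectral_gaps_def by blast
  have res: "complex_of_real x \<notin> l2_spectrum (jacobi (amo_potential \<omega> \<theta>))" if "x \<in> U" for x
    using in_components_subset[OF U(1)[unfolded spectral_gaps_def]] that by (auto simp: amo_spectrum_def amo_jacobi)
  obtain K where "\<And>L. \<bar>cnt \<omega> \<theta> a L - cnt \<omega> \<theta> c L\<bar> \<le> K"
    using count_diff_bounded[OF con res U(2,3)] unfolding cnt_def by blast
  from density_transfer[OF lim this] show ?thesis .
qed

lemma density_high: "5 \<le> a \<Longrightarrow> (\<lambda>L. cnt \<omega> \<theta> a L / real L) \<longlonglongrightarrow> 1"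
proof -
  assume a: "5 \<le> a"
  have "cnt \<omega> \<theta> a L / real L = 1" if "1 \<le> L" for L
  proof -
    have "jroots (amo_potential \<omega> \<theta>) L \<inter> {..a} = jroots (amo_potential \<omega> \<theta>) L"
    proof -
      have "r \<le> a" if "r \<in> jroots (amo_potential \<omega> \<theta>) L" for r
        using dirichlet_large_growth[where V = "amo_potential \<omega> \<theta>" and n = L and a = r, OF amo_pot_bound] that a
        by (force simp: jroots_def)
      then show ?thesis by blast
    qed
    then show ?thesis using that card_jroots[where V = "amo_potential \<omega> \<theta>", OF amo_pot_bound] by (simp add: cnt_def)
  qed
  then have "eventually (\<lambda>L. cnt \<omega> \<theta> a L / real L = 1) sequentially" unfolding eventually_sequentially by blast
  then show ?thesis by (rule tendsto_eventually)
qed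

lemma density_low: "a \<le> -5 \<Longrightarrow> (\<lambda>L. cnt \<omega> \<theta> a L / real L) \<longlonglongrightarrow> 0"
proof -
  assume a: "a \<le> -5"
  have "jroots (amo_potential \<omega> \<theta>) L \<inter> {..a} = {}" for L
  proof -
    have "\<not> r \<le> a" if "r \<in> jroots (amo_potential \<omega> \<theta>) L" for r
      using dirichlet_small_alternates[where V = "amo_potential \<omega> \<theta>" and n = L and a = r, OF amo_pot_bound] that a
      by (force simp: jroots_def)
    then show ?thesis by blast
  qed
  then show ?thesis by (simp add: cnt_def)
qed

lemma gap_containing:
  assumes "connected I" "I \<noteq> {}" "\<And>E. E \<in> I \<Longrightarrow> E \<notin> amo_spectrum \<omega> \<theta>"
  shows "\<exists>U\<in>spectral_gaps \<omega> \<theta>. I \<subseteq> U"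
proof -
  obtain x where x: "x \<in> I" using assms(2) by blast
  have sub: "I \<subseteq> - amo_spectrum \<omega> \<theta>" using assms(3) by blast
  have "connected_component_set (- amo_spectrum \<omega> \<theta>) x \<in> spectral_gaps \<omega> \<theta>"
    unfolding spectral_gaps_def components_def using x sub by blast
  moreover have "I \<subseteq> connected_component_set (- amo_spectrum \<omega> \<theta>) x"
    by (rule connected_component_maximal[OF x assms(1) sub])
  ultimately show ?thesis by blast
qed

lemma frac_inj_irrational:
  fixes \<omega> :: real
  assumes "\<omega> \<notin> \<rat>" "frac (of_int j * \<omega>) = frac (of_int k * \<omega>)"
  shows "j = k"
proof (rule ccontr)
  assume ne: "j \<noteq> k"
  have "of_int (j - k) * \<omega> = of_int (\<lfloor>of_int j * \<omega>\<rfloor> - \<lfloor>of_int k * \<omega>\<rfloor>)"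
    using assms(2) unfolding frac_def by (simp add: algebra_simps)
  then have "\<omega> = of_int (\<lfloor>of_int j * \<omega>\<rfloor> - \<lfloor>of_int k * \<omega>\<rfloor>) / of_int (j - k)" using ne by (simp add: field_simps)
  then show False using assms(1) by (metis Rats_divide Rats_of_int)
qed

context counted_tower
begin

text \<open>By Sturm's count, the eigenvalues above E are counted by the sign changes of the Dirichlet solution, whose density is
kap - k \<omega>.\<close>

lemma gap_density:
  assumes E: "E \<in> {E1..E2}"
  shows "(\<lambda>L. cnt \<omega> \<theta> E L / real L) \<longlonglongrightarrow> 1 - kap + k * \<omega>"
proof -
  define V where "V = amo_potential \<omega> \<theta>"
  obtain K where K: "\<And>L. \<bar>real (changes (dirichlet V E) L) - (kap - k * \<omega>) * real L\<bar> \<le> K"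
    using dirichlet_count_bounded[OF E, of V \<theta>] by (auto simp: V_def amo_pot)
  have c: "\<bar>cnt \<omega> \<theta> E L - (real L - real (changes (dirichlet V E) L))\<bar> \<le> 1" for L
  proof -
    have Vb: "\<And>n. \<bar>V n\<bar> \<le> 2" unfolding V_def by (rule amo_pot_bound)
    show ?thesis using eigenvalue_count_changes[where V = V and L = L and a = E, OF Vb]
      unfolding eigenvalue_count_jmat[where V = V, OF Vb] cnt_def V_def[symmetric] .
  qed
  have near: "\<bar>(1 - kap + k * \<omega>) * real L - cnt \<omega> \<theta> E L\<bar> \<le> K + 1" for L
  proof -
    have "(1 - kap + k * \<omega>) * real L = real L - (kap - k * \<omega>) * real L" by (simp add: algebra_simps)
    then show ?thesis using K[of L] c[of L] by linarith
  qed
  have "(\<lambda>L. (1 - kap + k * \<omega>) * real L / real L) \<longlonglongrightarrow> 1 - kap + k * \<omega>"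
  proof (rule tendsto_eventually)
    show "eventually (\<lambda>L. (1 - kap + k * \<omega>) * real L / real L = 1 - kap + k * \<omega>) sequentially"
      using eventually_gt_at_top[of 0] by eventually_elim simp
  qed
  then show ?thesis using near by (rule density_transfer)
qed

text \<open>The density is neither 0 nor 1, so the component is separated from the far energies on both sides, and irrationality
makes the label unique.\<close>

lemma bounded_gap:
  assumes I: "I \<subseteq> {E1..E2}" "E1 \<le> E2" and fr: "frac (of_int k * \<omega>) = 1 - kap + k * \<omega>" and k: "k \<noteq> 0"
  shows "in_bounded_gap \<omega> \<theta> I k"
proof -
  have "E \<notin> amo_spectrum \<omega> \<theta>" if "E \<in> {E1..E2}" for E
    by (rule resolventI, rule tower_hyperbolic[where \<theta> = \<theta>]) (use that amo_pot in auto)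
  then have "\<exists>U\<in>spectral_gaps \<omega> \<theta>. {E1..E2} \<subseteq> U" by (intro gap_containing) (use I(2) in auto)
  then obtain U where U: "U \<in> spectral_gaps \<omega> \<theta>" "{E1..E2} \<subseteq> U" by blast
  have dens: "(\<lambda>L. cnt \<omega> \<theta> a L / real L) \<longlonglongrightarrow> frac (of_int k * \<omega>)" if "a \<in> U" for a
    using density_component[OF U(1) _ that gap_density[of E1]] U(2) I(2) fr by auto
  have ids: "amo_ids \<omega> \<theta> a = frac (of_int k * \<omega>)" if "a \<in> U" for a
    using ids_eqI dens that by blast
  have fr0: "frac (of_int k * \<omega>) \<noteq> 0"
    using frac_inj_irrational[OF irr, of k 0] k by auto
  have fr1: "frac (of_int k * \<omega>) < 1" by (rule frac_lt_1)
  have "U \<subseteq> {-5..5}"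
  proof
    fix a assume a: "a \<in> U"
    show "a \<in> {-5..5}"
    proof (rule ccontr)
      assume "a \<notin> {-5..5}"
      then consider "5 \<le> a" | "a \<le> -5" by force
      then show False
      proof cases
        case 1
        then show ?thesis using LIMSEQ_unique[OF dens[OF a] density_high] fr1 by simp
      next
        case 2
        then show ?thesis using LIMSEQ_unique[OF dens[OF a] density_low] fr0 by simp
      qed
    qed
  qed
  then have bdd: "bounded U" using bounded_closed_interval bounded_subset by blast
  have "has_gap_label \<omega> \<theta> U k"
    unfolding has_gap_label_def
  proof (simp only: bdd if_True, intro allI iffI)
    fix j assume j: "\<forall>a\<in>U. amo_ids \<omega> \<theta> a = frac (of_int j * \<omega>)"
    have "E1 \<in> U" using U(2) I(2) by auto
    then have "frac (of_int j * \<omega>) = frac (of_int k * \<omega>)" using j ids by metis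
    then show "j = k" by (rule frac_inj_irrational[OF irr])
  next
    fix j assume "j = k"
    then show "\<forall>a\<in>U. amo_ids \<omega> \<theta> a = frac (of_int j * \<omega>)" using ids by blast
  qed
  then show ?thesis unfolding in_bounded_gap_def using U I(1) bdd by blast
qed

end

lemma (in tower) upper_gap:
  assumes "E1 \<le> 5" "5 \<le> E2"
  shows "in_upper_gap \<omega> \<theta> {E1<..}"
proof -
  have "E \<notin> amo_spectrum \<omega> \<theta>" if "E \<in> {E1..}" for E
  proof (cases "E \<le> E2")
    case True
    show ?thesis by (rule resolventI, rule tower_hyperbolic[where \<theta> = \<theta>]) (use that True amo_pot in auto)
  next
    case False
    show ?thesis by (rule resolventI, rule far_hyperbolic) (use that False assms amo_pot_bound in auto)
  qed
  then have "\<exists>U\<in>spectral_gaps \<omega> \<theta>. {E1..} \<subseteq> U" by (intro gap_containing) auto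
  then obtain U where U: "U \<in> spectral_gaps \<omega> \<theta>" "{E1..} \<subseteq> U" by blast
  have "5 \<in> U" using U(2) assms by auto
  have low: "-5 \<le> a" if "a \<in> U" for a
  proof (rule ccontr)
    assume "\<not> -5 \<le> a"
    then show False
      using LIMSEQ_unique[OF density_component[OF U(1) \<open>5 \<in> U\<close> that density_high[OF order_refl]] density_low] by simp
  qed
  have "\<not> bdd_above U"
  proof
    assume "bdd_above U"
    then obtain M where "\<forall>x\<in>U. x \<le> M" unfolding bdd_above_def by blast
    moreover have "max E1 M + 1 \<in> U" using U(2) by auto
    ultimately show False by fastforce
  qed
  moreover have "bdd_below U" using low by (intro bdd_belowI[of _ "-5"]) 
  moreover have "has_gap_label \<omega> \<theta> U 0"
    using \<open>\<not> bdd_above U\<close> bounded_imp_bdd_above unfolding has_gap_label_def by auto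
  ultimately show ?thesis unfolding in_upper_gap_def using U by (intro bexI[of _ U]) auto
qed

lemma (in tower) lower_gap:
  assumes "E1 \<le> -5" "-5 \<le> E2"
  shows "in_lower_gap \<omega> \<theta> {..<E2}"
proof -
  have "E \<notin> amo_spectrum \<omega> \<theta>" if "E \<in> {..E2}" for E
  proof (cases "E1 \<le> E")
    case True
    show ?thesis by (rule resolventI, rule tower_hyperbolic[where \<theta> = \<theta>]) (use that True amo_pot in auto)
  next
    case False
    show ?thesis by (rule resolventI, rule far_hyperbolic) (use that False assms amo_pot_bound in auto)
  qed
  then have "\<exists>U\<in>spectral_gaps \<omega> \<theta>. {..E2} \<subseteq> U" by (intro gap_containing) auto
  then obtain U where U: "U \<in> spectral_gaps \<omega> \<theta>" "{..E2} \<subseteq> U" by blast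
  have "-5 \<in> U" using U(2) assms by auto
  have high: "a \<le> 5" if "a \<in> U" for a
  proof (rule ccontr)
    assume "\<not> a \<le> 5"
    then show False
      using LIMSEQ_unique[OF density_component[OF U(1) \<open>-5 \<in> U\<close> that density_low[OF order_refl]] density_high] by simp
  qed
  have "\<not> bdd_below U"
  proof
    assume "bdd_below U"
    then obtain M where "\<forall>x\<in>U. M \<le> x" unfolding bdd_below_def by blast
    moreover have "min E2 M - 1 \<in> U" using U(2) by auto
    ultimately show False by fastforce
  qed
  moreover have "bdd_above U" using high by (intro bdd_aboveI[of _ 5])
  moreover have "has_gap_label \<omega> \<theta> U 0"
    using \<open>\<not> bdd_below U\<close> bounded_imp_bdd_below unfolding has_gap_label_def by auto
  ultimately show ?thesis unfolding in_lower_gap_def using U by (intro bexI[of _ U]) auto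
qed

section \<open>Rounded integer arithmetic\<close>

text \<open>Division rounding towards zero. On binary numerals, halving is then the same syntactic operation for both signs, and
division by a power of two becomes iterated halving, which rewriting carries out fast.\<close>

definition tdiv :: "int \<Rightarrow> int \<Rightarrow> int" where
  "tdiv d x = (if x < 0 then - ((- x) div d) else x div d)"

definition half :: "int \<Rightarrow> int" where "half = tdiv 2"

text \<open>Rescaling after a product of two fixed point numbers with unit 2^28.\<close>

definition sc :: "int \<Rightarrow> int" where "sc = tdiv 268435456"

lemma half_tdiv:
  assumes "0 < d" shows "half (tdiv d x) = tdiv (2 * d) x"
proof (cases "x < 0")
  case True
  have "0 \<le> (- x) div d" using True assms by (simp add: pos_imp_zdiv_nonneg_iff)
  moreover have "((- x) div d) div 2 = (- x) div (d * 2)" using assms by (subst zdiv_zmult2_eq) auto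
  ultimately show ?thesis using True by (auto simp: half_def tdiv_def mult.commute)
next
  case False
  have "0 \<le> x div d" using False assms by (simp add: pos_imp_zdiv_nonneg_iff)
  moreover have "(x div d) div 2 = x div (d * 2)" using assms by (subst zdiv_zmult2_eq) auto
  ultimately show ?thesis using False by (auto simp: half_def tdiv_def mult.commute)
qed

lemma sc_half: "sc x = half (half (half (half (half (half (half (half (half (half (half (half (half (half (half (half (half (half (half (half (half (half (half (half (half (half (half (half (x))))))))))))))))))))))))))))"
proof -
  have "half (half (half (half (half (half (half (half (half (half (half (half (half (half (half (half (half (half (half (half (half (half (half (half (half (half (half (half ((tdiv 1 x))))))))))))))))))))))))))))) = sc x" unfolding sc_def by (simp add: half_tdiv)
  moreover have "tdiv 1 x = x" by (simp add: tdiv_def)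
  ultimately show ?thesis by (simp only:)
qed

lemma tdiv_error:
  assumes "0 < d" shows "\<bar>real_of_int x / real_of_int d - real_of_int (tdiv d x)\<bar> < 1"
proof -
  have *: "0 \<le> real_of_int y / real_of_int d - real_of_int (y div d)" "real_of_int y / real_of_int d - real_of_int (y div d) < 1" for y
    using floor_divide_of_int_eq[of y d, where 'a = real] by linarith+
  show ?thesis
  proof (cases "x < 0")
    case True
    then show ?thesis using *[of "- x"] by (simp add: tdiv_def)
  next
    case False
    then show ?thesis using *[of x] by (simp add: tdiv_def)
  qed
qed

lemma half_error: "\<bar>real_of_int x / 2 - real_of_int (half x)\<bar> \<le> 1 / 2"
proof -
  have *: "\<bar>real_of_int y / 2 - real_of_int (y div 2)\<bar> \<le> 1 / 2" for y
    by (cases "even y") (auto elim!: evenE oddE simp: add_divide_distrib)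
  show ?thesis using *[of x] *[of "- x"] unfolding half_def tdiv_def by (cases "x < 0") (auto simp: abs_if split: if_splits)
qed

lemma half_simps:
  "half 0 = 0" "half 1 = 0" "half (- 1) = 0" "half (numeral num.One) = 0" "half (- numeral num.One) = 0"
  "half (numeral (num.Bit0 n)) = numeral n" "half (numeral (num.Bit1 n)) = numeral n"
  "half (- numeral (num.Bit0 n)) = - numeral n" "half (- numeral (num.Bit1 n)) = - numeral n"
  by (simp_all add: half_def tdiv_def)

abbreviation TT :: real where "TT \<equiv> 268435456"

lemma sc_error: "\<bar>real_of_int x / TT - real_of_int (sc x)\<bar> < 1"
  using tdiv_error[of 268435456 x] by (simp add: sc_def)

text \<open>IV C1 C2 G1 G2 is the vector with coordinates C1 + G1 t and C2 + G2 t, depending on a parameter t between - 1 and 1.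
Carrying the linear dependence on the phase, and not only an interval, lets one cell cover a much longer range of
phases.\<close>

datatype iv = IV int int int int

fun sneg :: "bool \<Rightarrow> int \<Rightarrow> int" where
  "sneg True x = x" | "sneg False x = - x"

text \<open>Half of the quadratic coefficient of the image: centring the term r t^2 at r / 2 halves its contribution to the error.\<close>

fun bend :: "int \<Rightarrow> iv \<Rightarrow> int" where
  "bend w1 (IV C1 C2 G1 G2) = half (sc (w1 * G1))"

text \<open>A bound for everything that the linear image neglects: the quadratic term, the error er of the potential and the
rounding.\<close>

fun slack :: "int \<Rightarrow> int \<Rightarrow> iv \<Rightarrow> int" where
  "slack er c0 (IV C1 C2 G1 G2) = \<bar>c0\<bar> + sc (er * (\<bar>C1\<bar> + \<bar>G1\<bar>)) + 6"

text \<open>The image vector is turned outwards by the slack K, so that the new cone contains the true image. The displaced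
coordinate must be multiplied by a coordinate of constant sign, so either the first or the second coordinate is
displaced. The null vector signals failure; its area with any vector is zero, which every later comparison rejects.\<close>

definition nxt0 :: "bool \<Rightarrow> int \<Rightarrow> int \<Rightarrow> int \<Rightarrow> int \<Rightarrow> int \<Rightarrow> iv" where
  "nxt0 sg X Gx K C1 G1 =
     (if \<bar>G1\<bar> < \<bar>C1\<bar> then IV (X + sneg (sg = (0 < C1)) K) C1 Gx G1
      else if \<bar>G1\<bar> + \<bar>C1\<bar> + 3 * K + 1 \<le> \<bar>X\<bar> - \<bar>Gx\<bar> then IV X (C1 + sneg (sg = (X < 0)) K) Gx G1
      else IV 0 0 0 0)"

fun nxt :: "bool \<Rightarrow> int \<Rightarrow> int \<Rightarrow> int \<Rightarrow> int \<Rightarrow> iv \<Rightarrow> iv" where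
  "nxt sg w0 w1 c0 K (IV C1 C2 G1 G2) = nxt0 sg (sc (w0 * C1) - C2 + c0) (sc (w0 * G1 + w1 * C1) - G2) K C1 G1"

fun nrm :: "iv \<Rightarrow> int" where
  "nrm (IV C1 C2 G1 G2) = \<bar>C1\<bar> + \<bar>C2\<bar> + \<bar>G1\<bar> + \<bar>G2\<bar>"

text \<open>A lower bound for the area form over all parameters between - 1 and 1.\<close>

fun wedge :: "iv \<Rightarrow> iv \<Rightarrow> int" where
  "wedge (IV C1 C2 G1 G2) (IV D1 D2 H1 H2) = C1 * D2 - C2 * D1
     - \<bar>C1 * H2 - C2 * H1 + G1 * D2 - G2 * D1\<bar> - \<bar>G1 * H2 - G2 * H1\<bar>"

fun val :: "iv \<Rightarrow> real \<Rightarrow> real \<times> real" where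
  "val (IV C1 C2 G1 G2) \<tau> = (of_int C1 + of_int G1 * \<tau>, of_int C2 + of_int G2 * \<tau>)"

lemma abs_mult_tau: "\<bar>\<tau>\<bar> \<le> 1 \<Longrightarrow> \<bar>a * \<tau>\<bar> \<le> \<bar>a\<bar>" for a \<tau> :: real
  by (simp add: abs_mult mult_left_le)

lemma wedge_le:
  assumes "\<bar>\<tau>\<bar> \<le> 1"
  shows "of_int (wedge P Q) \<le> area (val P \<tau>) (val Q \<tau>)"
proof -
  obtain C1 C2 G1 G2 where P: "P = IV C1 C2 G1 G2" by (cases P)
  obtain D1 D2 H1 H2 where Q: "Q = IV D1 D2 H1 H2" by (cases Q)
  define u where "u = real_of_int (C1 * H2 - C2 * H1 + G1 * D2 - G2 * D1)"
  define v where "v = real_of_int (G1 * H2 - G2 * H1)"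
  have "area (val P \<tau>) (val Q \<tau>) = real_of_int (C1 * D2 - C2 * D1) + u * \<tau> + (v * \<tau>) * \<tau>"
    by (simp add: P Q area_def u_def v_def algebra_simps)
  moreover have "\<bar>u * \<tau>\<bar> \<le> \<bar>u\<bar>" "\<bar>(v * \<tau>) * \<tau>\<bar> \<le> \<bar>v\<bar>"
    using abs_mult_tau[OF assms] order_trans by blast+
  moreover have "of_int (wedge P Q) = real_of_int (C1 * D2 - C2 * D1) - \<bar>u\<bar> - \<bar>v\<bar>"
    by (simp add: P Q u_def v_def)
  ultimately show ?thesis by linarith
qed

lemma val_nrm:
  assumes "\<bar>\<tau>\<bar> \<le> 1"
  shows "\<bar>fst (val P \<tau>)\<bar> + \<bar>snd (val P \<tau>)\<bar> \<le> of_int (nrm P)"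
proof (cases P)
  case (IV C1 C2 G1 G2)
  then show ?thesis
    using abs_mult_tau[OF assms, of "of_int G1"] abs_mult_tau[OF assms, of "of_int G2"] by (simp, linarith)
qed

text \<open>The parameter \<delta> moves the energy away from the end of its range at which the new vector is computed. A larger
energy turns every image clockwise, and s distinguishes the two boundary vectors. In the first case the area is the
unchanged coordinate times the difference of the displacement K and the neglected error, which has the sign of the
displacement. In the second case the term with \<delta> may be negative, but not below - 2 K^2, and the comparison of
the two coordinates in nxt0 leaves room for it.\<close>

lemma nxt_sound:
  fixes w e \<tau> \<delta> :: real
  assumes \<tau>: "\<bar>\<tau>\<bar> \<le> 1" and w: "TT * w = of_int w0 + of_int w1 * \<tau> + e" "\<bar>e\<bar> \<le> of_int er"
    and er: "0 \<le> er" and c0: "c0 = bend w1 P" and K: "K = slack er c0 P" and P': "P' = nxt sg w0 w1 c0 K P" "P' \<noteq> IV 0 0 0 0"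
    and \<delta>: "0 \<le> \<delta>" "\<delta> \<le> 8" and s: "s = (if sg then 1 else - 1)"
  shows "\<bar>fst (transfer_by w (val P \<tau>)) - fst (val P' \<tau>)\<bar> \<le> 2 * of_int K"
    "\<bar>snd (transfer_by w (val P \<tau>)) - snd (val P' \<tau>)\<bar> \<le> of_int K"
    "1 \<le> s * area (val P' \<tau>) (transfer_by (w - s * \<delta>) (val P \<tau>))" "0 \<le> K"
proof -
  obtain C1 C2 G1 G2 where P: "P = IV C1 C2 G1 G2" by (cases P)
  define X where "X = sc (w0 * C1) - C2 + c0"
  define Gx where "Gx = sc (w0 * G1 + w1 * C1) - G2"
  define p1 where "p1 = real_of_int C1 + of_int G1 * \<tau>"
  define x where "x = real_of_int X + of_int Gx * \<tau>"
  define a where "a = fst (transfer_by w (val P \<tau>))"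
  define \<rho> where "\<rho> = a - x"
  have snd_a: "snd (transfer_by w (val P \<tau>)) = p1" by (simp add: P transfer_by_def p1_def)
  have Keq: "K = \<bar>c0\<bar> + sc (er * (\<bar>C1\<bar> + \<bar>G1\<bar>)) + 6" using K P by simp
  have "0 \<le> er * (\<bar>C1\<bar> + \<bar>G1\<bar>)" using er by simp
  then have ser: "0 \<le> sc (er * (\<bar>C1\<bar> + \<bar>G1\<bar>))" unfolding sc_def tdiv_def by (simp add: pos_imp_zdiv_nonneg_iff)
  have K6: "6 \<le> K" using ser by (simp add: Keq)
  define r where "r = real_of_int (w1 * G1) / TT"
  have rho: "\<bar>\<rho>\<bar> \<le> of_int K - 1"
  proof -
    have a_eq: "a = of_int (w0 * C1) / TT - of_int C2 + (of_int (w0 * G1 + w1 * C1) / TT - of_int G2) * \<tau> + r * \<tau>\<^sup>2 + e * p1 / TT"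
    proof -
      have "TT * a = (TT * w) * p1 - TT * (of_int C2 + of_int G2 * \<tau>)" by (simp add: a_def P transfer_by_def p1_def algebra_simps)
      also have "\<dots> = of_int (w0 * C1) + of_int (w0 * G1 + w1 * C1) * \<tau> + of_int (w1 * G1) * \<tau>\<^sup>2 + e * p1 - TT * (of_int C2 + of_int G2 * \<tau>)"
        unfolding w by (simp add: p1_def power2_eq_square algebra_simps)
      finally show ?thesis unfolding r_def by (simp add: field_simps)
    qed
    have "\<rho> = (of_int (w0 * C1) / TT - of_int (sc (w0 * C1))) + (of_int (w0 * G1 + w1 * C1) / TT - of_int (sc (w0 * G1 + w1 * C1))) * \<tau>
        + (r * \<tau>\<^sup>2 - of_int c0) + e * p1 / TT"
      unfolding \<rho>_def x_def X_def Gx_def a_eq by (simp add: algebra_simps)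
    moreover have "\<bar>of_int (w0 * C1) / TT - of_int (sc (w0 * C1))\<bar> \<le> 1" using sc_error by (rule less_imp_le)
    moreover have "\<bar>(of_int (w0 * G1 + w1 * C1) / TT - of_int (sc (w0 * G1 + w1 * C1))) * \<tau>\<bar> \<le> 1"
      using abs_mult_tau[OF \<tau>] sc_error[of "w0 * G1 + w1 * C1"] by (meson less_imp_le order_trans)
    moreover have "\<bar>r * \<tau>\<^sup>2 - of_int c0\<bar> \<le> \<bar>of_int c0\<bar> + 2"
    proof -
      have "\<bar>r - of_int (sc (w1 * G1))\<bar> < 1" unfolding r_def by (rule sc_error)
      moreover have "\<bar>of_int (sc (w1 * G1)) / 2 - of_int c0\<bar> \<le> (1/2 :: real)" using half_error[of "sc (w1 * G1)"] c0 P by simp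
      ultimately have rc: "\<bar>r / 2 - of_int c0\<bar> \<le> 1" by linarith
      have t2: "0 \<le> \<tau>\<^sup>2" "\<tau>\<^sup>2 \<le> 1" using \<tau> by (auto simp: abs_square_le_1)
      have "\<bar>r * \<tau>\<^sup>2 - r / 2\<bar> = \<bar>r\<bar> * \<bar>\<tau>\<^sup>2 - 1/2\<bar>" by (simp add: abs_mult[symmetric] algebra_simps)
      moreover have "\<bar>\<tau>\<^sup>2 - 1/2\<bar> \<le> 1/2" using t2 by linarith
      then have "\<bar>r\<bar> * \<bar>\<tau>\<^sup>2 - 1/2\<bar> \<le> \<bar>r\<bar> * (1/2)" by (rule mult_left_mono) simp
      ultimately show ?thesis using rc by linarith
    qed
    moreover have "\<bar>e * p1 / TT\<bar> \<le> of_int (sc (er * (\<bar>C1\<bar> + \<bar>G1\<bar>))) + 1"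
    proof -
      have "\<bar>p1\<bar> \<le> of_int (\<bar>C1\<bar> + \<bar>G1\<bar>)" unfolding p1_def using abs_mult_tau[OF \<tau>, of "of_int G1"] by simp
      then have "\<bar>e * p1\<bar> \<le> of_int er * of_int (\<bar>C1\<bar> + \<bar>G1\<bar>)" unfolding abs_mult using w(2) by (intro mult_mono) auto
      then have "\<bar>e * p1 / TT\<bar> \<le> of_int (er * (\<bar>C1\<bar> + \<bar>G1\<bar>)) / TT" by (simp add: divide_right_mono)
      then show ?thesis using sc_error[of "er * (\<bar>C1\<bar> + \<bar>G1\<bar>)"] by linarith
    qed
    ultimately show ?thesis unfolding Keq of_int_add of_int_abs of_int_numeral by linarith
  qed
  have aP: "transfer_by v (val P \<tau>) = (a + (v - w) * p1, p1)" for v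
    by (simp add: P transfer_by_def p1_def a_def algebra_simps)
  define k where "k = real_of_int K"
  have k6: "6 \<le> k" unfolding k_def using K6 by simp
  have rho': "\<bar>\<rho>\<bar> \<le> k - 1" unfolding k_def by (rule rho)
  have P'0: "P' = nxt0 sg X Gx K C1 G1" using P' P by (simp add: X_def Gx_def)
  show "0 \<le> K" using K6 by simp
  show "\<bar>fst (transfer_by w (val P \<tau>)) - fst (val P' \<tau>)\<bar> \<le> 2 * of_int K" "\<bar>snd (transfer_by w (val P \<tau>)) - snd (val P' \<tau>)\<bar> \<le> of_int K"
    "1 \<le> s * area (val P' \<tau>) (transfer_by (w - s * \<delta>) (val P \<tau>))"
  proof (atomize (full), cases "\<bar>G1\<bar> < \<bar>C1\<bar>")
    case True
    define \<kappa> where "\<kappa> = (if sg = (0 < C1) then k else - k)"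
    have v: "val P' \<tau> = (x + \<kappa>, p1)"
      using True unfolding P'0 nxt0_def by (cases "sg = (0 < C1)") (simp_all add: x_def p1_def \<kappa>_def k_def)
    have p1: "(0 < C1 \<longrightarrow> 1 \<le> p1) \<and> (\<not> 0 < C1 \<longrightarrow> p1 \<le> -1)"
      using True abs_mult_tau[OF \<tau>, of "of_int G1"] unfolding p1_def by linarith
    have "area (val P' \<tau>) (transfer_by (w - s * \<delta>) (val P \<tau>)) = p1 * (\<kappa> - \<rho>) + s * \<delta> * p1\<^sup>2"
      unfolding v aP by (simp add: area_def \<rho>_def power2_eq_square algebra_simps)
    then have "s * area (val P' \<tau>) (transfer_by (w - s * \<delta>) (val P \<tau>)) = (s * p1) * (\<kappa> - \<rho>) + \<delta> * p1\<^sup>2"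
      using s by (auto simp: algebra_simps)
    moreover have "1 * 1 \<le> (s * p1) * (\<kappa> - \<rho>)"
    proof (cases "sg = (0 < C1)")
      case eq: True
      then have "1 \<le> s * p1 \<or> s * p1 \<le> -1 \<and> False \<or> 1 \<le> s * p1" using p1 s by auto
      then have "1 \<le> s * p1" by blast
      moreover have "1 \<le> \<kappa> - \<rho>" using eq rho' k6 unfolding \<kappa>_def by auto
      ultimately show ?thesis by (intro mult_mono) auto
    next
      case ne: False
      then have "1 \<le> - (s * p1)" using p1 s by auto
      moreover have "1 \<le> - (\<kappa> - \<rho>)" using ne rho' k6 unfolding \<kappa>_def by auto
      ultimately have "1 * 1 \<le> (- (s * p1)) * (- (\<kappa> - \<rho>))" by (intro mult_mono) auto
      then show ?thesis by (simp only: minus_mult_minus)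
    qed
    moreover have "0 \<le> \<delta> * p1\<^sup>2" using \<delta> by simp
    moreover have "\<bar>a - (x + \<kappa>)\<bar> \<le> 2 * k" using rho' unfolding \<kappa>_def \<rho>_def by (auto split: if_splits)
    ultimately show "\<bar>fst (transfer_by w (val P \<tau>)) - fst (val P' \<tau>)\<bar> \<le> 2 * of_int K \<and> \<bar>snd (transfer_by w (val P \<tau>)) - snd (val P' \<tau>)\<bar> \<le> of_int K \<and>
        1 \<le> s * area (val P' \<tau>) (transfer_by (w - s * \<delta>) (val P \<tau>))"
      using k6 unfolding v snd_a a_def[symmetric] k_def by auto
  next
    case False
    then have big: "\<bar>G1\<bar> + \<bar>C1\<bar> + 3 * K + 1 \<le> \<bar>X\<bar> - \<bar>Gx\<bar>" using P'(2) unfolding P'0 nxt0_def by (auto split: if_splits)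
    define \<kappa> where "\<kappa> = (if sg = (X < 0) then k else - k)"
    have v: "val P' \<tau> = (x, p1 + \<kappa>)"
      using False big unfolding P'0 nxt0_def by (cases "sg = (X < 0)") (simp_all add: x_def p1_def \<kappa>_def k_def)
    have x: "(X < 0 \<longrightarrow> x \<le> - (\<bar>p1\<bar> + 3 * k + 1)) \<and> (\<not> X < 0 \<longrightarrow> \<bar>p1\<bar> + 3 * k + 1 \<le> x)"
      using big abs_mult_tau[OF \<tau>, of "of_int Gx"] abs_mult_tau[OF \<tau>, of "of_int G1"] unfolding x_def p1_def k_def by linarith
    have wdv: "area (val P' \<tau>) (transfer_by (w - s * \<delta>) (val P \<tau>)) = - (\<kappa> * x) - (p1 + \<kappa>) * \<rho> + s * \<delta> * (p1 * (p1 + \<kappa>))"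
      unfolding v aP by (simp add: area_def \<rho>_def algebra_simps)
    have sx: "s * (\<kappa> * x) \<le> - (k * (\<bar>p1\<bar> + 3 * k + 1))"
    proof -
      have "k * (\<bar>p1\<bar> + 3 * k + 1) \<le> k * \<bar>x\<bar>" using x k6 by (intro mult_left_mono) (cases "X < 0"; simp)+
      moreover have "s * (\<kappa> * x) = - (k * \<bar>x\<bar>)"
        using x k6 s unfolding \<kappa>_def by (cases "X < 0"; cases sg) auto
      ultimately show ?thesis by linarith
    qed
    have "\<bar>(p1 + \<kappa>) * \<rho>\<bar> \<le> (\<bar>p1\<bar> + k) * (k - 1)"
      unfolding abs_mult using rho' k6 unfolding \<kappa>_def by (intro mult_mono) auto
    then have t2: "- ((\<bar>p1\<bar> + k) * (k - 1)) \<le> - (s * ((p1 + \<kappa>) * \<rho>))" using s by auto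
    have "0 \<le> (2 * p1 + \<kappa>)\<^sup>2" by simp
    then have "- (k\<^sup>2) / 4 \<le> p1 * (p1 + \<kappa>)" unfolding \<kappa>_def by (auto simp: power2_eq_square algebra_simps split: if_splits)
    then have "\<delta> * (- (k\<^sup>2) / 4) \<le> \<delta> * (p1 * (p1 + \<kappa>))" using \<delta> by (intro mult_left_mono) auto
    moreover have "8 * (- (k\<^sup>2) / 4) \<le> \<delta> * (- (k\<^sup>2) / 4)" using \<delta> by (intro mult_right_mono_neg) auto
    ultimately have t3: "- (2 * k\<^sup>2) \<le> \<delta> * (p1 * (p1 + \<kappa>))" by linarith
    have "s * area (val P' \<tau>) (transfer_by (w - s * \<delta>) (val P \<tau>)) = - (s * (\<kappa> * x)) - s * ((p1 + \<kappa>) * \<rho>) + \<delta> * (p1 * (p1 + \<kappa>))"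
      unfolding wdv using s by (auto simp: algebra_simps)
    then have "k * (\<bar>p1\<bar> + 3 * k + 1) - (\<bar>p1\<bar> + k) * (k - 1) - 2 * k\<^sup>2 \<le> s * area (val P' \<tau>) (transfer_by (w - s * \<delta>) (val P \<tau>))"
      using sx t2 t3 by linarith
    moreover have "k * (\<bar>p1\<bar> + 3 * k + 1) - (\<bar>p1\<bar> + k) * (k - 1) - 2 * k\<^sup>2 = \<bar>p1\<bar> + 2 * k"
      by (simp add: power2_eq_square algebra_simps)
    ultimately have "1 \<le> s * area (val P' \<tau>) (transfer_by (w - s * \<delta>) (val P \<tau>))" using k6 by linarith
    moreover have "\<bar>a - x\<bar> \<le> 2 * k" "\<bar>p1 - (p1 + \<kappa>)\<bar> \<le> k" using rho' k6 unfolding \<kappa>_def \<rho>_def by (auto split: if_splits)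
    ultimately show "\<bar>fst (transfer_by w (val P \<tau>)) - fst (val P' \<tau>)\<bar> \<le> 2 * of_int K \<and> \<bar>snd (transfer_by w (val P \<tau>)) - snd (val P' \<tau>)\<bar> \<le> of_int K \<and>
        1 \<le> s * area (val P' \<tau>) (transfer_by (w - s * \<delta>) (val P \<tau>))"
      unfolding v snd_a a_def[symmetric] k_def by simp
  qed
qed

section \<open>One certified step of a cone\<close>

text \<open>PAR zc zs E1 E2 Dl eta er: the rotation by the frequency and the energy range in fixed point, a bound Dl for the
length of the energy range, the half width eta of the phase cell in radians and the error er of the linearised
potential.\<close>

datatype par = PAR int int int int int int int

text \<open>The step is written in stages, with the remaining computation k as an argument: each stage passes values that occur
more than once, so that they are reduced to numerals before being copied. Since the energy range is an interval and
the area is linear in the energy, inclusion for all energies follows from the two ends, where b and b' bound the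
errors.\<close>

definition st5 :: "int \<Rightarrow> int \<Rightarrow> int \<Rightarrow> int \<Rightarrow> (int \<Rightarrow> int \<Rightarrow> iv \<Rightarrow> iv \<Rightarrow> int \<Rightarrow> bool) \<Rightarrow> iv \<Rightarrow> iv \<Rightarrow> int \<Rightarrow> int \<Rightarrow> int \<Rightarrow> int \<Rightarrow> int \<Rightarrow> bool" where
  "st5 zc zs c s k P' Q' W W' b b' m =
     (if b < W \<and> b < W' \<and> b' < W \<and> b' < W' \<and> m \<le> 1000000000000000000000000000000000000
      then k (sc (c * zc - s * zs)) (sc (s * zc + c * zs)) P' Q' W' else False)"

definition st4 :: "int \<Rightarrow> int \<Rightarrow> int \<Rightarrow> int \<Rightarrow> int \<Rightarrow> iv \<Rightarrow> iv \<Rightarrow> int \<Rightarrow> (int \<Rightarrow> int \<Rightarrow> iv \<Rightarrow> iv \<Rightarrow> int \<Rightarrow> bool) \<Rightarrow> int \<Rightarrow> int \<Rightarrow> iv \<Rightarrow> iv \<Rightarrow> bool" where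
  "st4 zc zs Dl c s P Q W k KP KQ P' Q' =
     st5 zc zs c s k P' Q' W (wedge P' Q') (2 * KP * (nrm Q' + 3 * KQ + Dl * nrm Q)) (2 * KQ * (nrm P' + 3 * KP + Dl * nrm P)) (nrm P' + nrm Q')"

definition st3 :: "int \<Rightarrow> int \<Rightarrow> int \<Rightarrow> int \<Rightarrow> int \<Rightarrow> iv \<Rightarrow> iv \<Rightarrow> int \<Rightarrow> (int \<Rightarrow> int \<Rightarrow> iv \<Rightarrow> iv \<Rightarrow> int \<Rightarrow> bool) \<Rightarrow> int \<Rightarrow> int \<Rightarrow> int \<Rightarrow> int \<Rightarrow> int \<Rightarrow> int \<Rightarrow> int \<Rightarrow> bool" where
  "st3 zc zs Dl c s P Q W k u2 u1 w1 cP cQ KP KQ = st4 zc zs Dl c s P Q W k KP KQ (nxt True u2 w1 cP KP P) (nxt False u1 w1 cQ KQ Q)"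

definition st2 :: "int \<Rightarrow> int \<Rightarrow> int \<Rightarrow> int \<Rightarrow> int \<Rightarrow> int \<Rightarrow> iv \<Rightarrow> iv \<Rightarrow> int \<Rightarrow> (int \<Rightarrow> int \<Rightarrow> iv \<Rightarrow> iv \<Rightarrow> int \<Rightarrow> bool) \<Rightarrow> int \<Rightarrow> int \<Rightarrow> int \<Rightarrow> int \<Rightarrow> int \<Rightarrow> bool" where
  "st2 zc zs Dl er c s P Q W k u2 u1 w1 cP cQ = st3 zc zs Dl c s P Q W k u2 u1 w1 cP cQ (slack er cP P) (slack er cQ Q)"

definition st1 :: "int \<Rightarrow> int \<Rightarrow> int \<Rightarrow> int \<Rightarrow> int \<Rightarrow> int \<Rightarrow> iv \<Rightarrow> iv \<Rightarrow> int \<Rightarrow> (int \<Rightarrow> int \<Rightarrow> iv \<Rightarrow> iv \<Rightarrow> int \<Rightarrow> bool) \<Rightarrow> int \<Rightarrow> int \<Rightarrow> int \<Rightarrow> bool" where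
  "st1 zc zs Dl er c s P Q W k u2 u1 w1 = st2 zc zs Dl er c s P Q W k u2 u1 w1 (bend w1 P) (bend w1 Q)"

fun step :: "par \<Rightarrow> int \<Rightarrow> int \<Rightarrow> iv \<Rightarrow> iv \<Rightarrow> int \<Rightarrow> (int \<Rightarrow> int \<Rightarrow> iv \<Rightarrow> iv \<Rightarrow> int \<Rightarrow> bool) \<Rightarrow> bool" where
  "step (PAR zc zs E1 E2 Dl eta er) c s P Q W k = st1 zc zs Dl er c s P Q W k (E2 - 2 * c) (E1 - 2 * c) (sc (2 * s * eta))"

definition near :: "real \<Rightarrow> real \<Rightarrow> int \<Rightarrow> int \<Rightarrow> bool" where
  "near \<epsilon> \<phi> c s \<longleftrightarrow> cmod (Complex (of_int c) (of_int s) - of_real TT * cis \<phi>) \<le> \<epsilon>"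

text \<open>The rotation error grows additively: the factor of modulus near 2^28 contributes about 1, and rounding both
coordinates at most the square root of 2.\<close>

lemma near_rotate:
  assumes "near \<epsilon> \<phi> c s" "near 1 \<alpha> zc zs" "0 \<le> \<epsilon>" "\<epsilon> \<le> 200"
  shows "near (\<epsilon> + 5 / 2) (\<phi> + \<alpha>) (sc (c * zc - s * zs)) (sc (s * zc + c * zs))"
proof -
  define z where "z = Complex (of_int c) (of_int s)"
  define u where "u = Complex (of_int zc) (of_int zs)"
  define z' where "z' = Complex (of_int (sc (c * zc - s * zs))) (of_int (sc (s * zc + c * zs)))"
  have h: "cmod (z - of_real TT * cis \<phi>) \<le> \<epsilon>" "cmod (u - of_real TT * cis \<alpha>) \<le> 1"
    using assms by (simp_all add: near_def z_def u_def)
  have tr: "cmod (z' - z * u / of_real TT) \<le> 1415 / 1000"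
  proof -
    have "\<bar>Re (z' - z * u / of_real TT)\<bar> \<le> 1" "\<bar>Im (z' - z * u / of_real TT)\<bar> \<le> 1"
      using sc_error[of "c * zc - s * zs"] sc_error[of "s * zc + c * zs"]
      by (simp_all add: z'_def z_def u_def complex_eq_iff add.commute mult.commute)
    then have "(Re (z' - z * u / of_real TT))\<^sup>2 \<le> 1" "(Im (z' - z * u / of_real TT))\<^sup>2 \<le> 1"
      by (simp_all add: abs_square_le_1)
    then have "(cmod (z' - z * u / of_real TT))\<^sup>2 \<le> 2" by (simp add: cmod_power2)
    also have "\<dots> \<le> (1415 / 1000)\<^sup>2" by (simp add: power2_eq_square)
    finally show ?thesis by (rule power2_le_imp_le) simp
  qed
  have zb: "cmod z \<le> TT + \<epsilon>" using norm_triangle_ineq2[of z "of_real TT * cis \<phi>"] h(1) by (simp add: norm_mult)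
  have eq: "z * u / of_real TT - of_real TT * cis (\<phi> + \<alpha>) = z * (u - of_real TT * cis \<alpha>) / of_real TT + (z - of_real TT * cis \<phi>) * cis \<alpha>"
    by (simp add: field_simps flip: cis_mult)
  have "cmod (z * u / of_real TT - of_real TT * cis (\<phi> + \<alpha>)) \<le> cmod (z * (u - of_real TT * cis \<alpha>) / of_real TT) + cmod ((z - of_real TT * cis \<phi>) * cis \<alpha>)"
    unfolding eq by (rule norm_triangle_ineq)
  also have "\<dots> = cmod z * cmod (u - of_real TT * cis \<alpha>) / TT + cmod (z - of_real TT * cis \<phi>)"
    by (simp add: norm_mult norm_divide)
  also have "\<dots> \<le> (TT + \<epsilon>) * 1 / TT + \<epsilon>"
    using zb h assms by (intro add_mono divide_right_mono mult_mono) auto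
  also have "\<dots> \<le> 1001 / 1000 + \<epsilon>" using assms by simp
  finally have "cmod (z * u / of_real TT - of_real TT * cis (\<phi> + \<alpha>)) \<le> 1001 / 1000 + \<epsilon>" .
  then have "cmod (z' - of_real TT * cis (\<phi> + \<alpha>)) \<le> \<epsilon> + 5 / 2"
    using norm_triangle_ineq[of "z' - z * u / of_real TT" "z * u / of_real TT - of_real TT * cis (\<phi> + \<alpha>)"] tr by simp
  then show ?thesis by (simp add: near_def z'_def)
qed

lemma cos_second_order: "\<bar>cos (x + y) - (cos x - y * sin x)\<bar> \<le> y\<^sup>2 / 2" for x y :: real
proof -
  define D where "D m t = cos (x + t + real m * pi / 2)" for m :: nat and t :: real
  have "D 0 = (\<lambda>t. cos (x + t))" by (rule ext) (simp add: D_def)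
  moreover have "\<forall>m t. DERIV (D m) t :> D (Suc m) t"
  proof (intro allI)
    fix m t
    have "x + t + real (Suc m) * pi / 2 = (x + t + real m * pi / 2) + pi / 2" by (simp add: field_simps)
    then have "D (Suc m) t = - sin (x + t + real m * pi / 2)" unfolding D_def by (simp only: cos_add) simp
    moreover have "DERIV (D m) t :> - sin (x + t + real m * pi / 2)"
      unfolding D_def by (auto intro!: derivative_eq_intros)
    ultimately show "DERIV (D m) t :> D (Suc m) t" by simp
  qed
  ultimately obtain t where "cos (x + y) = (\<Sum>m<2. D m 0 / fact m * y ^ m) + D 2 t / fact 2 * y ^ 2"
    using Maclaurin_all_le[of D "\<lambda>t. cos (x + t)" y 2] by auto
  moreover have "D 0 0 = cos x" "D (Suc 0) 0 = - sin x" by (simp_all add: D_def cos_add)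
  ultimately have "cos (x + y) - (cos x - y * sin x) = D 2 t * y\<^sup>2 / 2"
    by (simp add: numeral_2_eq_2)
  moreover have "\<bar>D 2 t * y\<^sup>2 / 2\<bar> \<le> y\<^sup>2 / 2"
    unfolding D_def by (simp add: abs_mult mult_left_le_one_le)
  ultimately show ?thesis by (simp only:)
qed

text \<open>The allowance 480 covers twice the error of c, which is at most 190, the rounding of w1 and the effect of the error of
s on the linear term, and the excess of the second order term over the rounded square of eta.\<close>

lemma near_potential:
  fixes h \<tau> :: real
  assumes n: "near \<epsilon> \<phi> c s" "0 \<le> \<epsilon>" "\<epsilon> \<le> 190" and \<tau>: "\<bar>\<tau>\<bar> \<le> 1" and h: "0 \<le> h" "h \<le> 1 / 8" "\<bar>of_int eta - TT * h\<bar> \<le> 2"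
    and er: "er = sc (eta * eta) + 480" and w1: "w1 = sc (2 * s * eta)"
  shows "\<bar>TT * (E - 2 * cos (\<phi> + h * \<tau>)) - (TT * E - 2 * of_int c + of_int w1 * \<tau>)\<bar> \<le> of_int er"
proof -
  have cs: "\<bar>of_int c - TT * cos \<phi>\<bar> \<le> \<epsilon>" "\<bar>of_int s - TT * sin \<phi>\<bar> \<le> \<epsilon>"
    using abs_Re_le_cmod[of "Complex (of_int c) (of_int s) - of_real TT * cis \<phi>"]
      abs_Im_le_cmod[of "Complex (of_int c) (of_int s) - of_real TT * cis \<phi>"] n(1) by (simp_all add: near_def)
  define r where "r = cos (\<phi> + h * \<tau>) - (cos \<phi> - (h * \<tau>) * sin \<phi>)"
  have "\<bar>r\<bar> \<le> (h * \<tau>)\<^sup>2 / 2" unfolding r_def by (rule cos_second_order)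
  also have "\<dots> \<le> h\<^sup>2 / 2" using \<tau> by (simp add: power_mult_distrib mult_left_le abs_square_le_1)
  finally have r: "\<bar>2 * TT * r\<bar> \<le> TT * h\<^sup>2" by (simp add: abs_mult)
  have th: "TT * h\<^sup>2 \<le> of_int (sc (eta * eta)) + 4"
  proof -
    have eta: "\<bar>of_int eta + TT * h\<bar> \<le> TT / 4 + 2" using h by linarith
    have "\<bar>(of_int eta)\<^sup>2 - (TT * h)\<^sup>2\<bar> = \<bar>of_int eta - TT * h\<bar> * \<bar>of_int eta + TT * h\<bar>"
      by (simp add: abs_mult[symmetric] power2_eq_square algebra_simps)
    also have "\<dots> \<le> 2 * (TT / 4 + 2)" using h eta by (intro mult_mono) auto
    finally have "(TT * h)\<^sup>2 \<le> (of_int eta)\<^sup>2 + 2 * (TT / 4 + 2)" by linarith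
    then have "TT * h\<^sup>2 \<le> (of_int eta)\<^sup>2 / TT + 1" by (simp add: power2_eq_square field_simps)
    then show ?thesis using sc_error[of "eta * eta"] by (simp add: power2_eq_square)
  qed
  define v where "v = 2 * TT * h * sin \<phi> - of_int w1"
  have v: "\<bar>v\<bar> \<le> 60"
  proof -
    have "\<bar>of_int (2 * s * eta) / TT - of_int w1\<bar> < 1" unfolding w1 by (rule sc_error)
    moreover have "\<bar>2 * TT * h * sin \<phi> - 2 * h * of_int s\<bar> \<le> 50"
    proof -
      have "\<bar>2 * TT * h * sin \<phi> - 2 * h * of_int s\<bar> = (2 * h) * \<bar>of_int s - TT * sin \<phi>\<bar>"
      proof -
        have "2 * TT * h * sin \<phi> - 2 * h * of_int s = - ((2 * h) * (of_int s - TT * sin \<phi>))" by (simp add: algebra_simps)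
        then show ?thesis using h by (simp only: abs_minus_cancel abs_mult)
      qed
      also have "\<dots> \<le> (2 * (1/8)) * 190" using h cs n by (intro mult_mono) auto
      finally show ?thesis by simp
    qed
    moreover have "\<bar>2 * h * of_int s - of_int (2 * s * eta) / TT\<bar> \<le> 5"
    proof -
      have sb: "\<bar>real_of_int s\<bar> \<le> TT + 190"
        using cs n abs_sin_le_one[of \<phi>] by (smt (verit, best) abs_mult mult_left_le)
      have "2 * h * of_int s - of_int (2 * s * eta) / TT = (2 * of_int s / TT) * (TT * h - of_int eta)"
        by (simp add: field_simps)
      then have "\<bar>2 * h * of_int s - of_int (2 * s * eta) / TT\<bar> = \<bar>(2 * of_int s / TT) * (TT * h - of_int eta)\<bar>"
        by (simp only:)
      also have "\<dots> = (2 * \<bar>of_int s\<bar> / TT) * \<bar>TT * h - of_int eta\<bar>"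
        by (simp only: abs_mult abs_divide abs_numeral)
      also have "\<dots> \<le> (2 * (TT + 190) / TT) * 2" using sb h by (intro mult_mono divide_right_mono) (auto simp: abs_minus_commute)
      finally show ?thesis by simp
    qed
    ultimately show ?thesis unfolding v_def by linarith
  qed
  have vt: "\<bar>v * \<tau>\<bar> \<le> 60" using abs_mult_tau[OF \<tau>, of v] v by linarith
  have arith: "\<bar>2 * a + b - d\<bar> \<le> x + 480" if "\<bar>a\<bar> \<le> \<epsilon>" "\<bar>b\<bar> \<le> 60" "\<bar>d\<bar> \<le> y" "y \<le> x + 4" for a b d x y :: real
    using that n(3) by linarith
  have eq: "TT * (E - 2 * cos (\<phi> + h * \<tau>)) - (TT * E - 2 * of_int c + of_int w1 * \<tau>)
      = 2 * (of_int c - TT * cos \<phi>) + v * \<tau> - 2 * TT * r"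
    unfolding v_def r_def by (simp add: algebra_simps)
  show ?thesis unfolding eq er of_int_add of_int_numeral by (rule arith[OF cs(1) vt r th])
qed

lemma area_bound1:
  assumes "\<bar>fst e\<bar> \<le> 2 * K" "\<bar>snd e\<bar> \<le> K" "\<bar>fst v\<bar> + \<bar>snd v\<bar> \<le> B"
  shows "\<bar>area e v\<bar> \<le> 2 * K * B"
proof -
  have K: "0 \<le> K" using assms by linarith
  have "\<bar>fst e * snd v\<bar> \<le> 2 * K * \<bar>snd v\<bar>" "\<bar>snd e * fst v\<bar> \<le> K * \<bar>fst v\<bar>"
    unfolding abs_mult using assms by (intro mult_right_mono; simp)+
  moreover have "K * \<bar>fst v\<bar> \<le> 2 * K * \<bar>fst v\<bar>" using K by simp
  moreover have "2 * K * (\<bar>fst v\<bar> + \<bar>snd v\<bar>) \<le> 2 * K * B" using K assms by (intro mult_left_mono) auto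
  ultimately show ?thesis unfolding area_def by (simp only: distrib_left)
qed

lemma linear_between:
  fixes x :: real
  assumes "1 \<le> m * a + n" "1 \<le> m * b + n" "a \<le> x" "x \<le> b"
  shows "1 \<le> m * x + n"
proof (cases "0 \<le> m")
  case True
  then have "m * a \<le> m * x" using assms by (simp add: mult_left_mono)
  then show ?thesis using assms by linarith
next
  case False
  then have "m * b \<le> m * x" using assms by (simp add: mult_left_mono_neg)
  then show ?thesis using assms by linarith
qed

lemma area_am_linear: "area u (transfer_by w v) = (- (snd u * fst v)) * w + (fst u * fst v + snd u * snd v)"
  "area (transfer_by w v) u = (snd u * fst v) * w + (- (fst u * fst v) - snd u * snd v)"
  by (simp_all add: area_def transfer_by_def algebra_simps)

lemma area_swap: "area u v = - area v u" by (simp add: area_def)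

lemma size_shift:
  fixes x y d :: real
  assumes "\<bar>x - x'\<bar> \<le> 2 * K" "\<bar>y - y'\<bar> \<le> K" "\<bar>x'\<bar> + \<bar>y'\<bar> \<le> n" "\<bar>d\<bar> \<le> m"
  shows "\<bar>x + d\<bar> + \<bar>y\<bar> \<le> n + 3 * K + m"
  using assms by (smt (verit))

text \<open>The image of P is exact at w2 and that of Q at w1 up to the displacements, and there the area of P and Q is preserved.
The two mixed areas are linear in w, hence it suffices to bound them at w1 and w2.\<close>

lemma inside_step:
  fixes w1 w2 w :: real
  assumes w: "w1 \<le> w" "w \<le> w2" "w2 - w1 \<le> D"
    and KP: "\<bar>fst (transfer_by w2 P) - fst P'\<bar> \<le> 2 * KP" "\<bar>snd (transfer_by w2 P) - snd P'\<bar> \<le> KP"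
    and KQ: "\<bar>fst (transfer_by w1 Q) - fst Q'\<bar> \<le> 2 * KQ" "\<bar>snd (transfer_by w1 Q) - snd Q'\<bar> \<le> KQ"
    and a: "1 \<le> area P' (transfer_by w P)" and b: "1 \<le> area (transfer_by w Q) Q'"
    and nP: "\<bar>fst P\<bar> + \<bar>snd P\<bar> \<le> nP" "\<bar>fst P'\<bar> + \<bar>snd P'\<bar> \<le> nP'"
    and nQ: "\<bar>fst Q\<bar> + \<bar>snd Q\<bar> \<le> nQ" "\<bar>fst Q'\<bar> + \<bar>snd Q'\<bar> \<le> nQ'"
    and W: "W \<le> area P Q" "W' \<le> area P' Q'"
    and bP: "2 * KP * (nQ' + 3 * KQ + D * nQ) \<le> W - 1" "2 * KP * (nQ' + 3 * KQ + D * nQ) \<le> W' - 1"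
    and bQ: "2 * KQ * (nP' + 3 * KP + D * nP) \<le> W - 1" "2 * KQ * (nP' + 3 * KP + D * nP) \<le> W' - 1"
  shows "inside (transfer_by w P) (transfer_by w Q) P' Q'"
proof -
  have D: "0 \<le> D" using w by linarith
  have K0: "0 \<le> KP" "0 \<le> KQ" "0 \<le> nP" "0 \<le> nQ"
    using order_trans[OF abs_ge_zero KP(2)] order_trans[OF abs_ge_zero KQ(2)] order_trans[OF add_nonneg_nonneg[OF abs_ge_zero abs_ge_zero] nP(1)]
      order_trans[OF add_nonneg_nonneg[OF abs_ge_zero abs_ge_zero] nQ(1)] by simp_all
  have eP: "\<bar>fst (P' - transfer_by w2 P)\<bar> \<le> 2 * KP" "\<bar>snd (P' - transfer_by w2 P)\<bar> \<le> KP" using KP by (simp_all add: abs_minus_commute)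
  have eQ: "\<bar>fst (Q' - transfer_by w1 Q)\<bar> \<le> 2 * KQ" "\<bar>snd (Q' - transfer_by w1 Q)\<bar> \<le> KQ" using KQ by (simp_all add: abs_minus_commute)
  have sizeQ: "\<bar>fst (transfer_by w2 Q)\<bar> + \<bar>snd (transfer_by w2 Q)\<bar> \<le> nQ' + 3 * KQ + D * nQ"
  proof -
    have eq: "fst (transfer_by w2 Q) = fst (transfer_by w1 Q) + (w2 - w1) * fst Q" "snd (transfer_by w2 Q) = snd (transfer_by w1 Q)" by (simp_all add: transfer_by_def algebra_simps)
    have "\<bar>fst Q\<bar> \<le> nQ" using nQ(1) abs_ge_zero[of "snd Q"] by linarith
    then have "\<bar>(w2 - w1) * fst Q\<bar> \<le> D * nQ" unfolding abs_mult using w D by (intro mult_mono) auto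
    then show ?thesis unfolding eq by (rule size_shift[OF KQ nQ(2)])
  qed
  have sizeP: "\<bar>fst (transfer_by w1 P)\<bar> + \<bar>snd (transfer_by w1 P)\<bar> \<le> nP' + 3 * KP + D * nP"
  proof -
    have eq: "fst (transfer_by w1 P) = fst (transfer_by w2 P) + - ((w2 - w1) * fst P)" "snd (transfer_by w1 P) = snd (transfer_by w2 P)" by (simp_all add: transfer_by_def algebra_simps)
    have "\<bar>fst P\<bar> \<le> nP" using nP(1) abs_ge_zero[of "snd P"] by linarith
    then have "\<bar>- ((w2 - w1) * fst P)\<bar> \<le> D * nP" unfolding abs_minus_cancel abs_mult using w D by (intro mult_mono) auto
    then show ?thesis unfolding eq by (rule size_shift[OF KP nP(2)])
  qed
  have DQ: "0 \<le> D * nQ" "0 \<le> D * nP" using D K0 by auto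
  have "2 * KP * nQ' \<le> 2 * KP * (nQ' + 3 * KQ + D * nQ)" using K0 DQ by (intro mult_left_mono) auto
  then have P2: "\<bar>area (P' - transfer_by w2 P) Q'\<bar> \<le> W' - 1" using area_bound1[OF eP nQ(2)] bP(2) by linarith
  have "2 * KQ * nP' \<le> 2 * KQ * (nP' + 3 * KP + D * nP)" using K0 DQ by (intro mult_left_mono) auto
  then have Q2: "\<bar>area (Q' - transfer_by w1 Q) P'\<bar> \<le> W' - 1" using area_bound1[OF eQ nP(2)] bQ(2) by linarith
  have P1: "\<bar>area (P' - transfer_by w2 P) (transfer_by w2 Q)\<bar> \<le> W - 1" using area_bound1[OF eP sizeQ] bP(1) by linarith
  have Q1: "\<bar>area (Q' - transfer_by w1 Q) (transfer_by w1 P)\<bar> \<le> W - 1" using area_bound1[OF eQ sizeP] bQ(1) by linarith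
  have "area P' (transfer_by w2 Q) = area P Q + area (P' - transfer_by w2 P) (transfer_by w2 Q)"
    using area_transfer_by[of w2 P Q] by (simp add: area_def algebra_simps)
  then have f2: "1 \<le> area P' (transfer_by w2 Q)" using P1 W by linarith
  have "area P' (transfer_by w1 Q) = area P' Q' + area (Q' - transfer_by w1 Q) P'" by (simp add: area_def algebra_simps)
  then have f1: "1 \<le> area P' (transfer_by w1 Q)" using Q2 W by linarith
  have "area (transfer_by w1 P) Q' = area P Q - area (Q' - transfer_by w1 Q) (transfer_by w1 P)"
    using area_transfer_by[of w1 P Q] by (simp add: area_def algebra_simps)
  then have h1: "1 \<le> area (transfer_by w1 P) Q'" using Q1 W by linarith
  have "area (transfer_by w2 P) Q' = area P' Q' - area (P' - transfer_by w2 P) Q'" by (simp add: area_def algebra_simps)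
  then have h2: "1 \<le> area (transfer_by w2 P) Q'" using P2 W by linarith
  have "1 \<le> area P' (transfer_by w Q)" using f1 f2 w(1,2) unfolding area_am_linear by (rule linear_between)
  moreover have "1 \<le> area (transfer_by w P) Q'" using h1 h2 w(1,2) unfolding area_am_linear by (rule linear_between)
  ultimately show ?thesis using a b by (simp add: inside_def)
qed

definition BIG :: int where "BIG = 1000000000000000000000000000000000000"

lemma nrm_nonneg: "0 \<le> nrm P" by (cases P) simp

lemma wedge_zero: "wedge (IV 0 0 0 0) Q = 0" "wedge P (IV 0 0 0 0) = 0"
  by (cases Q; simp) (cases P; simp)

lemma step_sound:
  assumes st: "step (PAR zc zs E1 E2 Dl eta er) c s P Q W k" and W: "W = wedge P Q"
    and n: "near \<epsilon> \<phi> c s" "0 \<le> \<epsilon>" "\<epsilon> \<le> 187" and rot: "near 1 \<alpha> zc zs"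
    and h: "0 \<le> h" "h \<le> 1 / 8" "\<bar>of_int eta - TT * h\<bar> \<le> 2"
    and er: "er = sc (eta * eta) + 480" and Dl: "E1 \<le> E2" "E2 - E1 \<le> Dl * 268435456" "Dl \<le> 8"
  shows "\<exists>c' s' P' Q'. k c' s' P' Q' (wedge P' Q') \<and> near (\<epsilon> + 5 / 2) (\<phi> + \<alpha>) c' s' \<and> 1 \<le> wedge P' Q' \<and> nrm P' \<le> BIG \<and> nrm Q' \<le> BIG \<and>
    (\<forall>\<tau>\<in>{-1..1}. \<forall>E\<in>{of_int E1 / TT..of_int E2 / TT}.
      inside (transfer_by (E - 2 * cos (\<phi> + h * \<tau>)) (val P \<tau>)) (transfer_by (E - 2 * cos (\<phi> + h * \<tau>)) (val Q \<tau>)) (val P' \<tau>) (val Q' \<tau>))"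
proof -
  define w1 where "w1 = sc (2 * s * eta)"
  define cP cQ where "cP = bend w1 P" and "cQ = bend w1 Q"
  define KP KQ where "KP = slack er cP P" and "KQ = slack er cQ Q"
  define P' Q' where "P' = nxt True (E2 - 2 * c) w1 cP KP P" and "Q' = nxt False (E1 - 2 * c) w1 cQ KQ Q"
  define bP where "bP = 2 * KP * (nrm Q' + 3 * KQ + Dl * nrm Q)"
  define bQ where "bQ = 2 * KQ * (nrm P' + 3 * KP + Dl * nrm P)"
  define c' s' where "c' = sc (c * zc - s * zs)" and "s' = sc (s * zc + c * zs)"
  have "st5 zc zs c s k P' Q' W (wedge P' Q') bP bQ (nrm P' + nrm Q')"
    using st unfolding step.simps st1_def st2_def st3_def st4_def w1_def[symmetric] cP_def[symmetric] cQ_def[symmetric]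
      KP_def[symmetric] KQ_def[symmetric] P'_def[symmetric] Q'_def[symmetric] bP_def[symmetric] bQ_def[symmetric] .
  then have ck: "bP < W" "bP < wedge P' Q'" "bQ < W" "bQ < wedge P' Q'" "nrm P' + nrm Q' \<le> BIG" "k c' s' P' Q' (wedge P' Q')"
    unfolding st5_def c'_def[symmetric] s'_def[symmetric] BIG_def by (auto split: if_splits)
  have "0 \<le> sc (eta * eta)" unfolding sc_def tdiv_def by (simp add: pos_imp_zdiv_nonneg_iff)
  then have er0: "0 \<le> er" by (simp add: er)
  have DlE: "0 \<le> Dl" using Dl by linarith
  have K0: "0 \<le> KP" "0 \<le> KQ"
  proof -
    have "0 \<le> sc (er * (\<bar>x\<bar> + \<bar>y\<bar>))" for x y
    proof -
      have "0 \<le> er * (\<bar>x\<bar> + \<bar>y\<bar>)" using er0 by simp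
      then show ?thesis unfolding sc_def tdiv_def by (simp add: pos_imp_zdiv_nonneg_iff)
    qed
    then show "0 \<le> KP" "0 \<le> KQ" unfolding KP_def KQ_def by (cases P; cases Q; simp add: add_nonneg_nonneg)+
  qed
  have b0: "0 \<le> bP" "0 \<le> bQ" unfolding bP_def bQ_def using K0 DlE nrm_nonneg by (intro mult_nonneg_nonneg add_nonneg_nonneg; simp)+
  have ne: "P' \<noteq> IV 0 0 0 0" "Q' \<noteq> IV 0 0 0 0" using ck(2) b0(1) wedge_zero by auto
  have ins: "inside (transfer_by (E - 2 * cos (\<phi> + h * \<tau>)) (val P \<tau>)) (transfer_by (E - 2 * cos (\<phi> + h * \<tau>)) (val Q \<tau>)) (val P' \<tau>) (val Q' \<tau>)"
    if t: "\<tau> \<in> {-1..1}" and E: "E \<in> {of_int E1 / TT..of_int E2 / TT}" for \<tau> E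
  proof -
    have \<tau>: "\<bar>\<tau>\<bar> \<le> 1" using t by auto
    define g where "g = 2 * cos (\<phi> + h * \<tau>)"
    define e where "e F = TT * (F - g) - (TT * F - 2 * of_int c + of_int w1 * \<tau>)" for F
    have e: "\<bar>e F\<bar> \<le> of_int er" for F
      unfolding e_def g_def by (rule near_potential[OF n(1,2) _ \<tau> h er w1_def]) (use n in simp)
    have u2: "TT * (of_int E2 / TT - g) = of_int (E2 - 2 * c) + of_int w1 * \<tau> + e (of_int E2 / TT)"
      and u1: "TT * (of_int E1 / TT - g) = of_int (E1 - 2 * c) + of_int w1 * \<tau> + e (of_int E1 / TT)"
      unfolding e_def by simp_all
    have DD: "of_int E2 / TT - of_int E1 / TT \<le> of_int Dl"
    proof -
      have "real_of_int (E2 - E1) \<le> of_int (Dl * 268435456)" using Dl(2) by (simp only: of_int_le_iff)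
      then show ?thesis by (simp add: field_simps)
    qed
    have D8: "real_of_int Dl \<le> 8" using Dl(3) by simp
    have dP: "0 \<le> of_int E2 / TT - E" "of_int E2 / TT - E \<le> 8" and dQ: "0 \<le> E - of_int E1 / TT" "E - of_int E1 / TT \<le> 8"
      using E DD D8 by auto
    note sP = nxt_sound[OF \<tau> u2 e er0 cP_def KP_def P'_def ne(1) dP refl]
    note sQ = nxt_sound[OF \<tau> u1 e er0 cQ_def KQ_def Q'_def ne(2) dQ refl]
    have a: "1 \<le> area (val P' \<tau>) (transfer_by (E - g) (val P \<tau>))" using sP(3) by (simp add: algebra_simps)
    have b: "1 \<le> area (transfer_by (E - g) (val Q \<tau>)) (val Q' \<tau>)" using sQ(3) area_swap[of "transfer_by (E - g) (val Q \<tau>)"] by (simp add: algebra_simps)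
    have i: "real_of_int x \<le> of_int y - 1" if "x < y" for x y using that by linarith
    show ?thesis
      unfolding g_def[symmetric]
    proof (rule inside_step[where KP = "of_int KP" and KQ = "of_int KQ" and W = "of_int W" and W' = "of_int (wedge P' Q')" and D = "of_int Dl",
          OF _ _ _ sP(1,2) sQ(1,2) a b val_nrm[OF \<tau>] val_nrm[OF \<tau>] val_nrm[OF \<tau>] val_nrm[OF \<tau>]])
      show "of_int W \<le> area (val P \<tau>) (val Q \<tau>)" "of_int (wedge P' Q') \<le> area (val P' \<tau>) (val Q' \<tau>)"
        unfolding W by (rule wedge_le[OF \<tau>])+
    qed (use E DD i[OF ck(1)] i[OF ck(2)] i[OF ck(3)] i[OF ck(4)] in \<open>simp_all add: bP_def bQ_def\<close>)
  qed
  have "near (\<epsilon> + 5 / 2) (\<phi> + \<alpha>) c' s'" unfolding c'_def s'_def using n by (intro near_rotate rot) auto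
  moreover have "1 \<le> wedge P' Q'" using ck(2) b0(1) by linarith
  moreover have "nrm P' \<le> BIG" "nrm Q' \<le> BIG" using ck(5) nrm_nonneg[of P'] nrm_nonneg[of Q'] by linarith+
  ultimately show ?thesis using ck(6) ins by blast
qed

section \<open>Chains of certified steps\<close>

fun ivneg :: "iv \<Rightarrow> iv" where "ivneg (IV a b c d) = IV (- a) (- b) (- c) (- d)"

definition closes :: "iv \<Rightarrow> iv \<Rightarrow> iv \<Rightarrow> iv \<Rightarrow> bool" where
  "closes p q P Q \<longleftrightarrow> 1 \<le> wedge p P \<and> 1 \<le> wedge p Q \<and> 1 \<le> wedge P q \<and> 1 \<le> wedge Q q"

text \<open>The final cone is compared with the start cone and with its negative, the latter being the usual case for an odd
number of sign changes.\<close>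

fun run :: "nat \<Rightarrow> par \<Rightarrow> iv \<Rightarrow> iv \<Rightarrow> int \<Rightarrow> int \<Rightarrow> iv \<Rightarrow> iv \<Rightarrow> int \<Rightarrow> bool" where
  "run 0 g p q c s P Q W = (closes p q P Q \<or> closes (ivneg p) (ivneg q) P Q)"
| "run (Suc n) g p q c s P Q W = step g c s P Q W (run n g p q)"

fun pos :: "iv \<Rightarrow> bool" where "pos (IV a b c d) = (0 < a)"

fun pure :: "bool \<Rightarrow> iv \<Rightarrow> iv \<Rightarrow> bool" where
  "pure True (IV C1 C2 G1 G2) (IV D1 D2 H1 H2) = (0 < C1 \<and> 0 < D1)"
| "pure False (IV C1 C2 G1 G2) (IV D1 D2 H1 H2) = (C1 < 0 \<and> D1 < 0)"

definition dec :: "bool \<Rightarrow> bool \<Rightarrow> int \<Rightarrow> int" where "dec b b' m = (if b = b' then m else m - 1)"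

text \<open>A run that also counts sign changes: all vectors of the cone must have first coordinates of one sign at every site, so
every orbit in the cone has the same changes. The number m counts down to zero.\<close>

fun crun :: "nat \<Rightarrow> par \<Rightarrow> bool \<Rightarrow> int \<Rightarrow> int \<Rightarrow> int \<Rightarrow> iv \<Rightarrow> iv \<Rightarrow> int \<Rightarrow> bool" where
  "crun 0 g b m c s P Q W = (if pure (pos P) P Q then dec b (pos P) m = 0 else False)"
| "crun (Suc n) g b m c s P Q W = (if pure (pos P) P Q then step g c s P Q W (crun n g (pos P) (dec b (pos P) m)) else False)"

definition chain :: "real \<Rightarrow> real \<Rightarrow> real \<Rightarrow> real \<Rightarrow> real \<Rightarrow> nat \<Rightarrow> (nat \<Rightarrow> iv) \<Rightarrow> (nat \<Rightarrow> iv) \<Rightarrow> bool" where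
  "chain \<alpha> \<phi> h E1 E2 N PP QQ \<longleftrightarrow>
     (\<forall>n\<le>N. 1 \<le> wedge (PP n) (QQ n) \<and> nrm (PP n) \<le> BIG \<and> nrm (QQ n) \<le> BIG) \<and>
     (\<forall>n<N. \<forall>\<tau>\<in>{-1..1}. \<forall>E\<in>{E1..E2}.
        inside (transfer_by (E - 2 * cos (\<phi> + real n * \<alpha> + h * \<tau>)) (val (PP n) \<tau>)) (transfer_by (E - 2 * cos (\<phi> + real n * \<alpha> + h * \<tau>)) (val (QQ n) \<tau>))
          (val (PP (Suc n)) \<tau>) (val (QQ (Suc n)) \<tau>))"

lemmas chain_cone = chain_def[THEN iffD1, THEN conjunct1, rule_format]
lemmas chain_inside = chain_def[THEN iffD1, THEN conjunct2, rule_format]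

lemma chain_Suc:
  assumes "chain \<alpha> (\<phi> + \<alpha>) h E1 E2 N PP QQ" "1 \<le> wedge P Q" "nrm P \<le> BIG" "nrm Q \<le> BIG"
    and "\<forall>\<tau>\<in>{-1..1}. \<forall>E\<in>{E1..E2}. inside (transfer_by (E - 2 * cos (\<phi> + h * \<tau>)) (val P \<tau>)) (transfer_by (E - 2 * cos (\<phi> + h * \<tau>)) (val Q \<tau>)) (val (PP 0) \<tau>) (val (QQ 0) \<tau>)"
  shows "chain \<alpha> \<phi> h E1 E2 (Suc N) (case_nat P PP) (case_nat Q QQ)"
  unfolding chain_def
proof (intro conjI allI impI ballI)
  fix n assume n: "n \<le> Suc N"
  have "1 \<le> wedge (PP m) (QQ m) \<and> nrm (PP m) \<le> BIG \<and> nrm (QQ m) \<le> BIG" if "m \<le> N" for m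
    by (rule chain_cone[OF assms(1) that])
  then show "1 \<le> wedge (case_nat P PP n) (case_nat Q QQ n)" "nrm (case_nat P PP n) \<le> BIG" "nrm (case_nat Q QQ n) \<le> BIG"
    using assms(2-4) n by (cases n; simp)+
next
  fix n and \<tau> E :: real assume n: "n < Suc N" and t: "\<tau> \<in> {-1..1}" "E \<in> {E1..E2}"
  show "inside (transfer_by (E - 2 * cos (\<phi> + real n * \<alpha> + h * \<tau>)) (val (case_nat P PP n) \<tau>)) (transfer_by (E - 2 * cos (\<phi> + real n * \<alpha> + h * \<tau>)) (val (case_nat Q QQ n) \<tau>))
          (val (case_nat P PP (Suc n)) \<tau>) (val (case_nat Q QQ (Suc n)) \<tau>)"
  proof (cases n)
    case 0
    then show ?thesis using assms(5) t by simp
  next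
    case (Suc m)
    have "m < N" using n Suc by simp
    have "inside (transfer_by (E - 2 * cos (\<phi> + \<alpha> + real m * \<alpha> + h * \<tau>)) (val (PP m) \<tau>)) (transfer_by (E - 2 * cos (\<phi> + \<alpha> + real m * \<alpha> + h * \<tau>)) (val (QQ m) \<tau>))
          (val (PP (Suc m)) \<tau>) (val (QQ (Suc m)) \<tau>)"
      by (rule chain_inside[OF assms(1) \<open>m < N\<close> t])
    moreover have "\<phi> + \<alpha> + real m * \<alpha> + h * \<tau> = \<phi> + real n * \<alpha> + h * \<tau>" by (simp add: Suc algebra_simps)
    ultimately show ?thesis unfolding Suc by (simp only: nat.case)
  qed
qed

definition faithful :: "real \<Rightarrow> real \<Rightarrow> par \<Rightarrow> real \<Rightarrow> real \<Rightarrow> bool" where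
  "faithful \<alpha> h g F1 F2 \<longleftrightarrow> (\<exists>zc zs E1 E2 Dl eta er. g = PAR zc zs E1 E2 Dl eta er \<and> near 1 \<alpha> zc zs \<and> 0 \<le> h \<and> h \<le> 1 / 8 \<and>
     \<bar>of_int eta - TT * h\<bar> \<le> 2 \<and> er = sc (eta * eta) + 480 \<and> E1 \<le> E2 \<and> E2 - E1 \<le> Dl * 268435456 \<and> Dl \<le> 8 \<and>
     F1 = of_int E1 / TT \<and> F2 = of_int E2 / TT)"

lemma step_faithful:
  assumes "faithful \<alpha> h g F1 F2" "step g c s P Q (wedge P Q) k" "near \<epsilon> \<phi> c s" "0 \<le> \<epsilon>" "\<epsilon> \<le> 187"
  shows "\<exists>c' s' P' Q'. k c' s' P' Q' (wedge P' Q') \<and> near (\<epsilon> + 5 / 2) (\<phi> + \<alpha>) c' s' \<and> 1 \<le> wedge P' Q' \<and> nrm P' \<le> BIG \<and> nrm Q' \<le> BIG \<and>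
    (\<forall>\<tau>\<in>{-1..1}. \<forall>E\<in>{F1..F2}.
      inside (transfer_by (E - 2 * cos (\<phi> + h * \<tau>)) (val P \<tau>)) (transfer_by (E - 2 * cos (\<phi> + h * \<tau>)) (val Q \<tau>)) (val P' \<tau>) (val Q' \<tau>))"
proof -
  obtain zc zs E1 E2 Dl eta er where g: "g = PAR zc zs E1 E2 Dl eta er" "near 1 \<alpha> zc zs" "0 \<le> h" "h \<le> 1 / 8"
     "\<bar>of_int eta - TT * h\<bar> \<le> 2" "er = sc (eta * eta) + 480" "E1 \<le> E2" "E2 - E1 \<le> Dl * 268435456" "Dl \<le> 8"
     "F1 = of_int E1 / TT" "F2 = of_int E2 / TT"
    using assms(1) unfolding faithful_def by blast
  show ?thesis unfolding g(10,11)
    by (rule step_sound[OF assms(2)[unfolded g(1)] refl assms(3-5) g(2-9)])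
qed

lemma run_sound:
  assumes g: "faithful \<alpha> h g F1 F2"
  shows "run N g p q c s P Q (wedge P Q) \<Longrightarrow> near \<epsilon> \<phi> c s \<Longrightarrow> 0 \<le> \<epsilon> \<Longrightarrow> \<epsilon> + 5 / 2 * N \<le> 189 \<Longrightarrow>
    1 \<le> wedge P Q \<Longrightarrow> nrm P \<le> BIG \<Longrightarrow> nrm Q \<le> BIG \<Longrightarrow>
    \<exists>PP QQ. PP 0 = P \<and> QQ 0 = Q \<and> chain \<alpha> \<phi> h F1 F2 N PP QQ \<and> (closes p q (PP N) (QQ N) \<or> closes (ivneg p) (ivneg q) (PP N) (QQ N))"
proof (induction N arbitrary: c s P Q \<epsilon> \<phi>)
  case 0
  then have "chain \<alpha> \<phi> h F1 F2 0 (\<lambda>_. P) (\<lambda>_. Q)" by (simp add: chain_def)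
  then show ?case using 0 by (intro exI[of _ "\<lambda>_. P"] exI[of _ "\<lambda>_. Q"]) simp
next
  case (Suc N)
  have e: "\<epsilon> \<le> 187" "\<epsilon> + 5 / 2 + 5 / 2 * N \<le> 189" "0 \<le> \<epsilon> + 5 / 2"
  proof -
    have "5 / 2 * real (Suc N) = 5 / 2 * real N + 5 / 2" "0 \<le> real N" by (simp_all add: distrib_left)
    then show "\<epsilon> \<le> 187" "\<epsilon> + 5 / 2 + 5 / 2 * N \<le> 189" "0 \<le> \<epsilon> + 5 / 2" using Suc.prems by linarith+
  qed
  obtain c' s' P' Q' where *: "run N g p q c' s' P' Q' (wedge P' Q')" "near (\<epsilon> + 5 / 2) (\<phi> + \<alpha>) c' s'" "1 \<le> wedge P' Q'" "nrm P' \<le> BIG" "nrm Q' \<le> BIG"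
    "\<forall>\<tau>\<in>{-1..1}. \<forall>E\<in>{F1..F2}.
      inside (transfer_by (E - 2 * cos (\<phi> + h * \<tau>)) (val P \<tau>)) (transfer_by (E - 2 * cos (\<phi> + h * \<tau>)) (val Q \<tau>)) (val P' \<tau>) (val Q' \<tau>)"
    using step_faithful[OF g Suc.prems(1)[unfolded run.simps] Suc.prems(2,3) e(1)] by blast
  obtain PP QQ where PQ: "PP 0 = P'" "QQ 0 = Q'" "chain \<alpha> (\<phi> + \<alpha>) h F1 F2 N PP QQ" "closes p q (PP N) (QQ N) \<or> closes (ivneg p) (ivneg q) (PP N) (QQ N)"
    using Suc.IH[OF *(1,2) e(3) e(2) *(3-5)] by blast
  have "chain \<alpha> \<phi> h F1 F2 (Suc N) (case_nat P PP) (case_nat Q QQ)"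
    using PQ *(6) Suc.prems by (intro chain_Suc) auto
  then show ?case using PQ(4) by (intro exI[of _ "case_nat P PP"] exI[of _ "case_nat Q QQ"]) simp
qed

definition sg :: "iv \<Rightarrow> real" where "sg P = (if pos P then 1 else - 1)"

lemma crun_sound:
  assumes g: "faithful \<alpha> h g F1 F2"
  shows "crun N g b m c s P Q (wedge P Q) \<Longrightarrow> near \<epsilon> \<phi> c s \<Longrightarrow> 0 \<le> \<epsilon> \<Longrightarrow> \<epsilon> + 5 / 2 * N \<le> 189 \<Longrightarrow>
    1 \<le> wedge P Q \<Longrightarrow> nrm P \<le> BIG \<Longrightarrow> nrm Q \<le> BIG \<Longrightarrow>
    \<exists>PP QQ. PP 0 = P \<and> QQ 0 = Q \<and> chain \<alpha> \<phi> h F1 F2 N PP QQ \<and> (\<forall>n\<le>N. pure (pos (PP n)) (PP n) (QQ n)) \<and>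
      m = (if b = pos P then 0 else 1) + int (changes (\<lambda>n. sg (PP n)) N)"
proof (induction N arbitrary: b m c s P Q \<epsilon> \<phi>)
  case 0
  then have "chain \<alpha> \<phi> h F1 F2 0 (\<lambda>_. P) (\<lambda>_. Q)" by (simp add: chain_def)
  then show ?case using 0 by (intro exI[of _ "\<lambda>_. P"] exI[of _ "\<lambda>_. Q"]) (auto simp: dec_def split: if_splits)
next
  case (Suc N)
  have e: "\<epsilon> \<le> 187" "\<epsilon> + 5 / 2 + 5 / 2 * N \<le> 189" "0 \<le> \<epsilon> + 5 / 2"
  proof -
    have "5 / 2 * real (Suc N) = 5 / 2 * real N + 5 / 2" "0 \<le> real N" by (simp_all add: distrib_left)
    then show "\<epsilon> \<le> 187" "\<epsilon> + 5 / 2 + 5 / 2 * N \<le> 189" "0 \<le> \<epsilon> + 5 / 2" using Suc.prems by linarith+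
  qed
  have pu: "pure (pos P) P Q" and st: "step g c s P Q (wedge P Q) (crun N g (pos P) (dec b (pos P) m))"
    using Suc.prems(1) by (auto split: if_splits)
  obtain c' s' P' Q' where *: "crun N g (pos P) (dec b (pos P) m) c' s' P' Q' (wedge P' Q')" "near (\<epsilon> + 5 / 2) (\<phi> + \<alpha>) c' s'" "1 \<le> wedge P' Q'" "nrm P' \<le> BIG" "nrm Q' \<le> BIG"
    "\<forall>\<tau>\<in>{-1..1}. \<forall>E\<in>{F1..F2}.
      inside (transfer_by (E - 2 * cos (\<phi> + h * \<tau>)) (val P \<tau>)) (transfer_by (E - 2 * cos (\<phi> + h * \<tau>)) (val Q \<tau>)) (val P' \<tau>) (val Q' \<tau>)"
    using step_faithful[OF g st Suc.prems(2,3) e(1)] by blast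
  obtain PP QQ where PQ: "PP 0 = P'" "QQ 0 = Q'" "chain \<alpha> (\<phi> + \<alpha>) h F1 F2 N PP QQ" "\<forall>n\<le>N. pure (pos (PP n)) (PP n) (QQ n)"
    "dec b (pos P) m = (if pos P = pos P' then 0 else 1) + int (changes (\<lambda>n. sg (PP n)) N)"
    using Suc.IH[OF *(1,2) e(3) e(2) *(3-5)] by blast
  have "chain \<alpha> \<phi> h F1 F2 (Suc N) (case_nat P PP) (case_nat Q QQ)"
    using PQ *(6) Suc.prems by (intro chain_Suc) auto
  moreover have "\<forall>n\<le>Suc N. pure (pos (case_nat P PP n)) (case_nat P PP n) (case_nat Q QQ n)"
    using PQ(4) pu by (auto split: nat.splits)
  moreover have "changes (\<lambda>n. sg (case_nat P PP n)) (Suc N) = (if pos P = pos P' then 0 else 1) + changes (\<lambda>n. sg (PP n)) N"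
    using changes_add[of "\<lambda>n. sg (case_nat P PP n)" 1 N] PQ(1) by (auto simp: sg_def)
  ultimately show ?case using PQ(5) by (intro exI[of _ "case_nat P PP"] exI[of _ "case_nat Q QQ"]) (auto simp: dec_def split: if_splits)
qed

lemma closes_inside:
  assumes "closes p q P Q" "\<bar>\<tau>\<bar> \<le> 1"
  shows "inside (val P \<tau>) (val Q \<tau>) (val p \<tau>) (val q \<tau>)"
proof -
  have "1 \<le> area (val u \<tau>) (val v \<tau>)" if "1 \<le> wedge u v" for u v
    using wedge_le[OF assms(2), of u v] that by linarith
  then show ?thesis using assms(1) by (auto simp: closes_def inside_def)
qed

lemma chain_column:
  assumes ch: "chain (2 * pi * \<omega>) \<phi> h E1 E2 N PP QQ" and p: "PP 0 = IV p1 p2 0 0" "QQ 0 = IV q1 q2 0 0"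
    and cl: "closes (PP 0) (QQ 0) (PP N) (QQ N) \<or> closes (ivneg (PP 0)) (ivneg (QQ 0)) (PP N) (QQ N)"
    and t: "2 * pi * t = \<phi> + h * \<tau>" "\<bar>\<tau>\<bar> \<le> 1"
  shows "column \<omega> E1 E2 (of_int BIG) (of_int p1, of_int p2) (of_int q1, of_int q2) N t"
proof -
  have pt: "pot (t + real n * \<omega>) = 2 * cos (\<phi> + real n * (2 * pi * \<omega>) + h * \<tau>)" for n
  proof -
    have "2 * pi * (t + real n * \<omega>) = \<phi> + real n * (2 * pi * \<omega>) + h * \<tau>" using t(1) by (simp add: algebra_simps)
    then show ?thesis by (simp add: pot_def)
  qed
  have tm: "\<tau> \<in> {-1..1}" using t(2) by auto
  have bdv: "bd (of_int BIG) (val P \<tau>)" if "nrm P \<le> BIG" for P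
    using val_nrm[OF t(2), of P] that unfolding bd_def by linarith
  have cone: "1 \<le> area (val (PP n) \<tau>) (val (QQ n) \<tau>) \<and> bd (of_int BIG) (val (PP n) \<tau>) \<and> bd (of_int BIG) (val (QQ n) \<tau>)" if "n \<le> N" for n
  proof -
    have "1 \<le> wedge (PP n) (QQ n)" "nrm (PP n) \<le> BIG" "nrm (QQ n) \<le> BIG" using chain_cone[OF ch that] by blast+
    then show ?thesis using wedge_le[OF t(2), of "PP n" "QQ n"] bdv by auto
  qed
  have ins: "inside (transfer_by (E - pot (t + real n * \<omega>)) (val (PP n) \<tau>)) (transfer_by (E - pot (t + real n * \<omega>)) (val (QQ n) \<tau>))
      (val (PP (Suc n)) \<tau>) (val (QQ (Suc n)) \<tau>)" if "n < N" "E \<in> {E1..E2}" for n E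
    unfolding pt by (rule chain_inside[OF ch that(1) tm that(2)])
  have v0: "val (PP 0) \<tau> = (of_int p1, of_int p2)" "val (QQ 0) \<tau> = (of_int q1, of_int q2)"
    "val (ivneg (PP 0)) \<tau> = - val (PP 0) \<tau>" "val (ivneg (QQ 0)) \<tau> = - val (QQ 0) \<tau>" by (simp_all add: p)
  have fin: "inside (val (PP N) \<tau>) (val (QQ N) \<tau>) (of_int p1, of_int p2) (of_int q1, of_int q2) \<or>
      inside (val (PP N) \<tau>) (val (QQ N) \<tau>) (- (of_int p1, of_int p2)) (- (of_int q1, of_int q2))"
    using cl closes_inside[OF _ t(2)] unfolding v0(1,2)[symmetric] v0(3,4)[symmetric] by blast
  show ?thesis
    unfolding column_def
  proof (rule exI[of _ "\<lambda>n. val (PP n) \<tau>"], rule exI[of _ "\<lambda>n. val (QQ n) \<tau>"], intro conjI allI impI ballI)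
    fix n assume "n \<le> N"
    from cone[OF this] show "1 \<le> area (val (PP n) \<tau>) (val (QQ n) \<tau>)" "bd (of_int BIG) (val (PP n) \<tau>)" "bd (of_int BIG) (val (QQ n) \<tau>)" by simp_all
  qed (rule v0(1) v0(2) ins fin | assumption)+
qed

lemma chain_orbit:
  assumes ch: "chain (2 * pi * \<omega>) (2 * pi * t) h E1 E2 N PP QQ" and E: "E \<in> {E1..E2}"
  shows "n \<le> N \<Longrightarrow> orb (\<lambda>n. E - pot (t + real n * \<omega>)) (val (PP 0) 0) n \<in> sector (val (PP n) 0) (val (QQ n) 0)"
proof (induction n)
  case 0
  show ?case unfolding sector_def orb.simps by (intro CollectI exI[of _ "1 :: real"] exI[of _ "0 :: real"]) simp
next
  case (Suc n)
  define w where "w = E - pot (t + real n * \<omega>)"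
  have pt: "pot (t + real n * \<omega>) = 2 * cos (2 * pi * t + real n * (2 * pi * \<omega>) + h * 0)"
    by (simp add: pot_def algebra_simps)
  obtain s r where st: "0 \<le> s" "0 \<le> r" "0 < s + r"
      "orb (\<lambda>n. E - pot (t + real n * \<omega>)) (val (PP 0) 0) n = s *\<^sub>R val (PP n) 0 + r *\<^sub>R val (QQ n) 0"
    using Suc by (auto simp: sector_def)
  have "orb (\<lambda>n. E - pot (t + real n * \<omega>)) (val (PP 0) 0) (Suc n) = s *\<^sub>R transfer_by w (val (PP n) 0) + r *\<^sub>R transfer_by w (val (QQ n) 0)"
    unfolding orb.simps st(4) w_def by (simp add: transfer_by_def algebra_simps)
  moreover have "inside (transfer_by w (val (PP n) 0)) (transfer_by w (val (QQ n) 0)) (val (PP (Suc n)) 0) (val (QQ (Suc n)) 0)"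
    unfolding w_def pt using Suc.prems by (intro chain_inside[OF ch _ _ E]) auto
  moreover have "0 < area (val (PP (Suc n)) 0) (val (QQ (Suc n)) 0)"
  proof -
    have "1 \<le> wedge (PP (Suc n)) (QQ (Suc n))" using chain_cone[OF ch Suc.prems] by blast
    then show ?thesis using wedge_le[of 0 "PP (Suc n)" "QQ (Suc n)"] by simp
  qed
  ultimately show ?case using st by (intro sector_step) auto
qed

lemma pure_sign: "pure (pos P) P Q \<Longrightarrow> 0 < sg P * fst (val P 0) \<and> 0 < sg P * fst (val Q 0)"
  by (cases P; cases Q; cases "pos P") (auto simp: sg_def)

lemma chain_count:
  assumes ch: "chain (2 * pi * \<omega>) (2 * pi * t) h E1 E2 N PP QQ" and E: "E \<in> {E1..E2}"
    and pu: "\<forall>n\<le>N. pure (pos (PP n)) (PP n) (QQ n)"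
  shows "(\<forall>n\<le>N. fst (orb (\<lambda>n. E - pot (t + real n * \<omega>)) (val (PP 0) 0) n) \<noteq> 0)
    \<and> changes (\<lambda>n. fst (orb (\<lambda>n. E - pot (t + real n * \<omega>)) (val (PP 0) 0) n)) N = changes (\<lambda>n. sg (PP n)) N"
proof -
  define x where "x n = fst (orb (\<lambda>n. E - pot (t + real n * \<omega>)) (val (PP 0) 0) n)" for n
  have sx: "0 < sg (PP n) * x n" if n: "n \<le> N" for n
  proof -
    obtain s r where st: "0 \<le> s" "0 \<le> r" "0 < s + r" "x n = s * fst (val (PP n) 0) + r * fst (val (QQ n) 0)"
      using chain_orbit[OF ch E n] unfolding x_def sector_def by auto
    have pq: "0 < sg (PP n) * fst (val (PP n) 0)" "0 < sg (PP n) * fst (val (QQ n) 0)"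
      using pure_sign pu n by blast+
    have a: "0 \<le> s * (sg (PP n) * fst (val (PP n) 0))" "0 \<le> r * (sg (PP n) * fst (val (QQ n) 0))"
      using pq st by simp_all
    have b: "0 < s * (sg (PP n) * fst (val (PP n) 0)) \<or> 0 < r * (sg (PP n) * fst (val (QQ n) 0))"
    proof (cases "0 < s")
      case True
      then show ?thesis using mult_pos_pos[OF True pq(1)] by blast
    next
      case False
      then have "0 < r" using st by linarith
      then show ?thesis using mult_pos_pos[OF _ pq(2)] by blast
    qed
    have c: "sg (PP n) * x n = s * (sg (PP n) * fst (val (PP n) 0)) + r * (sg (PP n) * fst (val (QQ n) 0))"
      unfolding st(4) by (simp add: algebra_simps)
    show ?thesis unfolding c using b add_pos_nonneg[OF _ a(2)] add_nonneg_pos[OF a(1)] by blast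
  qed
  have "changes x M = changes (\<lambda>n. sg (PP n)) M" if "M \<le> N" for M
    using that
  proof (induction M)
    case (Suc M)
    then have "0 < sg (PP M) * x M" "0 < sg (PP (Suc M)) * x (Suc M)" using sx by auto
    then have "(x M * x (Suc M) < 0 \<or> x (Suc M) = 0) = (sg (PP M) * sg (PP (Suc M)) < 0 \<or> sg (PP (Suc M)) = 0)"
      by (auto simp: sg_def mult_less_0_iff split: if_splits)
    then show ?case using Suc by simp
  qed simp
  then show ?thesis using sx unfolding x_def by fastforce
qed

section \<open>Cells of phases\<close>

text \<open>GEO zc zs E1 E2 Dl bc bs: as in PAR, with bc and bs the cosine and sine of the base phase in fixed point.\<close>

datatype geo = GEO int int int int int int int

definition cell4 :: "par \<Rightarrow> int \<Rightarrow> int \<Rightarrow> int \<Rightarrow> int \<Rightarrow> (par \<Rightarrow> int \<Rightarrow> int \<Rightarrow> bool) \<Rightarrow> bool" where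
  "cell4 g bc bs cI sI k = k g (sc (bc * cI - bs * sI)) (sc (bs * cI + bc * sI))"

text \<open>The constants are 2^28 divided by 24, 720, 6 and 120.\<close>

fun cell3 :: "geo \<Rightarrow> int \<Rightarrow> int \<Rightarrow> int \<Rightarrow> int \<Rightarrow> (par \<Rightarrow> int \<Rightarrow> int \<Rightarrow> bool) \<Rightarrow> bool" where
  "cell3 (GEO zc zs E1 E2 Dl bc bs) A eta y y2 k = cell4 (PAR zc zs E1 E2 Dl eta (sc (eta * eta) + 480)) bc bs
     (268435456 - half y + sc (y2 * 11184811) - sc (sc (y2 * y) * 372827))
     (A - sc (sc (A * y) * 44739243) + sc (sc (A * y2) * 2236962)) k"

definition cell2 :: "geo \<Rightarrow> int \<Rightarrow> int \<Rightarrow> int \<Rightarrow> (par \<Rightarrow> int \<Rightarrow> int \<Rightarrow> bool) \<Rightarrow> bool" where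
  "cell2 G A eta y k = cell3 G A eta y (sc (y * y)) k"

definition cell1 :: "geo \<Rightarrow> int \<Rightarrow> int \<Rightarrow> (par \<Rightarrow> int \<Rightarrow> int \<Rightarrow> bool) \<Rightarrow> bool" where
  "cell1 G A eta k = cell2 G A eta (sc (A * A)) k"

text \<open>Phases are offset from the base point in units of 2^-20 turns, and 215888603287 approximates 2 pi 2^35. The cosine and
sine of the offset are computed by Taylor polynomials and added to the base phase by one rotation.\<close>

definition cell :: "geo \<Rightarrow> int \<Rightarrow> int \<Rightarrow> (par \<Rightarrow> int \<Rightarrow> int \<Rightarrow> bool) \<Rightarrow> bool" where
  "cell G lo hi k = cell1 G (sc ((lo + hi) * 215888603287)) (sc ((hi - lo) * 215888603287)) k"

lemma sc_mult:
  fixes p q :: real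
  assumes "\<bar>of_int x - TT * p\<bar> \<le> e" "\<bar>of_int y - TT * q\<bar> \<le> f" "\<bar>p\<bar> \<le> P" "\<bar>q\<bar> \<le> Q"
    and "1 + e * f / TT + e * Q + P * f \<le> B"
  shows "\<bar>of_int (sc (x * y)) - TT * (p * q)\<bar> \<le> B"
proof -
  define a where "a = of_int x - TT * p"
  define b where "b = of_int y - TT * q"
  have eq: "of_int (x * y) / TT - TT * (p * q) = a * b / TT + a * q + p * b"
    by (simp add: a_def b_def field_simps)
  have ab: "\<bar>a\<bar> \<le> e" "\<bar>b\<bar> \<le> f" using assms by (simp_all add: a_def b_def)
  have "\<bar>a * b\<bar> \<le> e * f" "\<bar>a * q\<bar> \<le> e * Q" "\<bar>p * b\<bar> \<le> P * f"
    unfolding abs_mult using ab assms(3,4) by (intro mult_mono; simp)+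
  moreover from this(1) have "\<bar>a * b / TT\<bar> \<le> e * f / TT" by (simp add: divide_right_mono)
  moreover have "\<bar>of_int (x * y) / TT - of_int (sc (x * y))\<bar> < 1" by (rule sc_error)
  ultimately show ?thesis using assms(5) eq by linarith
qed

lemma cos_taylor: "\<bar>cos x - (1 - x\<^sup>2 / 2 + x ^ 4 / 24 - x ^ 6 / 720)\<bar> \<le> \<bar>x\<bar> ^ 8 / 40320" for x :: real
proof -
  obtain t where "cos x = (\<Sum>m<8. cos_coeff m * x ^ m) + cos (t + 1/2 * real 8 * pi) / fact 8 * x ^ 8"
    using Maclaurin_cos_expansion[of x 8] by auto
  moreover have "(\<Sum>m<8. cos_coeff m * x ^ m) = 1 - x\<^sup>2 / 2 + x ^ 4 / 24 - x ^ 6 / 720"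
    by (simp add: lessThan_nat_numeral cos_coeff_def fact_numeral)
  moreover have "\<bar>cos (t + 1/2 * real 8 * pi) / fact 8 * x ^ 8\<bar> \<le> \<bar>x\<bar> ^ 8 / 40320"
  proof -
    have "\<bar>cos (t + 1/2 * real 8 * pi)\<bar> * \<bar>x\<bar> ^ 8 \<le> 1 * \<bar>x\<bar> ^ 8" by (intro mult_right_mono) auto
    then show ?thesis by (simp add: abs_mult power_abs fact_numeral)
  qed
  ultimately show ?thesis by simp
qed

lemma sin_taylor: "\<bar>sin x - (x - x ^ 3 / 6 + x ^ 5 / 120 - x ^ 7 / 5040)\<bar> \<le> \<bar>x\<bar> ^ 9 / 362880" for x :: real
proof -
  have "(\<Sum>m<9. sin_coeff m * x ^ m) = x - x ^ 3 / 6 + x ^ 5 / 120 - x ^ 7 / 5040"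
    by (simp add: lessThan_nat_numeral sin_coeff_def fact_numeral)
  then show ?thesis using Maclaurin_sin_bound[of x 9] by (simp add: fact_numeral inverse_eq_divide)
qed

lemma pi_scaled: "\<bar>2 * pi * 34359738368 - 215888603287\<bar> \<le> 17"
  using pi_approx(1) pi_approx(2) by (simp add: abs_le_iff)

lemma angle_error:
  assumes "0 \<le> j" "j \<le> 65536"
  shows "\<bar>of_int (sc (j * 215888603287)) - TT * (2 * pi * (of_int j / 2097152))\<bar> \<le> 51 / 50"
proof -
  have "\<bar>of_int (j * 215888603287) / TT - TT * (2 * pi * (of_int j / 2097152))\<bar> = of_int j / TT * \<bar>2 * pi * 34359738368 - 215888603287\<bar>"
  proof -
    have "of_int (j * 215888603287) / TT - TT * (2 * pi * (of_int j / 2097152)) = - (of_int j / TT * (2 * pi * 34359738368 - 215888603287))"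
      by (simp add: field_simps)
    then show ?thesis using assms by (simp only: abs_minus_cancel abs_mult)
  qed
  also have "\<dots> \<le> 65536 / TT * 17" using assms pi_scaled by (intro mult_mono) auto
  finally show ?thesis using sc_error[of "j * 215888603287"] by linarith
qed

text \<open>The errors of the rounded Taylor polynomials are followed term by term; for angles up to 1/5 they stay below 17/2
units.\<close>

lemma taylor_near:
  fixes \<alpha> :: real
  assumes A: "\<bar>of_int A - TT * \<alpha>\<bar> \<le> 51 / 50" and \<alpha>: "0 \<le> \<alpha>" "\<alpha> \<le> 1 / 5" and y: "y = sc (A * A)" and y2: "y2 = sc (y * y)"
  shows "near (17 / 2) \<alpha> (268435456 - half y + sc (y2 * 11184811) - sc (sc (y2 * y) * 372827))
     (A - sc (sc (A * y) * 44739243) + sc (sc (A * y2) * 2236962))"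
proof -
  have pw: "\<alpha>\<^sup>2 \<le> 1 / 25" "\<alpha> ^ 4 \<le> 1 / 625" "\<alpha> ^ 3 \<le> 1 / 125" "\<alpha> ^ 5 \<le> 1 / 3125" "\<alpha> ^ 6 \<le> 1 / 15625" "\<alpha> ^ 7 \<le> 1 / 78125" "\<alpha> ^ 8 \<le> 1 / 390625"
    using power_mono[OF \<alpha>(2,1), of 2] power_mono[OF \<alpha>(2,1), of 4] power_mono[OF \<alpha>(2,1), of 3] power_mono[OF \<alpha>(2,1), of 5]
      power_mono[OF \<alpha>(2,1), of 6] power_mono[OF \<alpha>(2,1), of 7] power_mono[OF \<alpha>(2,1), of 8] by (simp_all add: power_divide)
  have c: "\<bar>of_int 11184811 - TT * (1/24)\<bar> \<le> 1" "\<bar>of_int 372827 - TT * (1/720)\<bar> \<le> 1" "\<bar>of_int 44739243 - TT * (1/6)\<bar> \<le> 1" "\<bar>of_int 2236962 - TT * (1/120)\<bar> \<le> 1"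
    by simp_all
  have e2: "\<bar>of_int y - TT * (\<alpha> * \<alpha>)\<bar> \<le> 3 / 2"
    unfolding y using \<alpha> by (intro sc_mult[OF A A, of "1/5" "1/5"]) auto
  have e4: "\<bar>of_int y2 - TT * ((\<alpha> * \<alpha>) * (\<alpha> * \<alpha>))\<bar> \<le> 6 / 5"
    unfolding y2 using pw(1) by (intro sc_mult[OF e2 e2, of "1/25" "1/25"]) (auto simp: power2_eq_square)
  have p4: "\<bar>(\<alpha> * \<alpha>) * (\<alpha> * \<alpha>)\<bar> \<le> 1 / 625" "\<bar>\<alpha> * \<alpha>\<bar> \<le> 1 / 25" "\<bar>\<alpha>\<bar> \<le> 1 / 5"
    using pw \<alpha> by (simp_all add: eval_nat_numeral mult.assoc)
  have t4: "\<bar>of_int (sc (y2 * 11184811)) - TT * ((\<alpha> * \<alpha>) * (\<alpha> * \<alpha>) * (1/24))\<bar> \<le> 11 / 10"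
    using p4 by (intro sc_mult[OF e4 c(1), of "1/625" "1/24"]) auto
  have e6: "\<bar>of_int (sc (y2 * y)) - TT * ((\<alpha> * \<alpha>) * (\<alpha> * \<alpha>) * (\<alpha> * \<alpha>))\<bar> \<le> 11 / 10"
    using p4 by (intro sc_mult[OF e4 e2, of "1/625" "1/25"]) auto
  have t6: "\<bar>of_int (sc (sc (y2 * y) * 372827)) - TT * ((\<alpha> * \<alpha>) * (\<alpha> * \<alpha>) * (\<alpha> * \<alpha>) * (1/720))\<bar> \<le> 11 / 10"
    using pw(5) \<alpha> by (intro sc_mult[OF e6 c(2), of "1/15625" "1/720"]) (auto simp: eval_nat_numeral mult.assoc)
  have e3: "\<bar>of_int (sc (A * y)) - TT * (\<alpha> * (\<alpha> * \<alpha>))\<bar> \<le> 7 / 5"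
    using p4 by (intro sc_mult[OF A e2, of "1/5" "1/25"]) auto
  have t3: "\<bar>of_int (sc (sc (A * y) * 44739243)) - TT * (\<alpha> * (\<alpha> * \<alpha>) * (1/6))\<bar> \<le> 5 / 4"
    using pw(3) \<alpha> by (intro sc_mult[OF e3 c(3), of "1/125" "1/6"]) (auto simp: eval_nat_numeral mult.assoc)
  have e5: "\<bar>of_int (sc (A * y2)) - TT * (\<alpha> * ((\<alpha> * \<alpha>) * (\<alpha> * \<alpha>)))\<bar> \<le> 5 / 4"
    using p4 by (intro sc_mult[OF A e4, of "1/5" "1/625"]) auto
  have t5: "\<bar>of_int (sc (sc (A * y2) * 2236962)) - TT * (\<alpha> * ((\<alpha> * \<alpha>) * (\<alpha> * \<alpha>)) * (1/120))\<bar> \<le> 11 / 10"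
    using pw(4) \<alpha> by (intro sc_mult[OF e5 c(4), of "1/3125" "1/120"]) (auto simp: eval_nat_numeral mult.assoc)
  have hy: "\<bar>of_int y / 2 - of_int (half y)\<bar> \<le> (1 / 2 :: real)" by (rule half_error)
  have scaled: "\<bar>TT * u - TT * v\<bar> \<le> TT * x" if "\<bar>u - v\<bar> \<le> x" for u v x :: real
    using that unfolding right_diff_distrib[symmetric] abs_mult by simp
  have ct: "\<bar>TT * cos \<alpha> - TT * (1 - \<alpha> * \<alpha> / 2 + (\<alpha> * \<alpha>) * (\<alpha> * \<alpha>) * (1/24) - (\<alpha> * \<alpha>) * (\<alpha> * \<alpha>) * (\<alpha> * \<alpha>) * (1/720))\<bar> \<le> 1 / 50"
  proof -
    have "\<bar>cos \<alpha> - (1 - \<alpha> * \<alpha> / 2 + (\<alpha> * \<alpha>) * (\<alpha> * \<alpha>) * (1/24) - (\<alpha> * \<alpha>) * (\<alpha> * \<alpha>) * (\<alpha> * \<alpha>) * (1/720))\<bar> \<le> 1 / 390625 / 40320"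
      using cos_taylor[of \<alpha>] pw(7) \<alpha> by (simp add: eval_nat_numeral mult.assoc)
    from scaled[OF this] show ?thesis by (rule order_trans) simp
  qed
  have st: "\<bar>TT * sin \<alpha> - TT * (\<alpha> - \<alpha> * (\<alpha> * \<alpha>) * (1/6) + \<alpha> * ((\<alpha> * \<alpha>) * (\<alpha> * \<alpha>)) * (1/120))\<bar> \<le> 7 / 10"
  proof -
    have "\<alpha> ^ 7 \<ge> 0" "\<alpha> ^ 9 \<le> 1 / 1953125" using \<alpha> power_mono[OF \<alpha>(2,1), of 9] by (simp_all add: power_divide)
    moreover have "\<alpha> * (\<alpha> * \<alpha>) = \<alpha> ^ 3" "\<alpha> * ((\<alpha> * \<alpha>) * (\<alpha> * \<alpha>)) = \<alpha> ^ 5" "\<bar>\<alpha>\<bar> = \<alpha>" using \<alpha> by (simp_all add: eval_nat_numeral mult.assoc)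
    ultimately have "\<bar>sin \<alpha> - (\<alpha> - \<alpha> * (\<alpha> * \<alpha>) * (1/6) + \<alpha> * ((\<alpha> * \<alpha>) * (\<alpha> * \<alpha>)) * (1/120))\<bar> \<le> 1 / 78125 / 5040 + 1 / 1953125 / 362880"
      using sin_taylor[of \<alpha>] pw(6) by (simp only:)
    from scaled[OF this] show ?thesis by (rule order_trans) simp
  qed
  define cI where "cI = 268435456 - half y + sc (y2 * 11184811) - sc (sc (y2 * y) * 372827)"
  define sI where "sI = A - sc (sc (A * y) * 44739243) + sc (sc (A * y2) * 2236962)"
  have dc: "TT * (1 - \<alpha> * \<alpha> / 2 + (\<alpha> * \<alpha>) * (\<alpha> * \<alpha>) * (1/24) - (\<alpha> * \<alpha>) * (\<alpha> * \<alpha>) * (\<alpha> * \<alpha>) * (1/720))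
      = TT - TT * (\<alpha> * \<alpha>) / 2 + TT * ((\<alpha> * \<alpha>) * (\<alpha> * \<alpha>) * (1/24)) - TT * ((\<alpha> * \<alpha>) * (\<alpha> * \<alpha>) * (\<alpha> * \<alpha>) * (1/720))"
    by (simp add: algebra_simps)
  have ds: "TT * (\<alpha> - \<alpha> * (\<alpha> * \<alpha>) * (1/6) + \<alpha> * ((\<alpha> * \<alpha>) * (\<alpha> * \<alpha>)) * (1/120))
      = TT * \<alpha> - TT * (\<alpha> * (\<alpha> * \<alpha>) * (1/6)) + TT * (\<alpha> * ((\<alpha> * \<alpha>) * (\<alpha> * \<alpha>)) * (1/120))"
    by (simp add: algebra_simps)
  have add_c: "\<bar>t - h + b - d - C\<bar> \<le> 4"
    if "\<bar>x - u\<bar> \<le> 3 / 2" "\<bar>x / 2 - h\<bar> \<le> 1 / 2" "\<bar>b - v\<bar> \<le> 11 / 10" "\<bar>d - w\<bar> \<le> 11 / 10" "\<bar>C - (t - u / 2 + v - w)\<bar> \<le> 1 / 50"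
    for t h b d C x u v w :: real using that unfolding abs_le_iff by linarith
  have add_s: "\<bar>x - b + d - S\<bar> \<le> 9 / 2"
    if "\<bar>x - u\<bar> \<le> 51 / 50" "\<bar>b - v\<bar> \<le> 5 / 4" "\<bar>d - w\<bar> \<le> 11 / 10" "\<bar>S - (u - v + w)\<bar> \<le> 7 / 10"
    for b d S x u v w :: real using that unfolding abs_le_iff by linarith
  have "\<bar>of_int cI - TT * cos \<alpha>\<bar> \<le> 4" unfolding cI_def of_int_add of_int_diff of_int_numeral
    by (rule add_c[OF e2 hy t4 t6 ct[unfolded dc]])
  moreover have "\<bar>of_int sI - TT * sin \<alpha>\<bar> \<le> 9 / 2" unfolding sI_def of_int_add of_int_diff
    by (rule add_s[OF A t3 t5 st[unfolded ds]])
  ultimately show ?thesis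
    unfolding near_def cI_def[symmetric] sI_def[symmetric]
    using cmod_le[of "Complex (of_int cI) (of_int sI) - of_real TT * cis \<alpha>"] by simp
qed

lemma cell_sound:
  assumes c: "cell (GEO zc zs E1 E2 Dl bc bs) lo hi k" and lh: "0 \<le> lo" "lo \<le> hi" "hi \<le> 32768"
    and b: "near 1 (2 * pi * b) bc bs" and z: "near 1 \<alpha> zc zs" and E: "E1 \<le> E2" "E2 - E1 \<le> Dl * 268435456" "Dl \<le> 8"
  shows "\<exists>g c s. k g c s \<and> faithful \<alpha> (2 * pi * (of_int (hi - lo) / 2097152)) g (of_int E1 / TT) (of_int E2 / TT) \<and>
    near 11 (2 * pi * (b + of_int (lo + hi) / 2097152)) c s"
proof -
  define A where "A = sc ((lo + hi) * 215888603287)"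
  define eta where "eta = sc ((hi - lo) * 215888603287)"
  define y where "y = sc (A * A)"
  define y2 where "y2 = sc (y * y)"
  define cI where "cI = 268435456 - half y + sc (y2 * 11184811) - sc (sc (y2 * y) * 372827)"
  define sI where "sI = A - sc (sc (A * y) * 44739243) + sc (sc (A * y2) * 2236962)"
  define \<beta> where "\<beta> = 2 * pi * (of_int (lo + hi) / 2097152)"
  have pi4: "pi < 16 / 5" using pi_approx by simp
  have "near (17 / 2) \<beta> cI sI" unfolding cI_def sI_def
  proof (rule taylor_near[OF _ _ _ y_def y2_def])
    show "\<bar>of_int A - TT * \<beta>\<bar> \<le> 51 / 50" unfolding A_def \<beta>_def using lh by (intro angle_error) auto
    show "0 \<le> \<beta>" unfolding \<beta>_def using lh by simp
    have "real_of_int (lo + hi) / 2097152 \<le> 65536 / 2097152" using lh by simp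
    then have "2 * pi * (of_int (lo + hi) / 2097152) \<le> 2 * (16 / 5) * (65536 / 2097152)"
      using pi4 lh by (intro mult_mono) auto
    then show "\<beta> \<le> 1 / 5" unfolding \<beta>_def by simp
  qed
  from near_rotate[OF this b] have "near 11 (2 * pi * (b + of_int (lo + hi) / 2097152)) (sc (cI * bc - sI * bs)) (sc (sI * bc + cI * bs))"
    by (simp add: \<beta>_def algebra_simps add_divide_distrib)
  then have n: "near 11 (2 * pi * (b + of_int (lo + hi) / 2097152)) (sc (bc * cI - bs * sI)) (sc (bs * cI + bc * sI))"
    by (simp add: mult.commute add.commute)
  have k: "k (PAR zc zs E1 E2 Dl eta (sc (eta * eta) + 480)) (sc (bc * cI - bs * sI)) (sc (bs * cI + bc * sI))"
    using c unfolding cell_def cell1_def cell2_def cell3.simps cell4_def A_def[symmetric] eta_def[symmetric] y_def[symmetric] y2_def[symmetric]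
      cI_def[symmetric] sI_def[symmetric] .
  have "\<bar>of_int eta - TT * (2 * pi * (of_int (hi - lo) / 2097152))\<bar> \<le> 51 / 50"
    unfolding eta_def using lh by (intro angle_error) auto
  moreover have "2 * pi * (of_int (hi - lo) / 2097152) \<le> 1 / 8"
  proof -
    have "real_of_int (hi - lo) / 2097152 \<le> 32768 / 2097152" using lh by simp
    then have "2 * pi * (of_int (hi - lo) / 2097152) \<le> 2 * (16 / 5) * (32768 / 2097152)"
      using pi4 lh by (intro mult_mono) auto
    then show ?thesis by simp
  qed
  moreover have "0 \<le> 2 * pi * (of_int (hi - lo) / 2097152)" using lh by simp
  moreover have "\<bar>x\<bar> \<le> 51 / 50 \<Longrightarrow> \<bar>x\<bar> \<le> 2" for x :: real by linarith
  ultimately have "faithful \<alpha> (2 * pi * (of_int (hi - lo) / 2097152)) (PAR zc zs E1 E2 Dl eta (sc (eta * eta) + 480)) (of_int E1 / TT) (of_int E2 / TT)"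
    unfolding faithful_def using z E by blast
  with k n show ?thesis by blast
qed

definition colk :: "nat \<Rightarrow> iv \<Rightarrow> iv \<Rightarrow> par \<Rightarrow> int \<Rightarrow> int \<Rightarrow> bool" where
  "colk N p q g c s = run N g p q c s p q (wedge p q)"

definition cntk :: "nat \<Rightarrow> int \<Rightarrow> iv \<Rightarrow> iv \<Rightarrow> par \<Rightarrow> int \<Rightarrow> int \<Rightarrow> bool" where
  "cntk N m p q g c s = crun N g True m c s p q (wedge p q)"

definition start :: "int \<Rightarrow> int \<Rightarrow> int \<Rightarrow> int \<Rightarrow> bool" where
  "start p1 p2 q1 q2 \<longleftrightarrow> 0 < p1 \<and> 0 < q1 \<and> 1 \<le> p1 * q2 - p2 * q1 \<and> \<bar>p1\<bar> + \<bar>p2\<bar> \<le> BIG \<and> \<bar>q1\<bar> + \<bar>q2\<bar> \<le> BIG"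

lemma cell_column:
  assumes c: "cell (GEO zc zs E1 E2 Dl bc bs) lo hi (colk N (IV p1 p2 0 0) (IV q1 q2 0 0))" and lh: "0 \<le> lo" "lo \<le> hi" "hi \<le> 32768"
    and b: "near 1 (2 * pi * b) bc bs" and z: "near 1 (2 * pi * \<omega>) zc zs" and E: "E1 \<le> E2" "E2 - E1 \<le> Dl * 268435456" "Dl \<le> 8"
    and N: "N \<le> 71" and st: "start p1 p2 q1 q2" and t: "b + of_int lo / 1048576 \<le> t" "t \<le> b + of_int hi / 1048576"
  shows "column \<omega> (of_int E1 / TT) (of_int E2 / TT) (of_int BIG) (of_int p1, of_int p2) (of_int q1, of_int q2) N t"
proof -
  define m where "m = b + of_int (lo + hi) / 2097152"
  define r where "r = real_of_int (hi - lo) / 2097152"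
  have r0: "0 \<le> r" unfolding r_def using lh by simp
  obtain g c s where g: "colk N (IV p1 p2 0 0) (IV q1 q2 0 0) g c s" "faithful (2 * pi * \<omega>) (2 * pi * r) g (of_int E1 / TT) (of_int E2 / TT)"
      "near 11 (2 * pi * m) c s"
    unfolding m_def r_def using cell_sound[OF c lh b z E] by blast
  have "\<exists>PP QQ. PP 0 = IV p1 p2 0 0 \<and> QQ 0 = IV q1 q2 0 0 \<and> chain (2 * pi * \<omega>) (2 * pi * m) (2 * pi * r) (of_int E1 / TT) (of_int E2 / TT) N PP QQ \<and>
     (closes (IV p1 p2 0 0) (IV q1 q2 0 0) (PP N) (QQ N) \<or> closes (ivneg (IV p1 p2 0 0)) (ivneg (IV q1 q2 0 0)) (PP N) (QQ N))"
    using st N by (intro run_sound[OF g(2) g(1)[unfolded colk_def] g(3)]) (auto simp: start_def)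
  then obtain PP QQ where PQ: "PP 0 = IV p1 p2 0 0" "QQ 0 = IV q1 q2 0 0"
    "chain (2 * pi * \<omega>) (2 * pi * m) (2 * pi * r) (of_int E1 / TT) (of_int E2 / TT) N PP QQ"
    "closes (IV p1 p2 0 0) (IV q1 q2 0 0) (PP N) (QQ N) \<or> closes (ivneg (IV p1 p2 0 0)) (ivneg (IV q1 q2 0 0)) (PP N) (QQ N)" by blast
  have tm: "\<bar>t - m\<bar> \<le> r" unfolding m_def r_def using t by (simp add: abs_le_iff field_simps)
  define \<tau> where "\<tau> = (if r = 0 then 0 else (t - m) / r)"
  have \<tau>: "\<bar>\<tau>\<bar> \<le> 1" "t = m + r * \<tau>" using tm r0 by (auto simp: \<tau>_def abs_divide divide_le_eq)
  have "2 * pi * t = 2 * pi * m + 2 * pi * r * \<tau>" unfolding \<tau>(2) by (simp add: algebra_simps)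
  with chain_column[OF PQ(3,1,2) _ _ \<tau>(1)] PQ(4) show ?thesis unfolding PQ(1,2) by blast
qed

lemma cell_count:
  assumes c: "cell (GEO zc zs F1 F2 DF bc bs) lo lo (cntk N m (IV u1 u2 0 0) (IV v1 v2 0 0))" and lh: "0 \<le> lo" "lo \<le> 32768"
    and b: "near 1 (2 * pi * b) bc bs" and z: "near 1 (2 * pi * \<omega>) zc zs" and E: "E1 \<le> F1" "F1 \<le> F2" "F2 \<le> E2" "F2 - F1 \<le> DF * 268435456" "DF \<le> 8"
    and N: "N \<le> 71" and st: "start u1 u2 v1 v2" and pq: "0 \<le> u1 * q2 - u2 * q1" "0 < p1 * u2 - p2 * u1" "0 < p1 * q2 - p2 * q1"
    and t: "of_int lo / 1048576 \<in> {d..e}"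
  shows "\<exists>t\<in>{b + d..b + e}. \<exists>E\<in>{of_int E1 / TT..of_int E2 / TT}. \<exists>u\<in>sector (of_int p1, of_int p2) (of_int q1, of_int q2).
      (\<forall>n\<le>N. fst (orb (\<lambda>n. E - pot (t + real n * \<omega>)) u n) \<noteq> 0) \<and>
      int (changes (\<lambda>n. fst (orb (\<lambda>n. E - pot (t + real n * \<omega>)) u n)) N) = m"
proof -
  define t where "t = b + of_int lo / 1048576"
  have tt: "b + of_int (lo + lo) / 2097152 = t" by (simp add: t_def)
  obtain g c s where g: "cntk N m (IV u1 u2 0 0) (IV v1 v2 0 0) g c s" "faithful (2 * pi * \<omega>) (2 * pi * (of_int (lo - lo) / 2097152)) g (of_int F1 / TT) (of_int F2 / TT)"
      "near 11 (2 * pi * t) c s"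
    using cell_sound[OF c lh(1) order_refl lh(2) b z E(2,4,5)] unfolding tt by auto
  have "\<exists>PP QQ. PP 0 = IV u1 u2 0 0 \<and> QQ 0 = IV v1 v2 0 0 \<and> chain (2 * pi * \<omega>) (2 * pi * t) (2 * pi * (of_int (lo - lo) / 2097152)) (of_int F1 / TT) (of_int F2 / TT) N PP QQ \<and>
     (\<forall>n\<le>N. pure (pos (PP n)) (PP n) (QQ n)) \<and> m = (if True = pos (IV u1 u2 0 0) then 0 else 1) + int (changes (\<lambda>n. sg (PP n)) N)"
    using st N by (intro crun_sound[OF g(2) g(1)[unfolded cntk_def] g(3)]) (auto simp: start_def)
  then obtain PP QQ where PQ: "PP 0 = IV u1 u2 0 0" "chain (2 * pi * \<omega>) (2 * pi * t) (2 * pi * (of_int (lo - lo) / 2097152)) (of_int F1 / TT) (of_int F2 / TT) N PP QQ"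
     "\<forall>n\<le>N. pure (pos (PP n)) (PP n) (QQ n)" "m = (if True = pos (IV u1 u2 0 0) then 0 else 1) + int (changes (\<lambda>n. sg (PP n)) N)" by blast
  have u0: "val (PP 0) 0 = (of_int u1, of_int u2)" by (simp add: PQ(1))
  have m: "m = int (changes (\<lambda>n. sg (PP n)) N)" using PQ(4) st by (simp add: start_def)
  have cnt: "(\<forall>n\<le>N. fst (orb (\<lambda>n. of_int F1 / TT - pot (t + real n * \<omega>)) (of_int u1, of_int u2) n) \<noteq> 0)
    \<and> changes (\<lambda>n. fst (orb (\<lambda>n. of_int F1 / TT - pot (t + real n * \<omega>)) (of_int u1, of_int u2) n)) N = changes (\<lambda>n. sg (PP n)) N"
    using chain_count[OF PQ(2) _ PQ(3), of "of_int F1 / TT"] E(2) unfolding u0 by (simp add: divide_right_mono)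
  have ri: "real_of_int a * of_int b - of_int c * of_int d = of_int (a * b - c * d)" for a b c d by simp
  have w: "0 < area (of_int p1, of_int p2) (of_int q1, of_int q2)" using pq(3) by (simp only: area_def fst_conv snd_conv ri of_int_0_less_iff)
  have "(of_int u1, of_int u2) \<in> sector (of_int p1, of_int p2) (of_int q1, of_int q2)"
    unfolding sector_iff[OF w] area_def fst_conv snd_conv ri using pq by (simp del: of_int_diff of_int_mult)
  moreover have "t \<in> {b + d..b + e}" using t by (simp add: t_def)
  moreover have "of_int F1 / TT \<in> {of_int E1 / TT..of_int E2 / TT}" using E by (simp add: divide_right_mono)
  moreover have "(\<forall>n\<le>N. fst (orb (\<lambda>n. of_int F1 / TT - pot (t + real n * \<omega>)) (of_int u1, of_int u2) n) \<noteq> 0)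
    \<and> int (changes (\<lambda>n. fst (orb (\<lambda>n. of_int F1 / TT - pot (t + real n * \<omega>)) (of_int u1, of_int u2) n)) N) = m"
    unfolding m by (rule conjI[OF conjunct1[OF cnt]]) (simp only: conjunct2[OF cnt])
  ultimately show ?thesis by (intro bexI[of _ t] bexI[of _ "of_int F1 / TT"] bexI[of _ "(of_int u1, of_int u2)"])
qed

fun cover :: "geo \<Rightarrow> (par \<Rightarrow> int \<Rightarrow> int \<Rightarrow> bool) \<Rightarrow> int list \<Rightarrow> bool" where
  "cover G k [] = False"
| "cover G k [lo] = True"
| "cover G k (lo # hi # xs) = (if cell G lo hi k then cover G k (hi # xs) else False)"

lemma cover_column:
  assumes b: "near 1 (2 * pi * b) bc bs" and z: "near 1 (2 * pi * \<omega>) zc zs" and E: "E1 \<le> E2" "E2 - E1 \<le> Dl * 268435456" "Dl \<le> 8"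
    and N: "N \<le> 71" and st: "start p1 p2 q1 q2"
  shows "cover (GEO zc zs E1 E2 Dl bc bs) (colk N (IV p1 p2 0 0) (IV q1 q2 0 0)) (lo # xs) \<Longrightarrow> 0 \<le> lo \<Longrightarrow>
    sorted (lo # xs) \<Longrightarrow> last (lo # xs) \<le> 32768 \<Longrightarrow> b + of_int lo / 1048576 \<le> t \<Longrightarrow> t < b + of_int (last (lo # xs)) / 1048576 \<Longrightarrow>
    column \<omega> (of_int E1 / TT) (of_int E2 / TT) (of_int BIG) (of_int p1, of_int p2) (of_int q1, of_int q2) N t"
proof (induction xs arbitrary: lo)
  case (Cons hi xs)
  have c: "cell (GEO zc zs E1 E2 Dl bc bs) lo hi (colk N (IV p1 p2 0 0) (IV q1 q2 0 0))"
    and r: "cover (GEO zc zs E1 E2 Dl bc bs) (colk N (IV p1 p2 0 0) (IV q1 q2 0 0)) (hi # xs)"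
    using Cons.prems(1) by (auto split: if_splits)
  have "hi \<in> set (hi # xs)" "last (hi # xs) \<in> set (hi # xs)" by (simp, rule last_in_set, simp)
  moreover have "\<forall>x\<in>set (hi # xs). hi \<le> x" using Cons.prems(3) by auto
  ultimately have h: "lo \<le> hi" "hi \<le> last (hi # xs)" using Cons.prems(3) by auto
  show ?case
  proof (cases "t \<le> b + of_int hi / 1048576")
    case True
    then show ?thesis using Cons.prems h by (intro cell_column[OF c _ _ _ b z E N st]) auto
  next
    case False
    show ?thesis
    proof (rule Cons.IH[OF r])
      show "0 \<le> hi" using Cons.prems(2) h by linarith
      show "sorted (hi # xs)" using Cons.prems(3) by simp
      show "last (hi # xs) \<le> 32768" using Cons.prems(4) by simp
      show "b + of_int hi / 1048576 \<le> t" using False by simp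
      show "t < b + of_int (last (hi # xs)) / 1048576" using Cons.prems(6) by simp
    qed
  qed
qed simp

section \<open>The rotation number\<close>

text \<open>Multiplying e by n! leaves the fractional remainder exp t / (n + 1), which lies strictly between 0 and 1 for n > 2.\<close>

lemma e_irrational: "exp 1 \<notin> (\<rat> :: real set)"
proof
  assume "exp 1 \<in> (\<rat> :: real set)"
  then obtain a d where d: "0 < d" "exp 1 = real_of_int a / of_int d" by (elim Rats_cases')
  define n where "n = nat d + 3"
  obtain t :: real where t: "\<bar>t\<bar> < 1" "exp 1 = (\<Sum>m<Suc n. 1 ^ m / fact m) + exp t / fact (Suc n) * 1 ^ Suc n"
    using Maclaurin_exp_lt[of 1 "Suc n"] by auto
  have "fact n * exp 1 = (\<Sum>m<Suc n. fact n / fact m) + exp t / (real n + 1)"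
  proof -
    have "fact n * (\<Sum>m<Suc n. 1 ^ m / fact m) = (\<Sum>m<Suc n. fact n / fact m :: real)"
      by (simp only: sum_distrib_left power_one times_divide_eq_right mult_1_right)
    moreover have "fact n * (exp t / fact (Suc n) * 1 ^ Suc n) = exp t / (real n + 1)"
    proof -
      have c: "F * (x / (G * F) * 1 ^ k) = x / G" if "F \<noteq> 0" for F G x :: real and k :: nat using that by simp
      have "(fact (Suc n) :: real) = (real n + 1) * fact n" by (simp add: algebra_simps)
      then show ?thesis using c[of "fact n"] by simp
    qed
    ultimately show ?thesis unfolding t(2) distrib_left by (simp only:)
  qed
  moreover have "(\<Sum>m<Suc n. fact n / fact m) \<in> (\<int> :: real set)"
  proof (intro Ints_sum)
    fix m assume "m \<in> {..<Suc n}"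
    then have "(fact m :: int) dvd fact n" by (intro fact_dvd) auto
    then obtain j where j: "(fact n :: int) = fact m * j" by (elim dvdE)
    have "(fact n :: real) = fact m * of_int j" using arg_cong[OF j, of real_of_int] by (simp only: of_int_mult of_int_fact)
    then show "fact n / fact m \<in> (\<int> :: real set)" by simp
  qed
  moreover have "fact n * exp 1 \<in> (\<int> :: real set)"
  proof -
    have "nat d dvd fact n" using d(1) by (intro dvd_fact) (auto simp: n_def)
    then have "int (nat d) dvd int (fact n)" by (simp only: int_dvd_int_iff)
    then have "d dvd fact n" using d(1) by (simp add: of_nat_fact)
    then obtain j where j: "(fact n :: int) = d * j" by (elim dvdE)
    have "(fact n :: real) = of_int d * of_int j" using arg_cong[OF j, of real_of_int] by (simp only: of_int_mult of_int_fact)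
    then have "fact n * exp 1 = real_of_int (j * a)" using d by simp
    then show ?thesis by (metis Ints_of_int)
  qed
  ultimately have "exp t / (real n + 1) \<in> \<int>" by (metis Ints_diff add_diff_cancel_left')
  then obtain j where j: "exp t / (real n + 1) = of_int j" by (elim Ints_cases)
  have "exp t < exp 1" using t(1) by simp
  then have "exp t < 3" using exp_le by linarith
  then have "exp t / (real n + 1) < 1" by (simp add: n_def)
  moreover have "0 < exp t / (real n + 1)" by simp
  ultimately show False unfolding j by simp
qed

lemma e_bounds: "271828182845 / 100000000000 \<le> exp (1::real)" "exp (1::real) \<le> 271828182850 / 100000000000"
proof -
  have "\<bar>exp 1 - 888656868019 / 326918592000\<bar> * 1307674368000 \<le> exp (1 :: real)"
    using Taylor_exp[of 1 15]
    by (simp add: sum_distrib_right in_Reals_norm Re_exp atMost_nat_numeral fact_numeral)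
  then have "\<bar>exp 1 - 888656868019 / 326918592000\<bar> \<le> (3 / 1307674368000 :: real)" using exp_le by simp
  then have "888656868019 / 326918592000 - 3 / 1307674368000 \<le> exp (1::real)" "exp (1::real) \<le> 888656868019 / 326918592000 + 3 / 1307674368000"
    by (simp_all only: abs_le_iff) linarith+
  moreover have "271828182845 / 100000000000 \<le> (888656868019 / 326918592000 - 3 / 1307674368000 :: real)"
    "888656868019 / 326918592000 + 3 / 1307674368000 \<le> (271828182850 / 100000000000 :: real)" by simp_all
  ultimately show "271828182845 / 100000000000 \<le> exp (1::real)" "exp (1::real) \<le> 271828182850 / 100000000000" by linarith+
qed

text \<open>With y = 2 pi (11/4 - e), about 0.2, the angle is 3 pi / 2 - y, so that short Taylor polynomials suffice. The two
coordinates err by about 0.33 and 0.44 from rounding; the enclosure of y adds less than 0.2.\<close>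

lemma rotation_near: "near 1 (2 * pi * (exp 1 - 2)) (- 53143391) (- 263122356)"
proof -
  define y where "y = 2 * pi * (11 / 4 - exp 1)"
  have l: "19929114909 / 100000000000 \<le> y"
  proof -
    have "2 * (3141592653588 / 1000000000000) * (11 / 4 - 271828182850 / 100000000000) \<le> y"
      unfolding y_def using pi_approx e_bounds by (intro mult_mono) auto
    then show ?thesis by simp
  qed
  have u: "y \<le> 19929114972 / 100000000000"
  proof -
    have "y \<le> 2 * (31415926535899 / 10000000000000) * (11 / 4 - 271828182845 / 100000000000)"
      unfolding y_def using pi_approx e_bounds pi_gt_zero by (intro mult_mono) auto
    then show ?thesis by simp
  qed
  have y0: "0 \<le> y" using l by simp
  have pl: "(19929114909 / 100000000000) ^ n \<le> y ^ n" "y ^ n \<le> (19929114972 / 100000000000) ^ n" for n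
    using power_mono[OF l] power_mono[OF u y0] by simp_all
  have lo2: "397169621056126 / 10000000000000000 \<le> y ^ 2" by (rule order_trans[OF _ pl(1)[of 2]]) (simp add: power_divide)
  have lo3: "79152390163915 / 10000000000000000 \<le> y ^ 3" by (rule order_trans[OF _ pl(1)[of 3]]) (simp add: power_divide)
  have lo4: "15774370788986 / 10000000000000000 \<le> y ^ 4" by (rule order_trans[OF _ pl(1)[of 4]]) (simp add: power_divide)
  have lo5: "3143692480708 / 10000000000000000 \<le> y ^ 5" by (rule order_trans[OF _ pl(1)[of 5]]) (simp add: power_divide)
  have lo6: "626510086866 / 10000000000000000 \<le> y ^ 6" by (rule order_trans[OF _ pl(1)[of 6]]) (simp add: power_divide)
  have lo7: "124857915128 / 10000000000000000 \<le> y ^ 7" by (rule order_trans[OF _ pl(1)[of 7]]) (simp add: power_divide)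
  have up2: "y ^ 2 \<le> 397169623567195 / 10000000000000000" by (rule order_trans[OF pl(2)[of 2]]) (simp add: power_divide)
  have up3: "y ^ 3 \<le> 79152390914566 / 10000000000000000" by (rule order_trans[OF pl(2)[of 3]]) (simp add: power_divide)
  have up4: "y ^ 4 \<le> 15774370988451 / 10000000000000000" by (rule order_trans[OF pl(2)[of 4]]) (simp add: power_divide)
  have up5: "y ^ 5 \<le> 3143692530399 / 10000000000000000" by (rule order_trans[OF pl(2)[of 5]]) (simp add: power_divide)
  have up6: "y ^ 6 \<le> 626510098750 / 10000000000000000" by (rule order_trans[OF pl(2)[of 6]]) (simp add: power_divide)
  have up7: "y ^ 7 \<le> 124857917891 / 10000000000000000" by (rule order_trans[OF pl(2)[of 7]]) (simp add: power_divide)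
  have up8: "y ^ 8 \<le> 24883078009 / 10000000000000000" by (rule order_trans[OF pl(2)[of 8]]) (simp add: power_divide)
  have up9: "y ^ 9 \<le> 4958977225 / 10000000000000000" by (rule order_trans[OF pl(2)[of 9]]) (simp add: power_divide)
  have ay: "\<bar>y\<bar> = y" using y0 by simp
  have "\<bar>TT * cos y - 263122356\<bar> \<le> 6 / 10"
    using cos_taylor[of y] lo2 lo4 lo6 up2 up4 up6 up8 unfolding ay abs_le_iff by linarith
  moreover have "\<bar>TT * sin y - 53143391\<bar> \<le> 6 / 10"
    using sin_taylor[of y] l u lo3 lo5 lo7 up3 up5 up7 up9 unfolding ay abs_le_iff by linarith
  ultimately have c: "\<bar>TT * cos y - 263122356\<bar> \<le> 6 / 10" and s: "\<bar>TT * sin y - 53143391\<bar> \<le> 6 / 10" .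
  have arg: "2 * pi * (exp 1 - 2) = (pi - (y - pi / 2))" by (simp add: y_def field_simps)
  have "cos (2 * pi * (exp 1 - 2)) = - sin y" "sin (2 * pi * (exp 1 - 2)) = - cos y"
    unfolding arg cos_diff sin_diff by simp_all
  then have "(cmod (Complex (of_int (- 53143391)) (of_int (- 263122356)) - of_real TT * cis (2 * pi * (exp 1 - 2))))\<^sup>2
      = \<bar>TT * sin y - 53143391\<bar>\<^sup>2 + \<bar>TT * cos y - 263122356\<bar>\<^sup>2"
    by (simp add: cmod_power2)
  also have "\<dots> \<le> (6 / 10)\<^sup>2 + (6 / 10)\<^sup>2" using c s by (intro add_mono power_mono) auto
  also have "\<dots> \<le> 1\<^sup>2" by (simp add: power2_eq_square)
  finally show ?thesis unfolding near_def by (rule power2_le_imp_le) simp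
qed

text \<open>The base phase is not a given number but the argument of an integer vector, so that its cosine and sine need no
approximation; any vector of length nearly 2^28 will do.\<close>

lemma phase_exists:
  assumes "72057593501057025 \<le> bc\<^sup>2 + bs\<^sup>2" "bc\<^sup>2 + bs\<^sup>2 \<le> 72057594574798849"
  shows "\<exists>b. near 1 (2 * pi * b) bc bs"
proof -
  define z where "z = Complex (of_int bc) (of_int bs)"
  define r where "r = cmod z"
  define c where "c = cis (2 * pi * (Arg z / (2 * pi)))"
  have r2: "r\<^sup>2 = of_int (bc\<^sup>2 + bs\<^sup>2)" by (simp add: r_def z_def cmod_power2)
  have "real_of_int 72057593501057025 \<le> of_int (bc\<^sup>2 + bs\<^sup>2)" "of_int (bc\<^sup>2 + bs\<^sup>2) \<le> real_of_int 72057594574798849"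
    using assms by (simp_all only: of_int_le_iff)
  then have sq: "(TT - 1)\<^sup>2 \<le> r\<^sup>2" "r\<^sup>2 \<le> (TT + 1)\<^sup>2" unfolding r2 by (simp_all add: power2_eq_square)
  have "0 \<le> r" by (simp add: r_def)
  then have "TT - 1 \<le> r" "r \<le> TT + 1" by (rule power2_le_imp_le[OF sq(1)], intro power2_le_imp_le[OF sq(2)]) simp
  then have r: "\<bar>r - TT\<bar> \<le> 1" by linarith
  have z: "z = of_real r * c"
    using rcis_cmod_Arg[of z] by (simp add: rcis_def r_def c_def)
  have "z - of_real TT * c = of_real (r - TT) * c" unfolding z by (simp add: left_diff_distrib)
  then have "cmod (z - of_real TT * c) = \<bar>r - TT\<bar>"
    by (simp only: norm_mult norm_of_real c_def norm_cis mult_1_right)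
  with r have "cmod (z - of_real TT * c) \<le> 1" by (simp only:)
  then show ?thesis unfolding near_def z_def[symmetric] c_def by (intro exI[of _ "Arg z / (2 * pi)"])
qed

section \<open>Towers from certificates\<close>

lemma tower_certificate:
  assumes b: "near 1 (2 * pi * b) bc bs" and z: "near 1 (2 * pi * \<omega>) zc zs" and irr: "\<omega> \<notin> \<rat>"
    and E: "E1 \<le> E2" "E2 - E1 \<le> Dl * 268435456" "Dl \<le> 8" and st: "start p1 p2 q1 q2"
    and N: "0 < N1" "N1 \<le> 71" "0 < N2" "N2 \<le> 71"
    and d: "real N1 * \<omega> = of_int z1 + d1" "real N2 * \<omega> = of_int z2 - d2" "0 < d1" "0 < d2"
    and c1: "cover (GEO zc zs E1 E2 Dl bc bs) (colk N1 (IV p1 p2 0 0) (IV q1 q2 0 0)) (0 # xs)" "sorted (0 # xs)" "last (0 # xs) \<le> 32768"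
      "d2 * 1048576 < of_int (last (0 # xs))"
    and c2: "cover (GEO zc zs E1 E2 Dl bc bs) (colk N2 (IV p1 p2 0 0) (IV q1 q2 0 0)) (lo # ys)" "sorted (lo # ys)" "last (lo # ys) \<le> 32768"
      "0 \<le> lo" "of_int lo \<le> d2 * 1048576" "(d2 + d1) * 1048576 < of_int (last (lo # ys))"
  shows "tower \<omega> (of_int E1 / TT) (of_int E2 / TT) (of_int BIG) b d1 d2 (of_int p1, of_int p2) (of_int q1, of_int q2) N1 N2 z1 z2"
proof
  show "1 \<le> real_of_int BIG" by (simp add: BIG_def)
  show "column \<omega> (of_int E1 / TT) (of_int E2 / TT) (of_int BIG) (of_int p1, of_int p2) (of_int q1, of_int q2) N1 t"
    if "t \<in> {b..b + d2}" for t
    using that c1(4) by (intro cover_column[OF b z E N(2) st c1(1) order_refl c1(2,3)]) auto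
  show "column \<omega> (of_int E1 / TT) (of_int E2 / TT) (of_int BIG) (of_int p1, of_int p2) (of_int q1, of_int q2) N2 t"
    if "t \<in> {b + d2..b + d2 + d1}" for t
  proof (rule cover_column[OF b z E N(4) st c2(1,4,2,3)])
    show "b + of_int lo / 1048576 \<le> t" using that c2(5) by simp
    have "d2 + d1 < of_int (last (lo # ys)) / 1048576" using c2(6) by (simp add: pos_less_divide_eq)
    then show "t < b + of_int (last (lo # ys)) / 1048576" using that by auto
  qed
qed (use irr d N st in \<open>simp_all add: start_def\<close>)

lemma omega_irrational: "exp 1 - 2 \<notin> (\<rat> :: real set)"
proof
  assume "exp 1 - 2 \<in> (\<rat> :: real set)"
  then have "exp 1 - 2 + 2 \<in> (\<rat> :: real set)" by (rule Rats_add) simp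
  then show False using e_irrational by simp
qed

text \<open>A narrow cone at the phase lo, for a part of the energy range: signs of first coordinates need only be constant along
it, since all orbits of a column have the same number of changes.\<close>

definition witness :: "int \<Rightarrow> int \<Rightarrow> int \<Rightarrow> int \<Rightarrow> int \<Rightarrow> int \<Rightarrow> int \<Rightarrow> int \<Rightarrow> int \<Rightarrow> int \<Rightarrow> int \<Rightarrow> int \<Rightarrow> int \<Rightarrow> int \<Rightarrow> bool" where
  "witness E1 E2 p1 p2 q1 q2 F1 F2 DF u1 u2 v1 v2 lo \<longleftrightarrow> E1 \<le> F1 \<and> F1 \<le> F2 \<and> F2 \<le> E2 \<and> F2 - F1 \<le> DF * 268435456 \<and> DF \<le> 8 \<and>
     start u1 u2 v1 v2 \<and> 0 \<le> u1 * q2 - u2 * q1 \<and> 0 < p1 * u2 - p2 * u1 \<and> 0 \<le> lo \<and> lo \<le> 32768"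

lemma counted_certificate:
  assumes T: "tower \<omega> (of_int E1 / TT) (of_int E2 / TT) (of_int BIG) b d1 d2 (of_int p1, of_int p2) (of_int q1, of_int q2) N1 N2 z1 z2"
    and b: "near 1 (2 * pi * b) bc bs" and z: "near 1 (2 * pi * \<omega>) zc zs" and N: "N1 \<le> 71" "N2 \<le> 71" and pq: "0 < p1 * q2 - p2 * q1"
    and c1: "cell (GEO zc zs F1 F2 DF bc bs) lo lo (cntk N1 m (IV u1 u2 0 0) (IV v1 v2 0 0))"
      "witness E1 E2 p1 p2 q1 q2 F1 F2 DF u1 u2 v1 v2 lo" "kap * int N1 - k * z1 = m" "0 \<le> of_int lo / (1048576 :: real)" "of_int lo / 1048576 \<le> d2"
    and c2: "cell (GEO zc zs F1' F2' DF' bc bs) lo' lo' (cntk N2 m' (IV u1' u2' 0 0) (IV v1' v2' 0 0))"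
      "witness E1 E2 p1 p2 q1 q2 F1' F2' DF' u1' u2' v1' v2' lo'" "kap * int N2 - k * z2 = m'" "d2 \<le> of_int lo' / 1048576" "of_int lo' / 1048576 \<le> d2 + d1"
  shows "counted_tower \<omega> (of_int E1 / TT) (of_int E2 / TT) (of_int BIG) b d1 d2 (of_int p1, of_int p2) (of_int q1, of_int q2) N1 N2 z1 z2 kap k"
proof (rule counted_tower.intro[OF T counted_tower_axioms.intro])
  note w1 = c1(2)[unfolded witness_def] and w2 = c2(2)[unfolded witness_def]
  have "of_int lo / 1048576 \<in> {0..d2}" using c1(4,5) by simp
  from cell_count[OF c1(1) _ _ b z _ _ _ _ _ N(1) _ _ _ pq this] w1
  show "\<exists>t\<in>{b..b + d2}. \<exists>E\<in>{of_int E1 / TT..of_int E2 / TT}. \<exists>u\<in>sector (of_int p1, of_int p2) (of_int q1, of_int q2).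
      (\<forall>n\<le>N1. fst (orb (\<lambda>n. E - pot (t + real n * \<omega>)) u n) \<noteq> 0) \<and>
      int (changes (\<lambda>n. fst (orb (\<lambda>n. E - pot (t + real n * \<omega>)) u n)) N1) = kap * int N1 - k * z1"
    unfolding c1(3) add_0_right by blast
  have "of_int lo' / 1048576 \<in> {d2..d2 + d1}" using c2(4,5) by simp
  from cell_count[OF c2(1) _ _ b z _ _ _ _ _ N(2) _ _ _ pq this] w2
  show "\<exists>t\<in>{b + d2..b + d2 + d1}. \<exists>E\<in>{of_int E1 / TT..of_int E2 / TT}. \<exists>u\<in>sector (of_int p1, of_int p2) (of_int q1, of_int q2).
      (\<forall>n\<le>N2. fst (orb (\<lambda>n. E - pot (t + real n * \<omega>)) u n) \<noteq> 0) \<and>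
      int (changes (\<lambda>n. fst (orb (\<lambda>n. E - pot (t + real n * \<omega>)) u n)) N2) = kap * int N2 - k * z2"
    unfolding c2(3) add.assoc by blast
qed

section \<open>Certificates\<close>

lemma run_numeral: "run (numeral n) g p q c s P Q W = step g c s P Q W (run (pred_numeral n) g p q)"
  "crun (numeral n) g b m c s P Q W = (if pure (pos P) P Q then step g c s P Q W (crun (pred_numeral n) g (pos P) (dec b (pos P) m)) else False)"
  by (simp_all add: numeral_eq_Suc)

text \<open>Rewriting stays on binary numerals throughout; the numeral 1 is always represented by its binary form, so that the
rules for halving apply to it.\<close>

lemmas numeric_rules = arith_simps rel_simps pred_numeral_simps half_simps if_True if_False simp_thms
  abs_numeral abs_neg_numeral abs_zero abs_one abs_neg_one diff_0 diff_0_right add_0_left add_0_right mult_zero_left mult_zero_right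
  mult_1_left mult_1_right minus_zero minus_minus numeral_One[symmetric]

lemmas checker_rules = numeric_rules sc_half sneg.simps bend.simps slack.simps nxt0_def nxt.simps nrm.simps wedge.simps
  st5_def st4_def st3_def st2_def st1_def step.simps ivneg.simps closes_def pos.simps pure.simps dec_def run.simps(1) crun.simps(1) run_numeral
  cell4_def cell3.simps cell2_def cell1_def cell_def colk_def cntk_def

abbreviation "gap1_geo \<equiv> GEO (- 53143391) (- 263122356) 215134240 666588152 2 82951118 255297290"
abbreviation "gap1_p \<equiv> IV 16325 1394 0 0"
abbreviation "gap1_q \<equiv> IV 13506 9275 0 0"

lemma gap1_cells_1_1:
  "cell gap1_geo 0 3927 (colk 39 gap1_p gap1_q)"
  "cell gap1_geo 3927 7855 (colk 39 gap1_p gap1_q)"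
  "cell gap1_geo 7855 11782 (colk 39 gap1_p gap1_q)"
  "cell gap1_geo 11782 15710 (colk 39 gap1_p gap1_q)"
  by (simp_all only: checker_rules cong: if_weak_cong)

lemma gap1_cells_2_1:
  "cell gap1_geo 15709 19114 (colk 32 gap1_p gap1_q)"
  "cell gap1_geo 19114 22520 (colk 32 gap1_p gap1_q)"
  "cell gap1_geo 22520 25926 (colk 32 gap1_p gap1_q)"
  "cell gap1_geo 25926 29332 (colk 32 gap1_p gap1_q)"
  by (simp_all only: checker_rules cong: if_weak_cong)

lemma gap1_cover_1: "cover gap1_geo (colk 39 gap1_p gap1_q) [0, 3927, 7855, 11782, 15710]"
  by (simp only: cover.simps if_True gap1_cells_1_1)

lemma gap1_cover_2: "cover gap1_geo (colk 32 gap1_p gap1_q) [15709, 19114, 22520, 25926, 29332]"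
  by (simp only: cover.simps if_True gap1_cells_2_1)

lemma gap1_tower:
  assumes b: "near 1 (2 * pi * b) 82951118 255297290"
  shows "tower (exp 1 - 2) (of_int 215134240 / TT) (of_int 666588152 / TT) (of_int BIG) b (39 * (exp 1 - 2) - 28) (23 - 32 * (exp 1 - 2))
     (of_int 16325, of_int 1394) (of_int 13506, of_int 9275) 39 32 28 23"
  by (rule tower_certificate[OF b rotation_near omega_irrational _ _ _ _ _ _ _ _ _ _ _ _ gap1_cover_1 _ _ _ gap1_cover_2])
    (use e_bounds in \<open>simp_all add: start_def BIG_def\<close>)

lemma gap1_count_1: "cell (GEO (- 53143391) (- 263122356) 327997718 373143108 1 82951118 255297290) 785 785 (cntk 39 11 (IV 15273984 5462016 0 0) (IV 14792704 6807552 0 0))"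
  by (simp_all only: checker_rules cong: if_weak_cong)

lemma gap1_count_2: "cell (GEO (- 53143391) (- 263122356) 226420587 339284065 1 82951118 255297290) 16391 16391 (cntk 32 9 (IV 15273984 5462016 0 0) (IV 15129600 5866496 0 0))"
  by (simp_all only: checker_rules cong: if_weak_cong)

lemma gap1_counted: "\<exists>b. counted_tower (exp 1 - 2) (of_int 215134240 / TT) (of_int 666588152 / TT) (of_int BIG) b (39 * (exp 1 - 2) - 28) (23 - 32 * (exp 1 - 2))
     (of_int 16325, of_int 1394) (of_int 13506, of_int 9275) 39 32 28 23 1 1"
proof -
  obtain b where b: "near 1 (2 * pi * b) 82951118 255297290" using phase_exists[of "82951118" "255297290"] by auto
  show ?thesis
    by (rule exI, rule counted_certificate[OF gap1_tower[OF b] b rotation_near _ _ _ gap1_count_1 _ _ _ _ gap1_count_2])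
      (use e_bounds in \<open>simp_all add: witness_def start_def BIG_def\<close>)
qed

abbreviation "gap2_geo \<equiv> GEO (- 53143391) (- 263122356) 25981196 158217536 1 (- 226670660) 143798492"
abbreviation "gap2_p \<equiv> IV 3710530 (- 1955544) 0 0"
abbreviation "gap2_q \<equiv> IV 1739216 3816715 0 0"

lemma gap2_cells_1_1:
  "cell gap2_geo 0 1043 (colk 39 gap2_p gap2_q)"
  "cell gap2_geo 1043 1565 (colk 39 gap2_p gap2_q)"
  "cell gap2_geo 1565 2087 (colk 39 gap2_p gap2_q)"
  by (simp_all only: checker_rules cong: if_weak_cong)

lemma gap2_cells_2_1:
  "cell gap2_geo 2086 2298 (colk 71 gap2_p gap2_q)"
  "cell gap2_geo 2298 2511 (colk 71 gap2_p gap2_q)"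
  "cell gap2_geo 2511 2937 (colk 71 gap2_p gap2_q)"
  "cell gap2_geo 2937 3363 (colk 71 gap2_p gap2_q)"
  by (simp_all only: checker_rules cong: if_weak_cong)

lemma gap2_cells_2_2:
  "cell gap2_geo 3363 3789 (colk 71 gap2_p gap2_q)"
  "cell gap2_geo 3789 4214 (colk 71 gap2_p gap2_q)"
  "cell gap2_geo 4214 4640 (colk 71 gap2_p gap2_q)"
  "cell gap2_geo 4640 4853 (colk 71 gap2_p gap2_q)"
  by (simp_all only: checker_rules cong: if_weak_cong)

lemma gap2_cells_2_3:
  "cell gap2_geo 4853 5066 (colk 71 gap2_p gap2_q)"
  "cell gap2_geo 5066 5279 (colk 71 gap2_p gap2_q)"
  "cell gap2_geo 5279 5492 (colk 71 gap2_p gap2_q)"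
  "cell gap2_geo 5492 5704 (colk 71 gap2_p gap2_q)"
  by (simp_all only: checker_rules cong: if_weak_cong)

lemma gap2_cells_2_4:
  "cell gap2_geo 5704 5810 (colk 71 gap2_p gap2_q)"
  "cell gap2_geo 5810 5917 (colk 71 gap2_p gap2_q)"
  "cell gap2_geo 5917 6023 (colk 71 gap2_p gap2_q)"
  "cell gap2_geo 6023 6130 (colk 71 gap2_p gap2_q)"
  by (simp_all only: checker_rules cong: if_weak_cong)

lemma gap2_cells_2_5:
  "cell gap2_geo 6130 6236 (colk 71 gap2_p gap2_q)"
  "cell gap2_geo 6236 6343 (colk 71 gap2_p gap2_q)"
  "cell gap2_geo 6343 6449 (colk 71 gap2_p gap2_q)"
  "cell gap2_geo 6449 6556 (colk 71 gap2_p gap2_q)"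
  by (simp_all only: checker_rules cong: if_weak_cong)

lemma gap2_cells_2_6:
  "cell gap2_geo 6556 6769 (colk 71 gap2_p gap2_q)"
  "cell gap2_geo 6769 6982 (colk 71 gap2_p gap2_q)"
  "cell gap2_geo 6982 7195 (colk 71 gap2_p gap2_q)"
  "cell gap2_geo 7195 7620 (colk 71 gap2_p gap2_q)"
  by (simp_all only: checker_rules cong: if_weak_cong)

lemma gap2_cells_2_7:
  "cell gap2_geo 7620 8046 (colk 71 gap2_p gap2_q)"
  "cell gap2_geo 8046 8472 (colk 71 gap2_p gap2_q)"
  "cell gap2_geo 8472 8898 (colk 71 gap2_p gap2_q)"
  "cell gap2_geo 8898 9749 (colk 71 gap2_p gap2_q)"
  by (simp_all only: checker_rules cong: if_weak_cong)

lemma gap2_cells_2_8: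
  "cell gap2_geo 9749 10601 (colk 71 gap2_p gap2_q)"
  "cell gap2_geo 10601 11452 (colk 71 gap2_p gap2_q)"
  "cell gap2_geo 11452 12304 (colk 71 gap2_p gap2_q)"
  "cell gap2_geo 12304 13155 (colk 71 gap2_p gap2_q)"
  by (simp_all only: checker_rules cong: if_weak_cong)

lemma gap2_cells_2_9:
  "cell gap2_geo 13155 14007 (colk 71 gap2_p gap2_q)"
  "cell gap2_geo 14007 14858 (colk 71 gap2_p gap2_q)"
  "cell gap2_geo 14858 15710 (colk 71 gap2_p gap2_q)"
  by (simp_all only: checker_rules cong: if_weak_cong)

lemma gap2_cover_1: "cover gap2_geo (colk 39 gap2_p gap2_q) [0, 1043, 1565, 2087]"
  by (simp only: cover.simps if_True gap2_cells_1_1)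

lemma gap2_cover_2: "cover gap2_geo (colk 71 gap2_p gap2_q) [2086, 2298, 2511, 2937, 3363, 3789, 4214, 4640, 4853, 5066, 5279, 5492, 5704, 5810, 5917, 6023, 6130, 6236, 6343, 6449, 6556, 6769, 6982, 7195, 7620, 8046, 8472, 8898, 9749, 10601, 11452, 12304, 13155, 14007, 14858, 15710]"
  by (simp only: cover.simps if_True gap2_cells_2_1 gap2_cells_2_2 gap2_cells_2_3 gap2_cells_2_4 gap2_cells_2_5 gap2_cells_2_6 gap2_cells_2_7 gap2_cells_2_8 gap2_cells_2_9)

lemma gap2_tower:
  assumes b: "near 1 (2 * pi * b) (- 226670660) 143798492"
  shows "tower (exp 1 - 2) (of_int 25981196 / TT) (of_int 158217536 / TT) (of_int BIG) b (39 * (exp 1 - 2) - 28) (51 - 71 * (exp 1 - 2))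
     (of_int 3710530, of_int (- 1955544)) (of_int 1739216, of_int 3816715) 39 71 28 51"
  by (rule tower_certificate[OF b rotation_near omega_irrational _ _ _ _ _ _ _ _ _ _ _ _ gap2_cover_1 _ _ _ gap2_cover_2])
    (use e_bounds in \<open>simp_all add: start_def BIG_def\<close>)

lemma gap2_count_1: "cell (GEO (- 53143391) (- 263122356) 72263915 85487549 1 (- 226670660) 143798492) 104 104 (cntk 39 17 (IV 2790269952 952920064 0 0) (IV 2453832704 1938052096 0 0))"
  by (simp_all only: checker_rules cong: if_weak_cong)

lemma gap2_count_2: "cell (GEO (- 53143391) (- 263122356) 85487549 98711183 1 (- 226670660) 143798492) 6854 6854 (cntk 71 31 (IV 2790269952 952920064 0 0) (IV 2453832704 1938052096 0 0))"
  by (simp_all only: checker_rules cong: if_weak_cong)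

lemma gap2_counted: "\<exists>b. counted_tower (exp 1 - 2) (of_int 25981196 / TT) (of_int 158217536 / TT) (of_int BIG) b (39 * (exp 1 - 2) - 28) (51 - 71 * (exp 1 - 2))
     (of_int 3710530, of_int (- 1955544)) (of_int 1739216, of_int 3816715) 39 71 28 51 (- 1) (- 2)"
proof -
  obtain b where b: "near 1 (2 * pi * b) (- 226670660) 143798492" using phase_exists[of "(- 226670660)" "143798492"] by auto
  show ?thesis
    by (rule exI, rule counted_certificate[OF gap2_tower[OF b] b rotation_near _ _ _ gap2_count_1 _ _ _ _ gap2_count_2])
      (use e_bounds in \<open>simp_all add: witness_def start_def BIG_def\<close>)
qed

abbreviation "gap3_geo \<equiv> GEO (- 53143391) (- 263122356) 686272020 701728031 1 263680726 50299789"
abbreviation "gap3_p \<equiv> IV 15666 4796 0 0"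
abbreviation "gap3_q \<equiv> IV 791 16365 0 0"

lemma gap3_cells_1_1:
  "cell gap3_geo 0 7855 (colk 39 gap3_p gap3_q)"
  "cell gap3_geo 7855 11782 (colk 39 gap3_p gap3_q)"
  "cell gap3_geo 11782 15710 (colk 39 gap3_p gap3_q)"
  by (simp_all only: checker_rules cong: if_weak_cong)

lemma gap3_cells_2_1:
  "cell gap3_geo 15709 19114 (colk 32 gap3_p gap3_q)"
  "cell gap3_geo 19114 22520 (colk 32 gap3_p gap3_q)"
  "cell gap3_geo 22520 25926 (colk 32 gap3_p gap3_q)"
  "cell gap3_geo 25926 29332 (colk 32 gap3_p gap3_q)"
  by (simp_all only: checker_rules cong: if_weak_cong)

lemma gap3_cover_1: "cover gap3_geo (colk 39 gap3_p gap3_q) [0, 7855, 11782, 15710]"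
  by (simp only: cover.simps if_True gap3_cells_1_1)

lemma gap3_cover_2: "cover gap3_geo (colk 32 gap3_p gap3_q) [15709, 19114, 22520, 25926, 29332]"
  by (simp only: cover.simps if_True gap3_cells_2_1)

lemma gap3_tower:
  assumes b: "near 1 (2 * pi * b) 263680726 50299789"
  shows "tower (exp 1 - 2) (of_int 686272020 / TT) (of_int 701728031 / TT) (of_int BIG) b (39 * (exp 1 - 2) - 28) (23 - 32 * (exp 1 - 2))
     (of_int 15666, of_int 4796) (of_int 791, of_int 16365) 39 32 28 23"
  by (rule tower_certificate[OF b rotation_near omega_irrational _ _ _ _ _ _ _ _ _ _ _ _ gap3_cover_1 _ _ _ gap3_cover_2])
    (use e_bounds in \<open>simp_all add: start_def BIG_def\<close>)

lemma gap3_count_1: "cell (GEO (- 53143391) (- 263122356) 692068024 695932026 1 263680726 50299789) 785 785 (cntk 39 6 (IV 8425472 10833920 0 0) (IV 5886976 12809216 0 0))"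
  by (simp_all only: checker_rules cong: if_weak_cong)

lemma gap3_count_2: "cell (GEO (- 53143391) (- 263122356) 690136023 697864027 1 263680726 50299789) 26606 26606 (cntk 32 5 (IV 2332672 15572992 0 0) (IV 1825792 15968256 0 0))"
  by (simp_all only: checker_rules cong: if_weak_cong)

lemma gap3_counted: "\<exists>b. counted_tower (exp 1 - 2) (of_int 686272020 / TT) (of_int 701728031 / TT) (of_int BIG) b (39 * (exp 1 - 2) - 28) (23 - 32 * (exp 1 - 2))
     (of_int 15666, of_int 4796) (of_int 791, of_int 16365) 39 32 28 23 (- 2) (- 3)"
proof -
  obtain b where b: "near 1 (2 * pi * b) 263680726 50299789" using phase_exists[of "263680726" "50299789"] by auto
  show ?thesis
    by (rule exI, rule counted_certificate[OF gap3_tower[OF b] b rotation_near _ _ _ gap3_count_1 _ _ _ _ gap3_count_2])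
      (use e_bounds in \<open>simp_all add: witness_def start_def BIG_def\<close>)
qed

abbreviation "gap4_geo \<equiv> GEO (- 53143391) (- 263122356) 707197403 713270756 1 263680726 50299789"
abbreviation "gap4_p \<equiv> IV 15762 4473 0 0"
abbreviation "gap4_q \<equiv> IV 15471 5394 0 0"

lemma gap4_cells_1_1:
  "cell gap4_geo 0 3927 (colk 39 gap4_p gap4_q)"
  "cell gap4_geo 3927 5891 (colk 39 gap4_p gap4_q)"
  "cell gap4_geo 5891 7855 (colk 39 gap4_p gap4_q)"
  "cell gap4_geo 7855 11782 (colk 39 gap4_p gap4_q)"
  by (simp_all only: checker_rules cong: if_weak_cong)

lemma gap4_cells_1_2:
  "cell gap4_geo 11782 15710 (colk 39 gap4_p gap4_q)"
  by (simp_all only: checker_rules cong: if_weak_cong)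

lemma gap4_cells_2_1:
  "cell gap4_geo 15709 19114 (colk 32 gap4_p gap4_q)"
  "cell gap4_geo 19114 22520 (colk 32 gap4_p gap4_q)"
  "cell gap4_geo 22520 25926 (colk 32 gap4_p gap4_q)"
  "cell gap4_geo 25926 29332 (colk 32 gap4_p gap4_q)"
  by (simp_all only: checker_rules cong: if_weak_cong)

lemma gap4_cover_1: "cover gap4_geo (colk 39 gap4_p gap4_q) [0, 3927, 5891, 7855, 11782, 15710]"
  by (simp only: cover.simps if_True gap4_cells_1_1 gap4_cells_1_2)

lemma gap4_cover_2: "cover gap4_geo (colk 32 gap4_p gap4_q) [15709, 19114, 22520, 25926, 29332]"
  by (simp only: cover.simps if_True gap4_cells_2_1)

lemma gap4_tower:
  assumes b: "near 1 (2 * pi * b) 263680726 50299789"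
  shows "tower (exp 1 - 2) (of_int 707197403 / TT) (of_int 713270756 / TT) (of_int BIG) b (39 * (exp 1 - 2) - 28) (23 - 32 * (exp 1 - 2))
     (of_int 15762, of_int 4473) (of_int 15471, of_int 5394) 39 32 28 23"
  by (rule tower_certificate[OF b rotation_near omega_irrational _ _ _ _ _ _ _ _ _ _ _ _ gap4_cover_1 _ _ _ gap4_cover_2])
    (use e_bounds in \<open>simp_all add: start_def BIG_def\<close>)

lemma gap4_count_1: "cell (GEO (- 53143391) (- 263122356) 708715741 711752417 1 263680726 50299789) 785 785 (cntk 39 5 (IV 15990784 5052416 0 0) (IV 15941632 5209088 0 0))"
  by (simp_all only: checker_rules cong: if_weak_cong)

lemma gap4_count_2: "cell (GEO (- 53143391) (- 263122356) 708715741 711752417 1 263680726 50299789) 16391 16391 (cntk 32 4 (IV 16080896 4768768 0 0) (IV 16057344 4844544 0 0))"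
  by (simp_all only: checker_rules cong: if_weak_cong)

lemma gap4_counted: "\<exists>b. counted_tower (exp 1 - 2) (of_int 707197403 / TT) (of_int 713270756 / TT) (of_int BIG) b (39 * (exp 1 - 2) - 28) (23 - 32 * (exp 1 - 2))
     (of_int 15762, of_int 4473) (of_int 15471, of_int 5394) 39 32 28 23 3 4"
proof -
  obtain b where b: "near 1 (2 * pi * b) 263680726 50299789" using phase_exists[of "263680726" "50299789"] by auto
  show ?thesis
    by (rule exI, rule counted_certificate[OF gap4_tower[OF b] b rotation_near _ _ _ gap4_count_1 _ _ _ _ gap4_count_2])
      (use e_bounds in \<open>simp_all add: witness_def start_def BIG_def\<close>)
qed

abbreviation "gap0_geo \<equiv> GEO (- 53143391) (- 263122356) 731763441 1342177280 3 263680726 50299789"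
abbreviation "gap0_p \<equiv> IV 16316 (- 1487) 0 0"
abbreviation "gap0_q \<equiv> IV 15499 5311 0 0"

lemma gap0_cells_1_1:
  "cell gap0_geo 0 3927 (colk 39 gap0_p gap0_q)"
  "cell gap0_geo 3927 7855 (colk 39 gap0_p gap0_q)"
  "cell gap0_geo 7855 11782 (colk 39 gap0_p gap0_q)"
  "cell gap0_geo 11782 15710 (colk 39 gap0_p gap0_q)"
  by (simp_all only: checker_rules cong: if_weak_cong)

lemma gap0_cells_2_1:
  "cell gap0_geo 15709 19114 (colk 32 gap0_p gap0_q)"
  "cell gap0_geo 19114 22520 (colk 32 gap0_p gap0_q)"
  "cell gap0_geo 22520 25926 (colk 32 gap0_p gap0_q)"
  "cell gap0_geo 25926 29332 (colk 32 gap0_p gap0_q)"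
  by (simp_all only: checker_rules cong: if_weak_cong)

lemma gap0_cover_1: "cover gap0_geo (colk 39 gap0_p gap0_q) [0, 3927, 7855, 11782, 15710]"
  by (simp only: cover.simps if_True gap0_cells_1_1)

lemma gap0_cover_2: "cover gap0_geo (colk 32 gap0_p gap0_q) [15709, 19114, 22520, 25926, 29332]"
  by (simp only: cover.simps if_True gap0_cells_2_1)

lemma gap0_tower:
  assumes b: "near 1 (2 * pi * b) 263680726 50299789"
  shows "tower (exp 1 - 2) (of_int 731763441 / TT) (of_int 1342177280 / TT) (of_int BIG) b (39 * (exp 1 - 2) - 28) (23 - 32 * (exp 1 - 2))
     (of_int 16316, of_int (- 1487)) (of_int 15499, of_int 5311) 39 32 28 23"
  by (rule tower_certificate[OF b rotation_near omega_irrational _ _ _ _ _ _ _ _ _ _ _ _ gap0_cover_1 _ _ _ gap0_cover_2])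
    (use e_bounds in \<open>simp_all add: start_def BIG_def\<close>)

text \<open>The mirrored tower yields the opposite label on the reflected interval.\<close>

lemma gap_pair:
  fixes \<theta> :: real
  assumes C: "\<exists>b. counted_tower \<omega> E1 E2 R b d1 d2 p q N1 N2 z1 z2 kap k"
    and I: "E1 \<le> lo" "lo \<le> hi" "hi \<le> E2" and fr: "0 < 1 - kap + k * \<omega>" "1 - kap + k * \<omega> < 1" and k: "k \<noteq> 0"
  shows "in_bounded_gap \<omega> \<theta> {lo<..<hi} k" "in_bounded_gap \<omega> \<theta> {- hi<..<- lo} (- k)"
proof -
  obtain b where b: "counted_tower \<omega> E1 E2 R b d1 d2 p q N1 N2 z1 z2 kap k" using C ..
  have z: "of_int k * \<omega> - (of_int (1 - kap) + of_int k * \<omega>) = of_int (kap - 1)"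
    "of_int (- k) * \<omega> - (of_int (1 - (1 - kap)) + of_int (- k) * \<omega>) = of_int (- kap)" by simp_all
  have f: "frac (of_int k * \<omega>) = of_int (1 - kap) + of_int k * \<omega>"
    unfolding frac_unique_iff z using fr by simp
  have f': "frac (of_int (- k) * \<omega>) = of_int (1 - (1 - kap)) + of_int (- k) * \<omega>"
    unfolding frac_unique_iff z using fr by simp
  show "in_bounded_gap \<omega> \<theta> {lo<..<hi} k"
    by (rule counted_tower.bounded_gap[OF b _ _ f k]) (use I in auto)
  show "in_bounded_gap \<omega> \<theta> {- hi<..<- lo} (- k)"
    by (rule counted_tower.bounded_gap[OF counted_tower_mir[OF b] _ _ f']) (use I k in auto)
qed

lemma outer_gap_mono:
  "in_upper_gap \<omega> \<theta> J \<Longrightarrow> I \<subseteq> J \<Longrightarrow> in_upper_gap \<omega> \<theta> I"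
  "in_lower_gap \<omega> \<theta> J \<Longrightarrow> I \<subseteq> J \<Longrightarrow> in_lower_gap \<omega> \<theta> I"
  unfolding in_upper_gap_def in_lower_gap_def by (meson subset_trans)+

theorem mainTheorem4:
  fixes \<omega> \<theta> :: real
  assumes "\<omega> = exp 1 - 2"
  shows "in_bounded_gap \<omega> \<theta> {-2.65714062500 <..< -2.63451562500} (-4)
    \<and> in_bounded_gap \<omega> \<theta> {-2.61414062500 <..< -2.55656250000} 3
    \<and> in_bounded_gap \<omega> \<theta> {-2.48323437500 <..< -0.801437500000} (-1)
    \<and> in_bounded_gap \<omega> \<theta> {-0.589406250000 <..< -0.096787500000} 2
    \<and> in_bounded_gap \<omega> \<theta> {0.096787500000 <..< 0.589406250000} (-2)
    \<and> in_bounded_gap \<omega> \<theta> {0.801437500000 <..< 2.48323437500} 1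
    \<and> in_bounded_gap \<omega> \<theta> {2.55656250000 <..< 2.61414062500} (-3)
    \<and> in_bounded_gap \<omega> \<theta> {2.63451562500 <..< 2.65714062500} 4
    \<and> in_lower_gap \<omega> \<theta> {..< -2.72603125000}
    \<and> in_upper_gap \<omega> \<theta> {2.72603125000 <..}"
  unfolding assms
proof (intro conjI)
  note g1 = gap_pair[OF gap1_counted, of "0.801437500000" "2.48323437500" \<theta>]
  note g2 = gap_pair[OF gap2_counted, of "0.096787500000" "0.589406250000" \<theta>]
  note g3 = gap_pair[OF gap3_counted, of "2.55656250000" "2.61414062500" \<theta>]
  note g4 = gap_pair[OF gap4_counted, of "2.63451562500" "2.65714062500" \<theta>]
  show "in_bounded_gap (exp 1 - 2) \<theta> {0.801437500000 <..< 2.48323437500} 1"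
    "in_bounded_gap (exp 1 - 2) \<theta> {-2.48323437500 <..< -0.801437500000} (-1)"
    by (rule g1; use e_bounds in simp)+
  show "in_bounded_gap (exp 1 - 2) \<theta> {0.096787500000 <..< 0.589406250000} (-2)"
    by (rule g2(1); use e_bounds in simp)
  show "in_bounded_gap (exp 1 - 2) \<theta> {-0.589406250000 <..< -0.096787500000} 2"
    by (rule g2(2)[unfolded minus_minus]; use e_bounds in simp)
  show "in_bounded_gap (exp 1 - 2) \<theta> {2.55656250000 <..< 2.61414062500} (-3)"
    by (rule g3(1); use e_bounds in simp)
  show "in_bounded_gap (exp 1 - 2) \<theta> {-2.61414062500 <..< -2.55656250000} 3"
    by (rule g3(2)[unfolded minus_minus]; use e_bounds in simp)
  show "in_bounded_gap (exp 1 - 2) \<theta> {2.63451562500 <..< 2.65714062500} 4"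
    "in_bounded_gap (exp 1 - 2) \<theta> {-2.65714062500 <..< -2.63451562500} (-4)"
    by (rule g4; use e_bounds in simp)+
  obtain b where b: "near 1 (2 * pi * b) 263680726 50299789" using phase_exists[of 263680726 50299789] by auto
  have "in_upper_gap (exp 1 - 2) \<theta> {of_int 731763441 / TT<..}"
    by (rule tower.upper_gap[OF gap0_tower[OF b]]) simp_all
  moreover have "{2.72603125000 <..} \<subseteq> {of_int 731763441 / TT<..}" by auto
  ultimately show "in_upper_gap (exp 1 - 2) \<theta> {2.72603125000 <..}" by (rule outer_gap_mono)
  have "in_lower_gap (exp 1 - 2) \<theta> {..<- (of_int 731763441 / TT)}"
    by (rule tower.lower_gap[OF tower_mir[OF gap0_tower[OF b]]]) simp_all
  moreover have "{..< -2.72603125000} \<subseteq> {..<- (of_int 731763441 / TT)}" by auto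
  ultimately show "in_lower_gap (exp 1 - 2) \<theta> {..< -2.72603125000}" by (rule outer_gap_mono)
qed

end
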